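(* For every $n\ge1$, $c_5(n)\equiv c_{10}(n)\pmod 2$. Moreover: (1) $c_5(2n)\equiv 0\pmod 2$ for $n\ge1$, and for all $n\ge0$, $c_5(8n+3)\equiv 0$, $c_5(40n+5+8i)\equiv 0$ for $i\in\{1,2,3,4\}$, and $c_5(40n+7+8j)\equiv0\pmod 2$ for $j\in\{0,2\}$. (2) For every $n\ge1$, $c_5(40n-1)\equiv c_{X_{10}}(n)\pmod 2$. (3) For every $n\ge1$, $c_5(40n-9)\equiv c_{\chi_{10}}(n)\pmod 2$. (4) For every $n\ge0$, $c_5(8n+1)\equiv c_5(40n+5)\pmod 2$, and $c_5(8n+1)\equiv1\pmod 2$ if and only if $n=\frac{k(k+1)}{2}$ for some integer $k\ge0$. (5) For every $n\ge0$, $c_5(40n+15)\equiv p_{10}(n)\pmod 2$.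
   Context: Let $q=e^{2\pi i\tau}$, $(a,q)_n=\prod_{k=0}^{n-1}(1-aq^k)$, $(q)_n=(q,q)_n$, with the obvious infinite versions; $\eta_k=q^{k/24}(q^k)_\infty$. Define $j_5=\eta_1^6/\eta_5^6$ and $j_{10}=\eta_2\eta_5^5/(\eta_1\eta_{10}^5)$. Each has an expansion $j_N(\tau)=q^{-1}+a_N+\sum_{n\ge1}c_N(n)q^n$, and $c_N(n)$ denotes the $n$-th Fourier coefficient. For a $q$-series $f$, $c_f(n)$ is the coefficient of $q^n$. The 10th order mock theta functions are $X_{10}(q)=\sum_{n\ge0}\frac{(-1)^nq^{n^2}}{(-q,q)_{2n}}$ and $\chi_{10}(q)=\sum_{n\ge0}\frac{(-1)^nq^{(n+1)^2}}{(-q,q)_{2n+1}}$. $p_{10}(n)$ is the number of partitions of $n$ in which no part is a multiple of $10$. *)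

theory Defs
  imports
    "HOL-Analysis.Analysis"
    "HOL-Computational_Algebra.Formal_Power_Series"
    "HOL-Library.Multiset"
    "HOL-Number_Theory.Cong"
begin

text \<open>
  The finite symbol \<open>(a,q)\<^sub>n\<close> is stated for an arbitrary commutative ring, so that \<open>q\<close> can be
  the indeterminate of a ring of formal power series.
\<close>

definition qpoch :: "'a::comm_ring_1 \<Rightarrow> 'a \<Rightarrow> nat \<Rightarrow> 'a" where
  "qpoch a q n = (\<Prod>k<n. 1 - a * q ^ k)"

definition qpoch_inf :: "complex \<Rightarrow> complex \<Rightarrow> complex" where
  "qpoch_inf a q = (\<Prod>k. 1 - a * q ^ k)"

definition nome :: "complex \<Rightarrow> complex" where
  "nome \<tau> = exp (2 * of_real pi * \<i> * \<tau>)"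

text \<open>The power \<open>q\<^bsup>k/24\<^esup>\<close> means \<open>exp (2 \<pi> \<i> k \<tau> / 24)\<close>.\<close>

definition eta :: "nat \<Rightarrow> complex \<Rightarrow> complex" where
  "eta k \<tau> = exp (2 * of_real pi * \<i> * of_nat k * \<tau> / 24) * qpoch_inf (nome \<tau> ^ k) (nome \<tau> ^ k)"

definition j5 :: "complex \<Rightarrow> complex" where
  "j5 \<tau> = eta 1 \<tau> ^ 6 / eta 5 \<tau> ^ 6"

definition j10 :: "complex \<Rightarrow> complex" where
  "j10 \<tau> = eta 2 \<tau> * eta 5 \<tau> ^ 5 / (eta 1 \<tau> * eta 10 \<tau> ^ 5)"

text \<open>
  \<open>f(\<tau>) = q\<^sup>-\<^sup>1 + c(0) + (\<Sum>n\<ge>1. c(n) q\<^sup>n)\<close> on the upper half plane, with integral coefficients;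
  such a family \<open>c\<close>, indexed by all integers, is unique (see below).
\<close>

definition has_q_expansion :: "(complex \<Rightarrow> complex) \<Rightarrow> (int \<Rightarrow> int) \<Rightarrow> bool" where
  "has_q_expansion f c \<longleftrightarrow>
     (\<forall>n < -1. c n = 0) \<and> c (-1) = 1 \<and>
     (\<forall>\<tau>. Im \<tau> > 0 \<longrightarrow>
        (\<lambda>n. of_int (c (int n)) * nome \<tau> ^ n) sums (f \<tau> - inverse (nome \<tau>)))"

lemma has_q_expansion_unique:
  assumes "has_q_expansion f c" and "has_q_expansion f d"
  shows "c = d"
proof -
  define a where "a n = (of_int (c (int n)) - of_int (d (int n)) :: complex)" for n
  have sums0: "(\<lambda>n. a n * q ^ n) sums 0" if q: "q \<noteq> 0" "norm q < 1" for q
  proof -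
    define \<tau> where "\<tau> = Ln q / (2 * of_real pi * \<i>)"
    have "Im \<tau> = - ln (norm q) / (2 * pi)"
      using q by (simp add: \<tau>_def Im_divide power2_eq_square field_simps)
    moreover have "ln (norm q) < 0" using q by simp
    ultimately have "Im \<tau> > 0" by (simp add: divide_neg_pos)
    moreover have "nome \<tau> = q" using q by (simp add: nome_def \<tau>_def)
    ultimately have
      "(\<lambda>n. of_int (c (int n)) * q ^ n) sums (f \<tau> - inverse q)"
      "(\<lambda>n. of_int (d (int n)) * q ^ n) sums (f \<tau> - inverse q)"
      using assms unfolding has_q_expansion_def by metis+
    from sums_diff[OF this] show ?thesis by (simp add: a_def algebra_simps)
  qed
  have "a n = 0" for n
  proof (induction n rule: less_induct)
    case (less n)
    define b where "b k = a (k + n)" for k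
    define g where "g z = (if z = 0 then a n else 0)" for z :: complex
    have bs: "(\<lambda>k. b k * z ^ k) sums g z" if z: "norm z < 1" for z
    proof (cases "z = 0")
      case True
      then show ?thesis using powser_sums_zero[of b] by (simp add: g_def b_def)
    next
      case False
      have "(\<lambda>k. a (k + n) * z ^ (k + n)) sums 0"
        using sums_split_initial_segment[OF sums0[OF False z], of n] less by simp
      from sums_divide[OF this, of "z ^ n"] False show ?thesis
        by (simp add: g_def b_def power_add)
    qed
    have "(g \<longlongrightarrow> b 0) (at 0)"
      by (rule powser_limit_0[where s = 1]) (use bs in auto)
    moreover have "(g \<longlongrightarrow> 0) (at 0)"
      by (rule tendsto_eventually) (auto simp: g_def eventually_at_filter)
    ultimately have "b 0 = 0" by (rule tendsto_unique[rotated]) auto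
    then show ?case by (simp add: b_def)
  qed
  then have nonneg: "c (int n) = d (int n)" for n
    by (simp add: a_def)
  show "c = d"
  proof
    fix n :: int
    consider "n < -1" | "n = -1" | "n \<ge> 0" by linarith
    then show "c n = d n"
      by cases (use assms nonneg[of "nat n"] in \<open>auto simp: has_q_expansion_def\<close>)
  qed
qed

definition fourier_coeff :: "(complex \<Rightarrow> complex) \<Rightarrow> int \<Rightarrow> int" where
  "fourier_coeff f = (THE c. has_q_expansion f c)"

abbreviation c5 :: "int \<Rightarrow> int" where "c5 \<equiv> fourier_coeff j5"

abbreviation c10 :: "int \<Rightarrow> int" where "c10 \<equiv> fourier_coeff j10"

text \<open>
  The \<open>q\<close>-series below are elements of \<open>\<int>[[q]]\<close>, with \<open>q = fps_X\<close>, and the infinite sums are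
  taken in the \<open>q\<close>-adic topology.  There is no division on \<open>int fps\<close>; the denominators have
  constant term \<open>1\<close>, for which \<open>fps_right_inverse _ 1\<close> is the multiplicative inverse.
\<close>

definition X10 :: "int fps" where
  "X10 = (\<Sum>n. (-1) ^ n * fps_X ^ (n\<^sup>2) * fps_right_inverse (qpoch (- fps_X) fps_X (2 * n)) 1)"

definition chi10 :: "int fps" where
  "chi10 = (\<Sum>n. (-1) ^ n * fps_X ^ ((n + 1)\<^sup>2) *
              fps_right_inverse (qpoch (- fps_X) fps_X (2 * n + 1)) 1)"

lemma qpoch_inverse:
  "qpoch (- fps_X) fps_X n * fps_right_inverse (qpoch (- fps_X) fps_X n) 1 = (1 :: int fps)"
proof -
  have "fps_nth (qpoch (- fps_X) fps_X n :: int fps) 0 = 1"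
    by (induction n) (auto simp: qpoch_def)
  then show ?thesis by (intro fps_right_inverse) simp
qed

definition p10 :: "nat \<Rightarrow> nat" where
  "p10 n = card {M :: nat multiset. sum_mset M = n \<and> (\<forall>m\<in>#M. 0 < m \<and> \<not> 10 dvd m)}"

end

theory Submission
  imports Defs "HOL-Complex_Analysis.Complex_Analysis" "HOL-Library.Z2"
begin

text \<open>
  Write \<open>f\<^sub>k = (q\<^sup>k)\<^sub>\<infinity>\<close> and work over the field with two elements, where \<open>f\<^sub>k\<^sup>2 = f\<^sub>2\<^sub>k\<close>.  The key relation is
  \<open>f\<^sub>1 f\<^sub>5 = f\<^sub>1\<^sup>6 + q f\<^sub>5\<^sup>6\<close>: by the Jacobi triple product the left-hand side counts representations of
  \<open>8N + 2\<close> as \<open>x\<^sup>2 + y\<^sup>2\<close> with \<open>x\<close>, \<open>y\<close> odd and \<open>2x + y = 2\<close> modulo 5, and sign changes, exchanges of the coordinates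
  and division by a Gaussian prime of norm 5 determine the parity of that number.  It shows at once that
  \<open>j\<^sub>5\<close> and \<open>j\<^sub>1\<^sub>0\<close> differ by a constant, and yields the 4-dissection
  \<open>f\<^sub>1\<^sup>3/f\<^sub>5\<^sup>3 = f\<^sub>8/f\<^sub>2\<^sub>0 + q f\<^sub>4\<^sup>3 + q\<^sup>3 f\<^sub>2\<^sub>0\<^sup>3\<close>, whose square is \<open>q j\<^sub>5\<close>.  Everything else is read off from
  \<open>f\<^sub>1\<^sup>3 = \<Sum> q\<^bsup>k(k+1)/2\<^esup>\<close> and the 5-dissection of \<open>f\<^sub>2/f\<^sub>5\<close> given by the pentagonal number theorem.  For the mock
  theta functions, signs disappear modulo 2, and the Bailey pair with \<open>\<beta>\<^sub>n = 1/(q)\<^sub>2\<^sub>n\<close> turns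
  \<open>\<Sum> q\<^bsup>n\<^sup>2\<^esup>/(q)\<^sub>2\<^sub>n\<close> and \<open>\<Sum> q\<^bsup>(n+1)\<^sup>2\<^esup>/(q)\<^sub>2\<^sub>n\<^sub>+\<^sub>1\<close> into theta series divided by \<open>f\<^sub>1\<close>.
\<close>

unbundle no vec_syntax
unbundle fps_syntax

text \<open>These rules rewrite sums and products into bitwise operations and hide the ring structure.\<close>

declare add_bit_eq_xor [simp del] mult_bit_eq_and [simp del] bit_not_zero_iff [simp del] bit_not_one_iff [simp del]
  power_bit_unfold [simp del]

subsection \<open>Locally finite sums of formal power series\<close>

text \<open>For m >= 1, c_5(8m - 1) has the parity of the coefficient of q^m in f_2/f_5. As f_5 is a
  series in q^5, the residue of m modulo 5 sorts the claims: the sections of f_2 at 0 and 4 lead to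
  the two mock theta functions, the section at 2 is f_10 and leads to the partitions, and those at 1
  and 3 vanish. The other quarters of the 4-dissection give the indices 8n + 1 and 8n + 5, and its
  missing quarter gives 8n + 3. The constant between j_5 and j_10 comes from q j_10 = f_1/f_5^5 =
  f_1 f_5/f_5^6 = q j_5 + q modulo 2. The eta quotients are complex functions, the mock theta
  functions live in the ring of integral series, and the identities hold only modulo 2. Both sides
  are therefore expressed by integral series and reduced to \<open>bit\<close>, where the theta
  identities are proved directly. These are obtained from finite forms: reciprocals of q-factorials
  that vanish at negative index satisfy recurrences at all integers, and bilateral sums then need no
  boundary terms.\<close>

definition fps_summable :: "('i \<Rightarrow> 'a::comm_monoid_add fps) \<Rightarrow> bool" where
  "fps_summable F \<longleftrightarrow> (\<forall>n. finite {i. F i $ n \<noteq> 0})"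

text \<open>The index sets are the integers and pairs of integers, without an order of summation.
  Local finiteness turns reindexing and interchange into finite statements about each
  coefficient.\<close>

definition fps_sum :: "('i \<Rightarrow> 'a::comm_monoid_add fps) \<Rightarrow> 'a fps" where
  "fps_sum F = Abs_fps (\<lambda>n. \<Sum>i | F i $ n \<noteq> 0. F i $ n)"

lemma fps_summableD: "fps_summable F \<Longrightarrow> finite {i. F i $ n \<noteq> 0}"
  by (simp add: fps_summable_def)

lemma fps_sum_nth_superset:
  assumes "finite A" "\<And>i. F i $ n \<noteq> 0 \<Longrightarrow> i \<in> A"
  shows "fps_sum F $ n = (\<Sum>i\<in>A. F i $ n)"
  unfolding fps_sum_def fps_nth_Abs_fps
  by (rule sum.mono_neutral_left) (use assms in auto)

lemma fps_summable_add:
  assumes "fps_summable F" "fps_summable G"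
  shows "fps_summable (\<lambda>i. F i + G i)"
  unfolding fps_summable_def
proof
  fix n
  have "{i. (F i + G i) $ n \<noteq> 0} \<subseteq> {i. F i $ n \<noteq> 0} \<union> {i. G i $ n \<noteq> 0}"
    by auto
  then show "finite {i. (F i + G i) $ n \<noteq> 0}"
    by (rule finite_subset) (use assms in \<open>simp add: fps_summableD\<close>)
qed

lemma fps_sum_add:
  assumes "fps_summable F" "fps_summable G"
  shows "fps_sum (\<lambda>i. F i + G i) = fps_sum F + fps_sum G"
proof (rule fps_ext)
  fix n
  let ?A = "{i. F i $ n \<noteq> 0} \<union> {i. G i $ n \<noteq> 0}"
  have fin: "finite ?A" using assms by (simp add: fps_summableD)
  have "fps_sum (\<lambda>i. F i + G i) $ n = (\<Sum>i\<in>?A. (F i + G i) $ n)"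
    by (rule fps_sum_nth_superset[OF fin]) auto
  also have "\<dots> = (\<Sum>i\<in>?A. F i $ n) + (\<Sum>i\<in>?A. G i $ n)"
    by (simp add: sum.distrib)
  also have "(\<Sum>i\<in>?A. F i $ n) = fps_sum F $ n"
    by (rule fps_sum_nth_superset[OF fin, symmetric]) auto
  also have "(\<Sum>i\<in>?A. G i $ n) = fps_sum G $ n"
    by (rule fps_sum_nth_superset[OF fin, symmetric]) auto
  finally show "fps_sum (\<lambda>i. F i + G i) $ n = (fps_sum F + fps_sum G) $ n" by simp
qed

lemma fps_mult_nth_nonzero:
  fixes f g :: "'a::comm_ring_1 fps"
  assumes "(f * g) $ n \<noteq> 0"
  obtains k where "k \<le> n" "f $ k \<noteq> 0" "g $ (n - k) \<noteq> 0"
proof -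
  have "\<exists>k\<in>{0..n}. f $ k * g $ (n - k) \<noteq> 0"
    using assms sum.neutral[of "{0..n}" "\<lambda>k. f $ k * g $ (n - k)"] unfolding fps_mult_nth by blast
  then show ?thesis using that by force
qed

lemma fps_sum_mult_left:
  fixes F :: "'i \<Rightarrow> 'a::comm_ring_1 fps"
  assumes "fps_summable F"
  shows "fps_sum (\<lambda>i. c * F i) = c * fps_sum F"
proof (rule fps_ext)
  fix n
  let ?A = "\<Union>k\<le>n. {i. F i $ k \<noteq> 0}"
  have fin: "finite ?A" using assms by (simp add: fps_summableD)
  have nth: "fps_sum F $ k = (\<Sum>i\<in>?A. F i $ k)" if "k \<le> n" for k
    by (rule fps_sum_nth_superset[OF fin]) (use that in auto)
  have "fps_sum (\<lambda>i. c * F i) $ n = (\<Sum>i\<in>?A. (c * F i) $ n)"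
  proof (rule fps_sum_nth_superset[OF fin])
    fix i assume "(c * F i) $ n \<noteq> 0"
    then obtain k where "k \<le> n" "F i $ (n - k) \<noteq> 0" by (rule fps_mult_nth_nonzero)
    then show "i \<in> ?A" by (intro UN_I[of "n - k"]) auto
  qed
  also have "\<dots> = (\<Sum>k=0..n. \<Sum>i\<in>?A. c $ k * F i $ (n - k))"
    unfolding fps_mult_nth by (rule sum.swap)
  also have "\<dots> = (\<Sum>k=0..n. c $ k * fps_sum F $ (n - k))"
    by (simp add: nth sum_distrib_left)
  also have "\<dots> = (c * fps_sum F) $ n"
    by (simp add: fps_mult_nth)
  finally show "fps_sum (\<lambda>i. c * F i) $ n = (c * fps_sum F) $ n" .
qed

lemma fps_summable_reindex:
  assumes "inj h" "fps_summable F"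
  shows "fps_summable (\<lambda>i. F (h i))"
  unfolding fps_summable_def
proof
  fix n
  have "h ` {i. F (h i) $ n \<noteq> 0} \<subseteq> {i. F i $ n \<noteq> 0}" by auto
  then have "finite (h ` {i. F (h i) $ n \<noteq> 0})"
    using assms(2) fps_summableD finite_subset by blast
  then show "finite {i. F (h i) $ n \<noteq> 0}"
    by (rule finite_imageD) (use assms(1) inj_on_subset in blast)
qed

lemma fps_sum_reindex:
  assumes "inj h" "fps_summable F" "\<And>i. i \<notin> range h \<Longrightarrow> F i = 0"
  shows "fps_sum (\<lambda>i. F (h i)) = fps_sum F"
proof (rule fps_ext)
  fix n
  have fin: "finite {i. F (h i) $ n \<noteq> 0}"
    using fps_summable_reindex[OF assms(1,2)] by (rule fps_summableD)
  have eq: "{i. F i $ n \<noteq> 0} = h ` {i. F (h i) $ n \<noteq> 0}"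
    using assms(3) by fastforce
  show "fps_sum (\<lambda>i. F (h i)) $ n = fps_sum F $ n"
    unfolding fps_sum_def fps_nth_Abs_fps eq
    by (subst sum.reindex) (use assms(1) inj_on_subset in \<open>auto simp: o_def\<close>)
qed

lemma fps_sum_Sigma:
  fixes F :: "'i \<times> 'j \<Rightarrow> 'a::comm_monoid_add fps"
  assumes "fps_summable F"
  shows "fps_sum F = fps_sum (\<lambda>i. fps_sum (\<lambda>j. F (i, j)))"
proof (rule fps_ext)
  fix n
  let ?S = "{p. F p $ n \<noteq> 0}"
  let ?A = "fst ` ?S" and ?B = "snd ` ?S"
  have fin: "finite ?A" "finite ?B" using assms by (simp_all add: fps_summableD)
  have sub: "i \<in> ?A \<and> j \<in> ?B" if "F (i, j) $ n \<noteq> 0" for i j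
    using that by (auto simp: image_iff)
  have inner: "fps_sum (\<lambda>j. F (i, j)) $ n = (\<Sum>j\<in>?B. F (i, j) $ n)" for i
    by (rule fps_sum_nth_superset[OF fin(2)]) (use sub in blast)
  have "fps_sum (\<lambda>i. fps_sum (\<lambda>j. F (i, j))) $ n = (\<Sum>i\<in>?A. \<Sum>j\<in>?B. F (i, j) $ n)"
    unfolding inner[symmetric]
  proof (rule fps_sum_nth_superset[OF fin(1)])
    fix i assume "fps_sum (\<lambda>j. F (i, j)) $ n \<noteq> 0"
    then have "\<exists>j\<in>?B. F (i, j) $ n \<noteq> 0" unfolding inner by (meson sum.neutral)
    then show "i \<in> ?A" using sub by blast
  qed
  also have "\<dots> = (\<Sum>p\<in>?A \<times> ?B. F p $ n)"
    by (simp add: sum.cartesian_product)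
  also have "\<dots> = fps_sum F $ n"
    by (rule fps_sum_nth_superset[symmetric]) (use fin sub in auto)
  finally show "fps_sum F $ n = fps_sum (\<lambda>i. fps_sum (\<lambda>j. F (i, j))) $ n" by simp
qed

lemma fps_sum_swap:
  fixes F :: "'i \<times> 'j \<Rightarrow> 'a::comm_monoid_add fps"
  assumes "fps_summable F"
  shows "fps_sum (\<lambda>i. fps_sum (\<lambda>j. F (i, j))) = fps_sum (\<lambda>j. fps_sum (\<lambda>i. F (i, j)))"
proof -
  have "fps_sum F = fps_sum (\<lambda>p. F (prod.swap p))"
    by (rule fps_sum_reindex[symmetric]) (use assms in auto)
  also have "\<dots> = fps_sum (\<lambda>j. fps_sum (\<lambda>i. F (i, j)))"
    using fps_sum_Sigma[of "\<lambda>p. F (prod.swap p)"] fps_summable_reindex[OF inj_swap assms] by simp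
  finally show ?thesis using fps_sum_Sigma[OF assms] by simp
qed

lemma fps_sum_mult:
  fixes F :: "'i \<Rightarrow> 'a::comm_ring_1 fps" and G :: "'j \<Rightarrow> 'a fps"
  assumes "fps_summable F" "fps_summable G"
  shows "fps_sum F * fps_sum G = fps_sum (\<lambda>(i, j). F i * G j)"
proof -
  have "fps_summable (\<lambda>(i, j). F i * G j)"
    unfolding fps_summable_def
  proof
    fix n
    have "{p. (case p of (i, j) \<Rightarrow> F i * G j) $ n \<noteq> 0}
        \<subseteq> (\<Union>k\<le>n. {i. F i $ k \<noteq> 0} \<times> {j. G j $ (n - k) \<noteq> 0})"
      by (auto elim!: fps_mult_nth_nonzero)
    then show "finite {p. (case p of (i, j) \<Rightarrow> F i * G j) $ n \<noteq> 0}"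
      by (rule finite_subset) (use assms in \<open>auto simp: fps_summableD\<close>)
  qed
  from fps_sum_Sigma[OF this] show ?thesis
    using fps_sum_mult_left[OF assms(2)] fps_sum_mult_left[OF assms(1), of "fps_sum G"]
    by (simp add: mult.commute)
qed

subsection \<open>Congruences modulo powers of the indeterminate\<close>

lemma fps_X_power_dvd_iff:
  "fps_X ^ n dvd (f :: 'a::comm_ring_1 fps) \<longleftrightarrow> (\<forall>k<n. f $ k = 0)"
proof
  assume "fps_X ^ n dvd f"
  then show "\<forall>k<n. f $ k = 0" by (auto elim!: dvdE simp: fps_X_power_mult_nth)
next
  assume "\<forall>k<n. f $ k = 0"
  then have "f = fps_X ^ n * fps_shift n f" by (auto simp: fps_eq_iff fps_X_power_mult_nth)
  then show "fps_X ^ n dvd f" by (metis dvd_triv_left)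
qed

text \<open>Stands in for passage to the limit: two infinite expressions agree once suitable
  truncations of them agree modulo every power of the indeterminate.\<close>

lemma fps_eq_if_dvd_diff:
  fixes f g :: "'a::comm_ring_1 fps"
  assumes "\<And>n. fps_X ^ n dvd f - g"
  shows "f = g"
proof (rule fps_ext)
  fix n
  show "f $ n = g $ n"
    using assms[of "Suc n"] unfolding fps_X_power_dvd_iff by auto
qed

lemma dvd_diff_mult:
  fixes a :: "'a::comm_ring_1"
  assumes "d dvd a - b" "d dvd a' - b'"
  shows "d dvd a * a' - b * b'"
proof -
  have "a * a' - b * b' = a * (a' - b') + (a - b) * b'" by (simp add: algebra_simps)
  then show ?thesis using assms by simp
qed

lemma dvd_diff_inverse:
  fixes f g :: "'a::field fps"
  assumes "d dvd f - g" "f $ 0 \<noteq> 0" "g $ 0 \<noteq> 0"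
  shows "d dvd inverse f - inverse g"
proof -
  have *: "inverse f * f = 1" "inverse g * g = 1" using assms by (auto intro: inverse_mult_eq_1)
  have "inverse f - inverse g = inverse f * (inverse g * g) - (inverse f * f) * inverse g"
    using * by simp
  also have "\<dots> = - (inverse f * inverse g * (f - g))" by (simp add: algebra_simps)
  finally show ?thesis using assms(1) by simp
qed

lemma dvd_diff_trans: "(d :: 'a::comm_ring_1) dvd a - b \<Longrightarrow> d dvd b - c \<Longrightarrow> d dvd a - c"
  using dvd_add[of d "a - b" "b - c"] by simp

subsection \<open>Infinite products over sets of exponents\<close>

text \<open>The exponent \<open>0\<close> is ignored, so that \<open>{s. k dvd s}\<close> can be used as an index set.\<close>

definition eprod :: "nat set \<Rightarrow> 'a::comm_ring_1 fps" where
  "eprod S = Abs_fps (\<lambda>n. (\<Prod>s\<in>S \<inter> {1..n}. 1 - fps_X ^ s) $ n)"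

lemma prod_one_minus_X_dvd:
  assumes "finite A" "\<And>s. s \<in> A \<Longrightarrow> s > n"
  shows "fps_X ^ Suc n dvd (\<Prod>s\<in>A. 1 - fps_X ^ s) - (1 :: 'a::comm_ring_1 fps)"
  using assms
proof (induction A rule: finite_induct)
  case (insert s A)
  have "fps_X ^ Suc n dvd (1 - fps_X ^ s) - (1 :: 'a fps)"
    using insert.prems[of s] by (simp add: le_imp_power_dvd del: power_Suc)
  from dvd_diff_mult[OF this insert.IH] show ?case using insert by simp
qed auto

lemma eprod_dvd:
  assumes "finite A" "A \<subseteq> S - {0}" "S \<inter> {1..n} \<subseteq> A"
  shows "fps_X ^ Suc n dvd (\<Prod>s\<in>A. 1 - fps_X ^ s) - (eprod S :: 'a::comm_ring_1 fps)"
proof -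
  have *: "fps_X ^ Suc m dvd (\<Prod>s\<in>B. 1 - fps_X ^ s) - (\<Prod>s\<in>S \<inter> {1..m}. 1 - fps_X ^ s :: 'a fps)"
    if B: "finite B" "B \<subseteq> S - {0}" "S \<inter> {1..m} \<subseteq> B" for B m
  proof -
    have "(\<Prod>s\<in>B. 1 - fps_X ^ s :: 'a fps) =
        (\<Prod>s\<in>S \<inter> {1..m}. 1 - fps_X ^ s) * (\<Prod>s\<in>B - S \<inter> {1..m}. 1 - fps_X ^ s)"
      using B by (simp add: prod.subset_diff[of "S \<inter> {1..m}" B] mult.commute)
    moreover have "s > m" if "s \<in> B - S \<inter> {1..m}" for s
    proof -
      have "s \<in> S" "s \<noteq> 0" "\<not> s \<in> {1..m}" using that B(2) by auto
      then show ?thesis by auto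
    qed
    then have "fps_X ^ Suc m dvd (\<Prod>s\<in>B - S \<inter> {1..m}. 1 - fps_X ^ s) - (1 :: 'a fps)"
      by (intro prod_one_minus_X_dvd) (use B in auto)
    then have "fps_X ^ Suc m dvd (\<Prod>s\<in>S \<inter> {1..m}. 1 - fps_X ^ s) *
        ((\<Prod>s\<in>B - S \<inter> {1..m}. 1 - fps_X ^ s) - (1 :: 'a fps))"
      by (rule dvd_mult)
    ultimately show ?thesis
      by (simp only: right_diff_distrib mult_1_right)
  qed
  show ?thesis
    unfolding fps_X_power_dvd_iff
  proof (intro allI impI)
    fix k assume k: "k < Suc n"
    \<comment> \<open>Coefficient k of \<open>eprod S\<close> is defined by the truncation at k, not
      at n, so each coefficient needs its own comparison.\<close>
    have "fps_X ^ Suc k dvd (\<Prod>s\<in>A. 1 - fps_X ^ s) - (\<Prod>s\<in>S \<inter> {1..k}. 1 - fps_X ^ s :: 'a fps)"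
      by (rule *) (use assms k in auto)
    then show "((\<Prod>s\<in>A. 1 - fps_X ^ s) - (eprod S :: 'a fps)) $ k = 0"
      unfolding fps_X_power_dvd_iff eprod_def by simp
  qed
qed

lemma eprod_dvd': "fps_X ^ Suc n dvd (\<Prod>s\<in>S \<inter> {1..n}. 1 - fps_X ^ s) - (eprod S :: 'a::comm_ring_1 fps)"
  by (rule eprod_dvd) auto

lemma eprod_nth_0 [simp]: "eprod S $ 0 = 1"
  by (simp add: eprod_def)

lemma eprod_Un:
  assumes "S \<inter> T \<subseteq> {0}"
  shows "eprod (S \<union> T) = eprod S * (eprod T :: 'a::comm_ring_1 fps)"
proof (rule fps_eq_if_dvd_diff)
  fix n
  have "(\<Prod>s\<in>(S \<union> T) \<inter> {1..n}. 1 - fps_X ^ s :: 'a fps) =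
      (\<Prod>s\<in>S \<inter> {1..n} \<union> T \<inter> {1..n}. 1 - fps_X ^ s)"
    by (simp add: Int_Un_distrib2)
  also have "\<dots> = (\<Prod>s\<in>S \<inter> {1..n}. 1 - fps_X ^ s) * (\<Prod>s\<in>T \<inter> {1..n}. 1 - fps_X ^ s)"
    by (rule prod.union_disjoint) (use assms in auto)
  finally have "fps_X ^ Suc n dvd (\<Prod>s\<in>(S \<union> T) \<inter> {1..n}. 1 - fps_X ^ s) - eprod S * (eprod T :: 'a fps)"
    using dvd_diff_mult[OF eprod_dvd'[of n S] eprod_dvd'[of n T]] by simp
  moreover have "fps_X ^ Suc n dvd eprod (S \<union> T) - (\<Prod>s\<in>(S \<union> T) \<inter> {1..n}. 1 - fps_X ^ s :: 'a fps)"
    using dvd_minus_iff[THEN iffD2, OF eprod_dvd'[of n "S \<union> T", where ?'a = 'a]] by (simp only: minus_diff_eq)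
  ultimately have "fps_X ^ Suc n dvd eprod (S \<union> T) - eprod S * (eprod T :: 'a fps)"
    by (rule dvd_diff_trans[rotated])
  then show "fps_X ^ n dvd eprod (S \<union> T) - eprod S * (eprod T :: 'a fps)"
    by (rule power_le_dvd) simp
qed

lemma fps_compose_X_power_nth:
  assumes "k > 0"
  shows "((f :: 'a::comm_ring_1 fps) oo fps_X ^ k) $ n = (if k dvd n then f $ (n div k) else 0)"
proof -
  have "(f oo fps_X ^ k) $ n = (\<Sum>i=0..n. if n = k * i then f $ i else 0)"
    by (simp add: fps_compose_nth fps_X_power_nth if_distrib flip: power_mult cong: if_cong)
  also have "\<dots> = (\<Sum>i=0..n. if i = n div k then (if k dvd n then f $ (n div k) else 0) else 0)"
    by (rule sum.cong) (use assms in auto)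
  also have "\<dots> = (if k dvd n then f $ (n div k) else 0)"
    by (simp add: sum.delta)
  finally show ?thesis .
qed

lemma eprod_image_times:
  assumes "k > 0"
  shows "eprod ((*) k ` S) = (eprod S :: 'a::idom fps) oo fps_X ^ k"
proof (rule fps_ext)
  fix n
  have X0: "(fps_X ^ k :: 'a fps) $ 0 = 0" using assms by simp
  let ?B = "S \<inter> {1..n}"
  have "fps_X ^ Suc n dvd (\<Prod>s\<in>(*) k ` ?B. 1 - fps_X ^ s) - (eprod ((*) k ` S) :: 'a fps)"
  proof (rule eprod_dvd)
    show "(*) k ` S \<inter> {1..n} \<subseteq> (*) k ` ?B"
    proof
      fix s assume "s \<in> (*) k ` S \<inter> {1..n}"
      then obtain t where t: "t \<in> S" "s = k * t" "1 \<le> k * t" "k * t \<le> n" by auto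
      have "t \<le> k * t" using assms by simp
      then have "t \<le> n" using t(4) by linarith
      then have "t \<in> ?B" using t by (cases t) auto
      then show "s \<in> (*) k ` ?B" using t(2) by blast
    qed
  qed (use assms in auto)
  then have "eprod ((*) k ` S) $ n = (\<Prod>s\<in>(*) k ` ?B. 1 - fps_X ^ s :: 'a fps) $ n"
    unfolding fps_X_power_dvd_iff by simp
  also have "(\<Prod>s\<in>(*) k ` ?B. 1 - fps_X ^ s :: 'a fps) = (\<Prod>s\<in>?B. 1 - (fps_X ^ k) ^ s)"
    using assms by (subst prod.reindex) (auto simp: inj_on_def power_mult)
  also have "\<dots> = (\<Prod>s\<in>?B. 1 - fps_X ^ s) oo fps_X ^ k"
  proof -
    have "(1 - fps_X ^ s :: 'a fps) oo fps_X ^ k = 1 - (fps_X ^ k) ^ s" for s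
      using X0 by (simp add: fps_compose_sub_distrib flip: fps_compose_power)
    then show ?thesis using X0 by (simp add: fps_compose_prod_distrib)
  qed
  also have "\<dots> $ n = (eprod S oo fps_X ^ k) $ n"
  proof -
    have "(\<Prod>s\<in>?B. 1 - fps_X ^ s :: 'a fps) $ i = eprod S $ i" if "i \<le> n" for i
      using eprod_dvd'[of n S, where ?'a = 'a] that unfolding fps_X_power_dvd_iff by auto
    then show ?thesis using assms by (simp add: fps_compose_X_power_nth)
  qed
  finally show "eprod ((*) k ` S) $ n = (eprod S oo fps_X ^ k :: 'a fps) $ n" .
qed

subsection \<open>Characteristic two\<close>

lemma fps_bit_add_self [simp]: "(f :: bit fps) + f = 0"
proof -
  have "f + f = 2 * f" by (rule mult_2[symmetric])
  also have "(2 :: bit fps) = 0" by (simp add: fps_numeral_fps_const)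
  finally show ?thesis by simp
qed

lemma fps_bit_add_self_left [simp]: "(f :: bit fps) + (f + g) = g"
  by (simp flip: add.assoc)

lemma fps_bit_uminus: "- (f :: bit fps) = f"
  using fps_bit_add_self[of f] by (simp only: neg_eq_iff_add_eq_0)

lemma fps_bit_minus: "(f :: bit fps) - g = f + g"
  using fps_bit_uminus[of g] by (simp only: diff_conv_add_uminus)

lemma fps_sum_dvd:
  fixes F :: "'i \<Rightarrow> 'a::comm_ring_1 fps"
  assumes "\<And>i. fps_X ^ n dvd F i"
  shows "fps_X ^ n dvd fps_sum F"
  using assms unfolding fps_X_power_dvd_iff fps_sum_def by simp

lemma fps_bit_sum_dvd_diff:
  fixes F G :: "'i \<Rightarrow> bit fps"
  assumes "fps_summable F" "fps_summable G" "\<And>i. fps_X ^ n dvd F i - G i"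
  shows "fps_X ^ n dvd fps_sum F - fps_sum G"
  using fps_sum_dvd[of n "\<lambda>i. F i - G i", OF assms(3)] fps_sum_add[OF assms(1,2)] by (simp add: fps_bit_minus)

lemma dvd_diff_trans': "(d :: 'a::comm_ring_1) dvd a - b \<Longrightarrow> d dvd a - c \<Longrightarrow> d dvd b - c"
  using dvd_diff[of d "a - c" "a - b"] by simp

text \<open>Exponents below are quadratic polynomials in an integer. A negative exponent yields 1,
  so additivity needs both exponents nonnegative; where this fails, a vanishing
  \<open>qfact_inv\<close> factor saves the identity.\<close>

definition Xpow :: "int \<Rightarrow> bit fps" where
  "Xpow i = fps_X ^ nat i"

lemma Xpow_add: "i \<ge> 0 \<Longrightarrow> j \<ge> 0 \<Longrightarrow> Xpow (i + j) = Xpow i * Xpow j"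
  by (simp add: Xpow_def nat_add_distrib power_add)

lemma Xpow_0 [simp]: "Xpow 0 = 1"
  by (simp add: Xpow_def)

lemma Xpow_int [simp]: "Xpow (int n) = fps_X ^ n"
  by (simp add: Xpow_def)

lemma Xpow_nth: "Xpow i $ n = of_bool (nat i = n)"
  by (simp add: Xpow_def fps_X_power_nth eq_commute)

lemma fps_X_power_dvd_Xpow: "int n \<le> i \<Longrightarrow> fps_X ^ n dvd Xpow i"
  unfolding Xpow_def by (rule le_imp_power_dvd) simp

lemma fps_summable_Xpow_mult:
  assumes "\<And>n::nat. finite {i. e i \<le> int n}"
  shows "fps_summable (\<lambda>i. Xpow (e i) * F i)"
  unfolding fps_summable_def
proof
  fix n
  have "{i. (Xpow (e i) * F i) $ n \<noteq> 0} \<subseteq> {i. e i \<le> int n}"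
    by (auto simp: Xpow_def fps_X_power_mult_nth split: if_splits)
  then show "finite {i. (Xpow (e i) * F i) $ n \<noteq> 0}"
    using assms by (rule finite_subset)
qed

lemma fps_summable_Xpow:
  assumes "\<And>n::nat. finite {i. e i \<le> int n}"
  shows "fps_summable (\<lambda>i. Xpow (e i))"
  using fps_summable_Xpow_mult[OF assms, of "\<lambda>_. 1"] by simp

lemma finite_int_le_if_ge_abs:
  fixes e :: "int \<Rightarrow> int"
  assumes "\<And>j. \<bar>j\<bar> \<le> e j"
  shows "finite {j. e j \<le> int n}"
proof (rule finite_subset)
  show "{j. e j \<le> int n} \<subseteq> {- int n..int n}"
  proof
    fix j assume "j \<in> {j. e j \<le> int n}"
    then show "j \<in> {- int n..int n}" using assms[of j] by auto
  qed
qed simp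

lemma fps_sum_Xpow_nth:
  assumes "\<And>n::nat. finite {i. e i \<le> int n}" "\<And>i. e i \<ge> 0"
  shows "fps_sum (\<lambda>i. Xpow (e i)) $ n = of_nat (card {i. e i = int n})"
proof -
  have fin: "finite {i. e i \<le> int n}" by (rule assms)
  have "fps_sum (\<lambda>i. Xpow (e i)) $ n = (\<Sum>i | e i = int n. Xpow (e i) $ n)"
  proof (rule fps_sum_nth_superset)
    show "finite {i. e i = int n}" by (rule finite_subset[OF _ fin]) auto
    fix i assume "Xpow (e i) $ n \<noteq> 0"
    then show "i \<in> {i. e i = int n}" using assms(2)[of i] by (auto simp: Xpow_nth)
  qed
  also have "\<dots> = (\<Sum>i | e i = int n. 1)" by (rule sum.cong) (auto simp: Xpow_nth)
  finally show ?thesis by simp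
qed

subsection \<open>Inverses of q-factorials\<close>

text \<open>\<open>1/(q,q)\<^sub>i\<close> with \<open>q = X\<^sup>M\<close>; the value \<open>0\<close> at negative \<open>i\<close> makes the recurrences valid
  for all integers.\<close>

definition qfact_inv :: "nat \<Rightarrow> int \<Rightarrow> bit fps" where
  "qfact_inv M i = (if i < 0 then 0 else inverse (\<Prod>k=1..nat i. 1 - fps_X ^ (M * k)))"

lemma qfact_inv_neg [simp]: "i < 0 \<Longrightarrow> qfact_inv M i = 0"
  by (simp add: qfact_inv_def)

lemma qfact_inv_0 [simp]: "qfact_inv M 0 = 1"
  by (simp add: qfact_inv_def)

text \<open>At i = 0 the factor 1 + q^0 vanishes in characteristic two, in agreement with the value
  0 at -1.\<close>

lemma qfact_inv_minus_one:
  assumes "M > 0"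
  shows "qfact_inv M (i - 1) = (1 + Xpow (int M * i)) * qfact_inv M i"
proof -
  consider "i < 0" | "i = 0" | "i > 0" by linarith
  then show ?thesis
  proof cases
    case 3
    define n where "n = nat (i - 1)"
    have n: "i = int (Suc n)" "i - 1 = int n" using 3 by (auto simp: n_def)
    have nz: "(1 - fps_X ^ (M * Suc n) :: bit fps) $ 0 \<noteq> 0" using assms by simp
    have "qfact_inv M i = inverse ((1 - fps_X ^ (M * Suc n)) * (\<Prod>k=1..n. 1 - fps_X ^ (M * k)))"
      unfolding qfact_inv_def n by (simp add: nat_add_distrib mult.commute)
    also have "\<dots> = inverse (1 - fps_X ^ (M * Suc n)) * qfact_inv M (i - 1)"
      unfolding qfact_inv_def n by (simp add: fps_inverse_mult)
    finally have "(1 - fps_X ^ (M * Suc n)) * qfact_inv M i = qfact_inv M (i - 1)"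
      using inverse_mult_eq_1'[OF nz] by (simp flip: mult.assoc)
    moreover have "int M * i = int (M * Suc n)" by (simp only: n of_nat_mult)
    ultimately show ?thesis by (simp only: Xpow_int fps_bit_minus)
  qed auto
qed

text \<open>The q-Pascal rule without its numerators: 1 - q^(i+k) = (1 - q^i) + q^i (1 - q^k), each
  bracket being absorbed by one reciprocal. For a negative index every term is 0.\<close>

lemma qfact_inv_pascal:
  assumes "M > 0"
  shows "(1 + Xpow (int M * (i + k))) * (qfact_inv M i * qfact_inv M k) =
    qfact_inv M (i - 1) * qfact_inv M k + Xpow (int M * i) * (qfact_inv M i * qfact_inv M (k - 1))"
proof (cases "i < 0 \<or> k < 0")
  case False
  then have "Xpow (int M * (i + k)) = Xpow (int M * i) * Xpow (int M * k)"
    by (simp add: distrib_left Xpow_add)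
  then show ?thesis
    unfolding qfact_inv_minus_one[OF assms] by (simp add: algebra_simps)
qed auto

lemma qfact_inv_dvd_diff:
  assumes "M > 0" "i \<ge> int n"
  shows "fps_X ^ n dvd qfact_inv M i - inverse (eprod {s. M dvd s})"
proof -
  define m where "m = nat i"
  have m: "i = int m" "n \<le> m" using assms by (auto simp: m_def)
  have "fps_X ^ Suc m dvd (\<Prod>s\<in>(*) M ` {1..m}. 1 - fps_X ^ s) - (eprod {s. M dvd s} :: bit fps)"
  proof (rule eprod_dvd)
    show "{s. M dvd s} \<inter> {1..m} \<subseteq> (*) M ` {1..m}"
    proof
      fix s assume s: "s \<in> {s. M dvd s} \<inter> {1..m}"
      then obtain k where k: "s = M * k" by (auto elim: dvdE)
      have "k \<le> M * k" using assms by simp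
      then have "k \<in> {1..m}" using s k by (cases k) auto
      then show "s \<in> (*) M ` {1..m}" using k by blast
    qed
  qed (use assms in auto)
  also have "(\<Prod>s\<in>(*) M ` {1..m}. 1 - fps_X ^ s :: bit fps) = (\<Prod>k=1..m. 1 - fps_X ^ (M * k))"
    using assms by (subst prod.reindex) (auto simp: inj_on_def)
  finally have *: "fps_X ^ Suc m dvd (\<Prod>k=1..m. 1 - fps_X ^ (M * k)) - (eprod {s. M dvd s} :: bit fps)" .
  have nz: "(\<Prod>k=1..m. 1 - fps_X ^ (M * k) :: bit fps) $ 0 \<noteq> 0"
    using assms by (induction m) auto
  have "fps_X ^ Suc m dvd qfact_inv M i - inverse (eprod {s. M dvd s})"
    using dvd_diff_inverse[OF * nz] by (simp add: qfact_inv_def m)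
  then show ?thesis by (rule power_le_dvd) (use m in simp)
qed

subsection \<open>The Jacobi triple product in characteristic two\<close>

text \<open>The exponent in Ramanujan's general theta function f(q^a, q^b), the sum of q^(a j(j+1)/2
  + b j(j-1)/2) over all integers j. The division by 2 is exact.\<close>

definition theta_exp :: "nat \<Rightarrow> nat \<Rightarrow> int \<Rightarrow> int" where
  "theta_exp a b j = (int a * (j * (j + 1)) + int b * (j * (j - 1))) div 2"

lemma two_theta_exp: "2 * theta_exp a b j = int a * (j * (j + 1)) + int b * (j * (j - 1))"
  unfolding theta_exp_def by (rule dvd_mult_div_cancel) simp

lemma theta_exp_Suc: "theta_exp a b (j + 1) = theta_exp a b j + int a + int (a + b) * j"
proof -
  have "2 * theta_exp a b (j + 1) = 2 * (theta_exp a b j + int a + int (a + b) * j)"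
    unfolding two_theta_exp distrib_left by (simp add: algebra_simps)
  then show ?thesis by simp
qed

lemma theta_exp_uminus: "theta_exp a b (- j) = theta_exp b a j"
  by (simp add: theta_exp_def algebra_simps)

text \<open>Lowering a and b to 1 leaves the exponent j^2. This single bound yields both
  nonnegativity and local finiteness.\<close>

lemma abs_le_theta_exp:
  assumes "a > 0" "b > 0"
  shows "\<bar>j\<bar> \<le> theta_exp a b j"
proof -
  have 1: "j * (j + 1) \<ge> 0" "j * (j - 1) \<ge> 0"
    by (cases "j \<ge> 0"; simp add: zero_le_mult_iff; linarith)+
  have "1 * (j * (j + 1)) \<le> int a * (j * (j + 1))" "1 * (j * (j - 1)) \<le> int b * (j * (j - 1))"
    by (intro mult_right_mono 1; use assms in simp)+
  then have "2 * (j * j) \<le> 2 * theta_exp a b j"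
    unfolding two_theta_exp by (simp add: algebra_simps)
  moreover have "\<bar>j\<bar> * 1 \<le> \<bar>j\<bar> * \<bar>j\<bar>"
    by (cases "j = 0") (auto intro: mult_left_mono simp del: abs_mult_self_eq mult_1_right)
  ultimately show ?thesis by (simp flip: abs_mult)
qed

lemma theta_exp_nonneg: "a > 0 \<Longrightarrow> b > 0 \<Longrightarrow> theta_exp a b j \<ge> 0"
  using abs_le_theta_exp[of a b j] by linarith

lemma finite_theta_exp_le: "a > 0 \<Longrightarrow> b > 0 \<Longrightarrow> finite {j. theta_exp a b j \<le> int n}"
  by (intro finite_int_le_if_ge_abs abs_le_theta_exp)

text \<open>Up to the factor 1/(q^M)_(m+n) with M = a + b, this is the q-binomial sum of the finite
  triple product. The zero values of \<open>qfact_inv\<close> cut the sum down to -n <= j <=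
  m.\<close>

definition theta_fin :: "nat \<Rightarrow> nat \<Rightarrow> nat \<Rightarrow> nat \<Rightarrow> bit fps" where
  "theta_fin a b m n = fps_sum (\<lambda>j. Xpow (theta_exp a b j) *
     (qfact_inv (a + b) (int m - j) * qfact_inv (a + b) (int n + j)))"

lemma theta_fin_commute:
  assumes "a > 0" "b > 0"
  shows "theta_fin a b m n = theta_fin b a n m"
proof -
  let ?F = "\<lambda>j. Xpow (theta_exp b a j) *
     (qfact_inv (a + b) (int n - j) * qfact_inv (a + b) (int m + j))"
  have "fps_sum (\<lambda>j. ?F (- j)) = fps_sum ?F"
    using assms by (intro fps_sum_reindex fps_summable_Xpow_mult finite_theta_exp_le)
      (auto simp: inj_def intro: surjI[of _ uminus])
  then show ?thesis
    unfolding theta_fin_def by (simp add: theta_exp_uminus add.commute mult.commute)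
qed

text \<open>The q-Pascal rule splits each term in two. The second halves, with j shifted by one, are
  q^(a+mM) times the first halves, which produces the new factor of the product.\<close>

lemma theta_fin_Suc:
  assumes "a > 0" "b > 0"
  shows "(1 + Xpow (int (a + b) * int (m + n + 1))) * theta_fin a b (Suc m) n =
    (1 + fps_X ^ (a + m * (a + b))) * theta_fin a b m n"
proof -
  let ?M = "a + b"
  let ?g = "qfact_inv ?M"
  let ?F = "\<lambda>j. Xpow (theta_exp a b j) * (?g (int m - j) * ?g (int n + j))"
  let ?G = "\<lambda>j. Xpow (theta_exp a b j) * (Xpow (int ?M * (int m + 1 - j)) *
     (?g (int m + 1 - j) * ?g (int n + j - 1)))"
  have M: "?M > 0" using assms by simp
  have sm: "fps_summable ?F" "fps_summable ?G"
    "fps_summable (\<lambda>j. Xpow (theta_exp a b j) * (?g (int (Suc m) - j) * ?g (int n + j)))"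
    by (intro fps_summable_Xpow_mult finite_theta_exp_le assms)+
  have "(1 + Xpow (int ?M * int (m + n + 1))) * theta_fin a b (Suc m) n =
      fps_sum (\<lambda>j. (1 + Xpow (int ?M * int (m + n + 1))) *
        (Xpow (theta_exp a b j) * (?g (int (Suc m) - j) * ?g (int n + j))))"
    unfolding theta_fin_def by (rule fps_sum_mult_left[OF sm(3), symmetric])
  also have "\<dots> = fps_sum (\<lambda>j. ?F j + ?G j)"
  proof (rule arg_cong[of _ _ fps_sum], rule ext)
    fix j
    have "(1 + Xpow (int ?M * int (m + n + 1))) * (?g (int (Suc m) - j) * ?g (int n + j)) =
      ?g (int m - j) * ?g (int n + j) +
        Xpow (int ?M * (int m + 1 - j)) * (?g (int m + 1 - j) * ?g (int n + j - 1))"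
      using qfact_inv_pascal[OF M, of "int m + 1 - j" "int n + j"] by (simp add: algebra_simps)
    then show "(1 + Xpow (int ?M * int (m + n + 1))) *
        (Xpow (theta_exp a b j) * (?g (int (Suc m) - j) * ?g (int n + j))) = ?F j + ?G j"
      by (simp only: mult.left_commute[of "1 + _"] distrib_left)
  qed
  also have "\<dots> = fps_sum ?F + fps_sum ?G"
    by (rule fps_sum_add[OF sm(1,2)])
  also have "fps_sum ?G = fps_sum (\<lambda>j. ?G (j + 1))"
    by (rule fps_sum_reindex[symmetric])
      (use sm(2) in \<open>auto simp: inj_def intro: surjI[of _ "\<lambda>j. j - 1"]\<close>)
  also have "(\<lambda>j. ?G (j + 1)) = (\<lambda>j. fps_X ^ (a + m * ?M) * ?F j)"
  proof
    fix j
    show "?G (j + 1) = fps_X ^ (a + m * ?M) * ?F j"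
    \<comment> \<open>For j > m the exponent M(m - j) is negative and \<open>Xpow\<close> is not
      additive, but \<open>qfact_inv\<close> at m - j is 0.\<close>
    proof (cases "j > int m")
      case False
      have nn: "int ?M * (int m - j) \<ge> 0" using False by simp
      have "Xpow (theta_exp a b (j + 1)) * Xpow (int ?M * (int m - j)) =
          Xpow (theta_exp a b (j + 1) + int ?M * (int m - j))"
        by (rule Xpow_add[symmetric]) (use nn theta_exp_nonneg[OF assms] in auto)
      also have "theta_exp a b (j + 1) + int ?M * (int m - j) = int (a + m * ?M) + theta_exp a b j"
        unfolding theta_exp_Suc by (simp add: algebra_simps)
      also have "Xpow \<dots> = Xpow (int (a + m * ?M)) * Xpow (theta_exp a b j)"
        by (rule Xpow_add) (use theta_exp_nonneg[OF assms] in auto)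
      finally show ?thesis
        by (simp add: mult.assoc[symmetric] del: of_nat_add of_nat_mult)
    qed simp
  qed
  also have "fps_sum \<dots> = fps_X ^ (a + m * ?M) * fps_sum ?F"
    by (rule fps_sum_mult_left[OF sm(1)])
  finally show ?thesis by (simp add: theta_fin_def distrib_right)
qed

lemma one_plus_Xpow_nonzero: "i > 0 \<Longrightarrow> 1 + Xpow i \<noteq> 0"
proof
  assume "i > 0" "1 + Xpow i = 0"
  then have "(1 + Xpow i) $ 0 = 0" by simp
  with \<open>i > 0\<close> show False by (simp add: Xpow_nth)
qed

text \<open>Here c is the product accumulated so far. Leaving it arbitrary lets the same step raise
  either index.\<close>

lemma theta_fin_step:
  assumes "a > 0" "b > 0" "theta_fin a b m n = c * qfact_inv (a + b) (int (m + n))"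
  shows "theta_fin a b (Suc m) n = (1 + fps_X ^ (a + m * (a + b))) * c * qfact_inv (a + b) (int (Suc m + n))"
proof -
  let ?d = "1 + Xpow (int (a + b) * int (m + n + 1))"
  have "?d * theta_fin a b (Suc m) n = (1 + fps_X ^ (a + m * (a + b))) * (c * qfact_inv (a + b) (int (m + n)))"
    using theta_fin_Suc[OF assms(1,2)] assms(3) by simp
  also have "qfact_inv (a + b) (int (m + n)) = ?d * qfact_inv (a + b) (int (Suc m + n))"
    using qfact_inv_minus_one[of "a + b" "int (m + n + 1)"] assms(1) by simp
  finally have "?d * theta_fin a b (Suc m) n =
      ?d * ((1 + fps_X ^ (a + m * (a + b))) * c * qfact_inv (a + b) (int (Suc m + n)))"
    by (simp only: mult_ac)
  moreover have "?d \<noteq> 0" using assms(1,2) by (intro one_plus_Xpow_nonzero mult_pos_pos) auto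
  ultimately show ?thesis by (simp only: mult_cancel_left) simp
qed

lemma theta_fin_eq:
  assumes "a > 0" "b > 0"
  shows "theta_fin a b m n = (\<Prod>k<m. 1 + fps_X ^ (a + k * (a + b))) *
    (\<Prod>k<n. 1 + fps_X ^ (b + k * (a + b))) * qfact_inv (a + b) (int (m + n))"
proof (induction m)
  case 0
  show ?case
  proof (induction n)
    case 0
    have "theta_fin a b 0 0 $ k = (1 :: bit fps) $ k" for k
    proof -
      have "theta_fin a b 0 0 $ k = (\<Sum>j\<in>{0}. (Xpow (theta_exp a b j) *
          (qfact_inv (a + b) (int 0 - j) * qfact_inv (a + b) (int 0 + j))) $ k)"
        unfolding theta_fin_def
      proof (rule fps_sum_nth_superset)
        fix j assume "(Xpow (theta_exp a b j) *
          (qfact_inv (a + b) (int 0 - j) * qfact_inv (a + b) (int 0 + j))) $ k \<noteq> 0"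
        then show "j \<in> {0}" by (cases "j < 0"; cases "j > 0") auto
      qed simp
      also have "\<dots> = (1 :: bit fps) $ k" by (simp add: theta_exp_def)
      finally show ?thesis .
    qed
    then show ?case by (simp add: fps_eq_iff)
  next
    case (Suc n)
    \<comment> \<open>Reflection j to -j exchanges a with b and m with n, so raising n is the step
      for the first index.\<close>
    have "theta_fin b a n 0 = (\<Prod>k<n. 1 + fps_X ^ (b + k * (a + b))) * qfact_inv (b + a) (int (n + 0))"
      using Suc theta_fin_commute[OF assms] by (simp add: add.commute)
    from theta_fin_step[OF assms(2,1) this] show ?case
      using theta_fin_commute[OF assms] by (simp add: add_ac mult_ac)
  qed
next
  case (Suc m)
  from theta_fin_step[OF assms Suc] show ?case by (simp add: mult_ac)
qed

lemma prod_arith_progression_dvd: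
  assumes "a > 0" "a < M"
  shows "fps_X ^ n dvd (\<Prod>k<n. 1 + fps_X ^ (a + k * M)) - (eprod {s. s mod M = a} :: bit fps)"
proof -
  have "fps_X ^ Suc n dvd (\<Prod>s\<in>(\<lambda>k. a + k * M) ` {..<n}. 1 - fps_X ^ s) - (eprod {s. s mod M = a} :: bit fps)"
  proof (rule eprod_dvd)
    show "{s. s mod M = a} \<inter> {1..n} \<subseteq> (\<lambda>k. a + k * M) ` {..<n}"
    proof
      fix s assume s: "s \<in> {s. s mod M = a} \<inter> {1..n}"
      then have eq: "s = a + (s div M) * M" using div_mult_mod_eq[of s M] by (simp add: add.commute)
      have "s div M \<le> (s div M) * M" using assms by simp
      moreover have "s \<le> n" using s by simp
      ultimately have "s div M < n" using eq assms(1) by linarith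
      then show "s \<in> (\<lambda>k. a + k * M) ` {..<n}" using eq by blast
    qed
  qed (use assms in auto)
  also have "(\<Prod>s\<in>(\<lambda>k. a + k * M) ` {..<n}. 1 - fps_X ^ s :: bit fps) = (\<Prod>k<n. 1 + fps_X ^ (a + k * M))"
    using assms by (subst prod.reindex) (auto simp: inj_on_def fps_bit_minus)
  finally show ?thesis by (rule power_le_dvd) simp
qed

text \<open>Both indices of the finite form tend to infinity: its product side becomes A B/E and its
  sum side the theta series over E^2, where A, B, E are the three products. Multiplying by E^2 gives
  the claim.\<close>

theorem jacobi_triple_product_bit:
  assumes "a > 0" "b > 0"
  shows "eprod {s. s mod (a + b) = a} * eprod {s. s mod (a + b) = b} * eprod {s. a + b dvd s} =
    fps_sum (\<lambda>j. Xpow (theta_exp a b j))"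
proof -
  let ?M = "a + b"
  let ?E = "eprod {s. ?M dvd s} :: bit fps"
  let ?A = "eprod {s. s mod ?M = a} :: bit fps"
  let ?B = "eprod {s. s mod ?M = b} :: bit fps"
  let ?T = "fps_sum (\<lambda>j. Xpow (theta_exp a b j))"
  have M: "?M > 0" using assms by simp
  have sm: "fps_summable (\<lambda>j. Xpow (theta_exp a b j) * F j)" for F
    using assms by (intro fps_summable_Xpow_mult finite_theta_exp_le)
  have "?A * ?B * inverse ?E = (inverse ?E * inverse ?E) * ?T"
  proof (rule fps_eq_if_dvd_diff)
    fix n :: nat
    \<comment> \<open>Twice the precision: for \<bar>j\<bar> < n both indices 2n - j and 2n + j stay
      above n, and for \<bar>j\<bar> \<ge> n the theta power itself is divisible by X^n.\<close>
    let ?N = "2 * n"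
    have pA: "fps_X ^ n dvd (\<Prod>k<?N. 1 + fps_X ^ (a + k * ?M)) - ?A"
      using prod_arith_progression_dvd[of a ?M ?N] assms by (rule_tac power_le_dvd[of _ ?N]) auto
    have pB: "fps_X ^ n dvd (\<Prod>k<?N. 1 + fps_X ^ (b + k * ?M)) - ?B"
      using prod_arith_progression_dvd[of b ?M ?N] assms by (rule_tac power_le_dvd[of _ ?N]) auto
    have pE: "fps_X ^ n dvd qfact_inv ?M (int (?N + ?N)) - inverse ?E"
      by (rule qfact_inv_dvd_diff[OF M]) simp
    have "fps_X ^ n dvd theta_fin a b ?N ?N - ?A * ?B * inverse ?E"
      unfolding theta_fin_eq[OF assms] by (intro dvd_diff_mult pA pB pE)
    moreover have "fps_X ^ n dvd theta_fin a b ?N ?N -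
        fps_sum (\<lambda>j. Xpow (theta_exp a b j) * (inverse ?E * inverse ?E))"
      unfolding theta_fin_def
    proof (rule fps_bit_sum_dvd_diff[OF sm sm])
      fix j
      show "fps_X ^ n dvd Xpow (theta_exp a b j) * (qfact_inv ?M (int ?N - j) * qfact_inv ?M (int ?N + j)) -
          Xpow (theta_exp a b j) * (inverse ?E * inverse ?E)"
      proof (cases "\<bar>j\<bar> \<ge> int n")
        case True
        then have "fps_X ^ n dvd Xpow (theta_exp a b j)"
          using abs_le_theta_exp[OF assms, of j] by (intro fps_X_power_dvd_Xpow) linarith
        then show ?thesis by (simp flip: right_diff_distrib)
      next
        case False
        then have "fps_X ^ n dvd qfact_inv ?M (int ?N - j) - inverse ?E"
            "fps_X ^ n dvd qfact_inv ?M (int ?N + j) - inverse ?E"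
          by (auto intro!: qfact_inv_dvd_diff[OF M])
        then show ?thesis by (intro dvd_diff_mult) auto
      qed
    qed
    ultimately have "fps_X ^ n dvd ?A * ?B * inverse ?E -
        fps_sum (\<lambda>j. Xpow (theta_exp a b j) * (inverse ?E * inverse ?E))"
      by (rule dvd_diff_trans')
    also have "fps_sum (\<lambda>j. Xpow (theta_exp a b j) * (inverse ?E * inverse ?E)) = (inverse ?E * inverse ?E) * ?T"
      using fps_sum_mult_left[of "\<lambda>j. Xpow (theta_exp a b j)" "inverse ?E * inverse ?E"] sm[of "\<lambda>_. 1"]
      by (simp only: mult.commute mult_1_left)
    finally show "fps_X ^ n dvd ?A * ?B * inverse ?E - (inverse ?E * inverse ?E) * ?T" .
  qed
  then have "?A * ?B * ?E * (inverse ?E * ?E) = ?T * (inverse ?E * ?E) * (inverse ?E * ?E)"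
    by (simp only: mult_ac)
  then show ?thesis using inverse_mult_eq_1[of ?E] by simp
qed

subsection \<open>Euler products modulo two\<close>

definition euler :: "nat \<Rightarrow> 'a::comm_ring_1 fps" where
  "euler k = eprod {s. k dvd s}"

lemma euler_nth_0 [simp]: "euler k $ 0 = 1"
  by (simp add: euler_def)

lemma euler_nonzero [simp]: "euler k \<noteq> (0 :: bit fps)"
  using euler_nth_0[of k, where ?'a = bit] by fastforce

lemma euler_compose:
  assumes "k > 0"
  shows "(euler m :: 'a::idom fps) oo fps_X ^ k = euler (k * m)"
proof -
  have "{s. k * m dvd s} = (*) k ` {s. m dvd s}" by (auto elim!: dvdE)
  then show ?thesis using eprod_image_times[OF assms, where ?'a = 'a] by (simp add: euler_def)
qed

text \<open>Frobenius, factor by factor: (1 - X^s)^2 = 1 - X^(2s) in characteristic two.\<close>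

lemma eprod_square: "(eprod S :: bit fps)\<^sup>2 = eprod ((*) 2 ` S)"
proof (rule fps_eq_if_dvd_diff)
  fix n :: nat
  let ?B = "S \<inter> {1..n}"
  let ?P = "\<Prod>s\<in>?B. 1 - fps_X ^ s :: bit fps"
  have "fps_X ^ Suc n dvd (\<Prod>s\<in>(*) 2 ` ?B. 1 - fps_X ^ s) - (eprod ((*) 2 ` S) :: bit fps)"
    by (rule eprod_dvd) auto
  also have "(\<Prod>s\<in>(*) 2 ` ?B. 1 - fps_X ^ s) = (\<Prod>s\<in>?B. 1 - fps_X ^ (2 * s) :: bit fps)"
    by (subst prod.reindex) (auto simp: inj_on_def)
  also have "\<dots> = (\<Prod>s\<in>?B. (1 - fps_X ^ s) * (1 - fps_X ^ s))"
    by (rule prod.cong) (simp_all add: fps_bit_minus algebra_simps mult_2_right power_add)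
  also have "\<dots> = ?P * ?P" by (rule prod.distrib)
  finally have "fps_X ^ Suc n dvd ?P * ?P - (eprod ((*) 2 ` S) :: bit fps)" .
  moreover have "fps_X ^ Suc n dvd ?P * ?P - eprod S * eprod S"
    by (intro dvd_diff_mult eprod_dvd')
  ultimately have "fps_X ^ Suc n dvd eprod S * eprod S - (eprod ((*) 2 ` S) :: bit fps)"
    by (rule dvd_diff_trans'[rotated])
  then show "fps_X ^ n dvd (eprod S)\<^sup>2 - (eprod ((*) 2 ` S) :: bit fps)"
    unfolding power2_eq_square by (rule power_le_dvd) simp
qed

lemma euler_square: "(euler k :: bit fps)\<^sup>2 = euler (2 * k)"
proof -
  have "(*) 2 ` {s. k dvd s} = {s. 2 * k dvd s}" by (auto elim!: dvdE)
  then show ?thesis by (simp add: euler_def eprod_square)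
qed

definition theta :: "nat \<Rightarrow> nat \<Rightarrow> bit fps" where
  "theta a b = fps_sum (\<lambda>j. Xpow (theta_exp a b j))"

lemma theta_summable: "a > 0 \<Longrightarrow> b > 0 \<Longrightarrow> fps_summable (\<lambda>j. Xpow (theta_exp a b j))"
  by (intro fps_summable_Xpow finite_theta_exp_le)

lemma theta_nth:
  "a > 0 \<Longrightarrow> b > 0 \<Longrightarrow> theta a b $ n = of_nat (card {j. theta_exp a b j = int n})"
  unfolding theta_def by (intro fps_sum_Xpow_nth finite_theta_exp_le theta_exp_nonneg)

lemma eprod_Un_eq:
  assumes "U = S \<union> T" "S \<inter> T \<subseteq> {0}"
  shows "eprod U = eprod S * (eprod T :: 'a::comm_ring_1 fps)"
  using eprod_Un[OF assms(2)] assms(1) by simp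

text \<open>f_1 consists of the four nonzero residue classes modulo 5 and one f_5. With the second
  f_5, the classes 1, 4 and the classes 2, 3 each form a complete triple product.\<close>

lemma euler_1_times_5: "euler 1 * euler 5 = theta 1 4 * theta 2 3"
proof -
  let ?e = "\<lambda>r. eprod {s. s mod 5 = r} :: bit fps"
  have "euler 1 = (eprod {s::nat. s mod 5 \<in> {1,2,3,4}} * euler 5 :: bit fps)"
    unfolding euler_def
  proof (rule eprod_Un_eq)
    show "{s::nat. 1 dvd s} = {s. s mod 5 \<in> {1,2,3,4}} \<union> {s. 5 dvd s}"
    proof (rule set_eqI)
      fix s :: nat
      have "1 dvd s \<longleftrightarrow> s mod 5 = 1 \<or> s mod 5 = 2 \<or> s mod 5 = 3 \<or> s mod 5 = 4 \<or> 5 dvd s" by presburger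
      then show "s \<in> {s::nat. 1 dvd s} \<longleftrightarrow> s \<in> {s. s mod 5 \<in> {1,2,3,4}} \<union> {s. 5 dvd s}" by simp
    qed
    show "{s. s mod 5 \<in> {1,2,3,4}} \<inter> {s. 5 dvd s} \<subseteq> {0::nat}"
    proof (rule subsetI)
      fix s :: nat assume "s \<in> {s. s mod 5 \<in> {1,2,3,4}} \<inter> {s. 5 dvd s}"
      then have "(s mod 5 = 1 \<or> s mod 5 = 2 \<or> s mod 5 = 3 \<or> s mod 5 = 4) \<and> 5 dvd s" by blast
      then have False by presburger
      then show "s \<in> {0}" ..
    qed
  qed
  also have "eprod {s::nat. s mod 5 \<in> {1,2,3,4}} = eprod {s::nat. s mod 5 \<in> {1,2,3}} * ?e 4"
    by (rule eprod_Un_eq) auto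
  also have "eprod {s::nat. s mod 5 \<in> {1,2,3}} = eprod {s::nat. s mod 5 \<in> {1,2}} * ?e 3"
    by (rule eprod_Un_eq) auto
  also have "eprod {s::nat. s mod 5 \<in> {1,2}} = ?e 1 * ?e 2"
    by (rule eprod_Un_eq) auto
  finally have "euler 1 * euler 5 = (?e 1 * ?e 4 * euler 5) * (?e 2 * ?e 3 * euler 5)"
    by (simp only: mult_ac)
  also have "?e 1 * ?e 4 * euler 5 = theta 1 4"
    using jacobi_triple_product_bit[of 1 4] by (simp add: theta_def euler_def)
  also have "?e 2 * ?e 3 * euler 5 = theta 2 3"
    using jacobi_triple_product_bit[of 2 3] by (simp add: theta_def euler_def)
  finally show ?thesis .
qed

text \<open>Jacobi's identity for f_1^3 modulo 2, with the triangular numbers 2j^2 - j as exponents.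
  The triple product has f_4 = f_2^2 where f_1 has f_2, so it equals f_1 f_2 = f_1^3.\<close>

lemma euler_1_cube: "euler 1 ^ 3 = theta 1 3"
proof -
  let ?e = "\<lambda>r. eprod {s. s mod 4 = r} :: bit fps"
  have "euler 1 = (eprod {s::nat. s mod 4 \<in> {1,3}} * euler 2 :: bit fps)"
    unfolding euler_def
  proof (rule eprod_Un_eq)
    show "{s::nat. 1 dvd s} = {s. s mod 4 \<in> {1,3}} \<union> {s. 2 dvd s}"
    proof (rule set_eqI)
      fix s :: nat
      have "1 dvd s \<longleftrightarrow> s mod 4 = 1 \<or> s mod 4 = 3 \<or> 2 dvd s" by presburger
      then show "s \<in> {s::nat. 1 dvd s} \<longleftrightarrow> s \<in> {s. s mod 4 \<in> {1,3}} \<union> {s. 2 dvd s}" by simp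
    qed
    show "{s. s mod 4 \<in> {1,3}} \<inter> {s. 2 dvd s} \<subseteq> {0::nat}"
    proof (rule subsetI)
      fix s :: nat assume "s \<in> {s. s mod 4 \<in> {1,3}} \<inter> {s. 2 dvd s}"
      then have "(s mod 4 = 1 \<or> s mod 4 = 3) \<and> 2 dvd s" by blast
      then have False by presburger
      then show "s \<in> {0}" ..
    qed
  qed
  also have "eprod {s::nat. s mod 4 \<in> {1,3}} = ?e 1 * ?e 3"
    by (rule eprod_Un_eq) auto
  finally have e1: "euler 1 = ?e 1 * ?e 3 * euler 2" .
  have "theta 1 3 = ?e 1 * ?e 3 * euler 4"
    using jacobi_triple_product_bit[of 1 3] by (simp add: theta_def euler_def)
  also have "euler 4 = (euler 2 :: bit fps)\<^sup>2" using euler_square[of 2] by simp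
  finally have "theta 1 3 = (?e 1 * ?e 3 * euler 2) * euler 2"
    by (simp only: mult_ac power2_eq_square)
  also have "\<dots> = euler 1 * (euler 1)\<^sup>2" using e1 euler_square[of 1] by simp
  finally show ?thesis by (simp add: power2_eq_square power3_eq_cube)
qed

text \<open>The pentagonal number theorem in q^2, with exponents 3j^2 - j.\<close>

lemma euler_2_theta: "euler 2 = theta 2 4"
proof -
  let ?e = "\<lambda>r. eprod {s. s mod 6 = r} :: bit fps"
  have "euler 2 = (eprod {s::nat. s mod 6 \<in> {2,4}} * euler 6 :: bit fps)"
    unfolding euler_def
  proof (rule eprod_Un_eq)
    show "{s::nat. 2 dvd s} = {s. s mod 6 \<in> {2,4}} \<union> {s. 6 dvd s}"
    proof (rule set_eqI)
      fix s :: nat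
      have "2 dvd s \<longleftrightarrow> s mod 6 = 2 \<or> s mod 6 = 4 \<or> 6 dvd s" by presburger
      then show "s \<in> {s::nat. 2 dvd s} \<longleftrightarrow> s \<in> {s. s mod 6 \<in> {2,4}} \<union> {s. 6 dvd s}" by simp
    qed
    show "{s. s mod 6 \<in> {2,4}} \<inter> {s. 6 dvd s} \<subseteq> {0::nat}"
    proof (rule subsetI)
      fix s :: nat assume "s \<in> {s. s mod 6 \<in> {2,4}} \<inter> {s. 6 dvd s}"
      then have "(s mod 6 = 2 \<or> s mod 6 = 4) \<and> 6 dvd s" by blast
      then have False by presburger
      then show "s \<in> {0}" ..
    qed
  qed
  also have "eprod {s::nat. s mod 6 \<in> {2,4}} = ?e 2 * ?e 4"
    by (rule eprod_Un_eq) auto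
  also have "?e 2 * ?e 4 * euler 6 = theta 2 4"
    using jacobi_triple_product_bit[of 2 4] by (simp add: theta_def euler_def)
  finally show ?thesis .
qed

subsection \<open>A quadratic relation between the Euler products of level 1 and 5\<close>

lemma even_card_involution:
  assumes "finite A" "\<And>x. x \<in> A \<Longrightarrow> f x \<in> A" "\<And>x. x \<in> A \<Longrightarrow> f (f x) = x" "\<And>x. x \<in> A \<Longrightarrow> f x \<noteq> x"
  shows "even (card A)"
  using assms
proof (induction "card A" arbitrary: A rule: less_induct)
  case less
  show ?case
  proof (cases "A = {}")
    case False
    then obtain x where x: "x \<in> A" by blast
    let ?B = "A - {x, f x}"
    have sub: "{x, f x} \<subseteq> A" using x less.prems(2) by blast
    have c2: "card {x, f x} = 2" using less.prems(4)[OF x] by simp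
    have "card ?B = card A - 2" using card_Diff_subset[OF _ sub] c2 by simp
    moreover have "card A \<ge> 2" using card_mono[OF less.prems(1) sub] c2 by simp
    moreover have "even (card ?B)"
    proof (rule less.hyps)
      show "card ?B < card A" using calculation by simp
      show "finite ?B" using less.prems(1) by simp
      fix y assume y: "y \<in> ?B"
      show "f y \<in> ?B"
        using y less.prems(2)[of y] less.prems(3)[of y] less.prems(3)[OF x] by auto
      show "f (f y) = y" "f y \<noteq> y" using y less.prems(3,4) by auto
    qed
    ultimately show ?thesis by simp
  qed simp
qed

lemma of_nat_card_involution:
  assumes "finite A" "\<And>x. x \<in> A \<Longrightarrow> f x \<in> A" "\<And>x. x \<in> A \<Longrightarrow> f (f x) = x"
  shows "(of_nat (card A) :: bit) = of_nat (card {x \<in> A. f x = x})"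
proof -
  have "A = {x \<in> A. f x = x} \<union> {x \<in> A. f x \<noteq> x}" by auto
  also have "card \<dots> = card {x \<in> A. f x = x} + card {x \<in> A. f x \<noteq> x}"
    by (rule card_Un_disjoint) (use assms(1) in auto)
  finally have "card A = card {x \<in> A. f x = x} + card {x \<in> A. f x \<noteq> x}" .
  moreover have "even (card {x \<in> A. f x \<noteq> x})"
    by (rule even_card_involution[where f = f]) (use assms in auto)
  ultimately show ?thesis by (auto elim!: evenE)
qed

text \<open>Completing squares in the summation indices m, n of \<open>theta 1 4 * theta 2 3\<close>
  gives (10m - 3)^2 + (10n - 1)^2 = 40N + 10. Division of (10m - 3) + (10n - 1)i by 2 - i leaves x +
  iy of norm 8N + 2, and 2x + y = 10m - 3 explains the congruence.\<close>

definition two_square_reps :: "nat \<Rightarrow> (int \<times> int) set" where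
  "two_square_reps N =
     {(x, y). odd x \<and> odd y \<and> (2 * x + y) mod 5 = 2 \<and> x * x + y * y = 8 * int N + 2}"

text \<open>The symmetries used below fix points (x, x) or (x, -x), for which 2x^2 = 8N + 2.\<close>

definition sq_roots :: "nat \<Rightarrow> int \<Rightarrow> int set" where
  "sq_roots N c = {x. x mod 5 = c \<and> x * x = 4 * int N + 1}"

text \<open>4N + 1 is a square exactly when N = z(z + 1), twice a triangular number. The indicator
  is thus the coefficient sequence of f_1^6 modulo 2.\<close>

definition is_sq :: "nat \<Rightarrow> bit" where
  "is_sq N = of_bool (\<exists>x::int. x * x = 4 * int N + 1)"

lemma abs_le_square_int: "\<bar>x\<bar> \<le> x * (x::int)"
proof -
  have "\<bar>x\<bar> * 1 \<le> \<bar>x\<bar> * \<bar>x\<bar>"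
    by (cases "x = 0") (auto intro: mult_left_mono simp del: abs_mult_self_eq mult_1_right)
  then show ?thesis by simp
qed

lemma finite_two_square_reps: "finite (two_square_reps N)"
proof (rule finite_subset)
  show "two_square_reps N \<subseteq> {- (8 * int N + 2)..8 * int N + 2} \<times> {- (8 * int N + 2)..8 * int N + 2}"
  proof
    fix p assume p: "p \<in> two_square_reps N"
    obtain x y where [simp]: "p = (x, y)" by fastforce
    have "x * x + y * y = 8 * int N + 2" using p by (simp add: two_square_reps_def)
    then have "\<bar>x\<bar> \<le> 8 * int N + 2" "\<bar>y\<bar> \<le> 8 * int N + 2"
      using abs_le_square_int[of x] abs_le_square_int[of y] by linarith+
    then show "p \<in> {- (8 * int N + 2)..8 * int N + 2} \<times> {- (8 * int N + 2)..8 * int N + 2}" by auto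
  qed
qed simp

text \<open>Since y is 2 - 2x modulo 5, the class of x decides the class of every linear form in x
  and y.\<close>

lemma mod_5_linear_combination:
  fixes x y z :: int
  assumes "x mod 5 = c" "(2 * x + y) mod 5 = 2" "z = a * x + b * y"
  shows "z mod 5 = (a * c + b * (2 - 2 * c)) mod 5"
proof -
  define u w where "u = x div 5" and "w = (2 * x + y) div 5"
  have x: "x = 5 * u + c" and y: "y = 5 * w + 2 - 2 * x"
    using div_mult_mod_eq[of x 5] div_mult_mod_eq[of "2 * x + y" 5] assms(1,2) by (simp_all add: u_def w_def)
  have "z - (a * c + b * (2 - 2 * c)) = 5 * ((a - 2 * b) * u + b * w)"
    unfolding assms(3) y by (simp add: x algebra_simps)
  then have "5 dvd z - (a * c + b * (2 - 2 * c))" by simp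
  then show ?thesis by (simp only: mod_eq_dvd_iff)
qed

text \<open>Negating x preserves 2x + y modulo 5 because 5 divides x, and an odd x is never
  fixed.\<close>

lemma two_square_reps_class_0:
  "(of_nat (card {p \<in> two_square_reps N. fst p mod 5 = 0}) :: bit) = 0"
proof -
  let ?A = "{p \<in> two_square_reps N. fst p mod 5 = 0}"
  let ?f = "\<lambda>p::int\<times>int. (- fst p, snd p)"
  have "even (card ?A)"
  proof (rule even_card_involution[where f = ?f])
    fix p assume p: "p \<in> ?A"
    obtain x y where [simp]: "p = (x, y)" by fastforce
    from p have "x mod 5 = 0" "(2 * x + y) mod 5 = 2" by (auto simp: two_square_reps_def)
    then have "(- x) mod 5 = 0" "(y - 2 * x) mod 5 = 2"
      using mod_5_linear_combination[of x 0 y "- x" "- 1" 0] mod_5_linear_combination[of x 0 y "y - 2 * x" "- 2" 1]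
      by simp_all
    then show "?f p \<in> ?A" using p by (auto simp: two_square_reps_def)
    show "?f p \<noteq> p" using p by (auto simp: two_square_reps_def)
  qed (auto simp: finite_two_square_reps)
  then show ?thesis by (auto elim!: evenE)
qed

text \<open>Here y is 0 modulo 5, so negating y preserves the congruence; an odd y is never
  fixed.\<close>

lemma two_square_reps_class_1:
  "(of_nat (card {p \<in> two_square_reps N. fst p mod 5 = 1}) :: bit) = 0"
proof -
  let ?A = "{p \<in> two_square_reps N. fst p mod 5 = 1}"
  let ?f = "\<lambda>p::int\<times>int. (fst p, - snd p)"
  have "even (card ?A)"
  proof (rule even_card_involution[where f = ?f])
    fix p assume p: "p \<in> ?A"
    obtain x y where [simp]: "p = (x, y)" by fastforce
    from p have "x mod 5 = 1" "(2 * x + y) mod 5 = 2" by (auto simp: two_square_reps_def)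
    then have "(2 * x - y) mod 5 = 2"
      using mod_5_linear_combination[of x 1 y "2 * x - y" 2 "- 1"] by simp
    then show "?f p \<in> ?A" using p by (auto simp: two_square_reps_def)
    show "?f p \<noteq> p" using p by (auto simp: two_square_reps_def)
  qed (auto simp: finite_two_square_reps)
  then show ?thesis by (auto elim!: evenE)
qed

text \<open>Here y is 3 modulo 5, so the reflection to (-y, -x) stays in the class. Its fixed points
  lie on y = -x.\<close>

lemma two_square_reps_class_2:
  "(of_nat (card {p \<in> two_square_reps N. fst p mod 5 = 2}) :: bit) = of_nat (card (sq_roots N 2))"
proof -
  let ?A = "{p \<in> two_square_reps N. fst p mod 5 = 2}"
  let ?f = "\<lambda>p::int\<times>int. (- snd p, - fst p)"
  have "(of_nat (card ?A) :: bit) = of_nat (card {p \<in> ?A. ?f p = p})"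
  proof (rule of_nat_card_involution)
    fix p assume p: "p \<in> ?A"
    obtain x y where [simp]: "p = (x, y)" by fastforce
    from p have "x mod 5 = 2" "(2 * x + y) mod 5 = 2" by (auto simp: two_square_reps_def)
    then have "(- y) mod 5 = 2" "(- x - 2 * y) mod 5 = 2"
      using mod_5_linear_combination[of x 2 y "- y" 0 "- 1"] mod_5_linear_combination[of x 2 y "- x - 2 * y" "- 1" "- 2"]
      by simp_all
    then show "?f p \<in> ?A" using p by (auto simp: two_square_reps_def)
  qed (auto simp: finite_two_square_reps)
  also have "card {p \<in> ?A. ?f p = p} = card (sq_roots N 2)"
  proof (rule bij_betw_same_card[of fst], rule bij_betw_byWitness[where f' = "\<lambda>x. (x, - x)"])
    show "(\<lambda>x. (x, - x)) ` sq_roots N 2 \<subseteq> {p \<in> ?A. ?f p = p}"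
    proof
      fix p assume "p \<in> (\<lambda>x. (x, - x)) ` sq_roots N 2"
      then obtain x where x: "p = (x, - x)" "x mod 5 = 2" "x * x = 4 * int N + 1"
        by (auto simp: sq_roots_def)
      have "odd (x * x)" unfolding x(3) by simp
      then have "odd x" by simp
      then show "p \<in> {p \<in> ?A. ?f p = p}" using x by (auto simp: two_square_reps_def)
    qed
    show "fst ` {p \<in> ?A. ?f p = p} \<subseteq> sq_roots N 2"
    proof
      fix x assume "x \<in> fst ` {p \<in> ?A. ?f p = p}"
      then have x: "(x, - x) \<in> two_square_reps N" "x mod 5 = 2" by auto
      from x(1) have "x * x + x * x = 8 * int N + 2" by (simp add: two_square_reps_def)
      then have "x * x = 4 * int N + 1" by linarith
      with x(2) show "x \<in> sq_roots N 2" by (simp add: sq_roots_def)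
    qed
  qed auto
  finally show ?thesis .
qed

text \<open>Both coordinates are 4 modulo 5, so they may be exchanged. The fixed points lie on the
  diagonal.\<close>

lemma two_square_reps_class_4:
  "(of_nat (card {p \<in> two_square_reps N. fst p mod 5 = 4}) :: bit) = of_nat (card (sq_roots N 4))"
proof -
  let ?A = "{p \<in> two_square_reps N. fst p mod 5 = 4}"
  let ?f = "\<lambda>p::int\<times>int. (snd p, fst p)"
  have "(of_nat (card ?A) :: bit) = of_nat (card {p \<in> ?A. ?f p = p})"
  proof (rule of_nat_card_involution)
    fix p assume p: "p \<in> ?A"
    obtain x y where [simp]: "p = (x, y)" by fastforce
    from p have "x mod 5 = 4" "(2 * x + y) mod 5 = 2" by (auto simp: two_square_reps_def)
    then have "y mod 5 = 4" "(2 * y + x) mod 5 = 2"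
      using mod_5_linear_combination[of x 4 y y 0 1] mod_5_linear_combination[of x 4 y "2 * y + x" 1 2]
      by simp_all
    then show "?f p \<in> ?A" using p by (auto simp: two_square_reps_def)
  qed (auto simp: finite_two_square_reps)
  also have "card {p \<in> ?A. ?f p = p} = card (sq_roots N 4)"
  proof (rule bij_betw_same_card[of fst], rule bij_betw_byWitness[where f' = "\<lambda>x. (x, x)"])
    show "(\<lambda>x. (x, x)) ` sq_roots N 4 \<subseteq> {p \<in> ?A. ?f p = p}"
    proof
      fix p assume "p \<in> (\<lambda>x. (x, x)) ` sq_roots N 4"
      then obtain x where x: "p = (x, x)" "x mod 5 = 4" "x * x = 4 * int N + 1"
        by (auto simp: sq_roots_def)
      have "odd (x * x)" unfolding x(3) by simp
      then have "odd x" by simp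
      moreover have "(3 * x) mod 5 = 2" using x(2) by presburger
      ultimately show "p \<in> {p \<in> ?A. ?f p = p}" using x by (auto simp: two_square_reps_def)
    qed
    show "fst ` {p \<in> ?A. ?f p = p} \<subseteq> sq_roots N 4"
    proof
      fix x assume "x \<in> fst ` {p \<in> ?A. ?f p = p}"
      then have x: "(x, x) \<in> two_square_reps N" "x mod 5 = 4" by auto
      from x(1) have "x * x + x * x = 8 * int N + 2" by (simp add: two_square_reps_def)
      then have "x * x = 4 * int N + 1" by linarith
      with x(2) show "x \<in> sq_roots N 4" by (simp add: sq_roots_def)
    qed
    show "\<forall>p\<in>{p \<in> ?A. ?f p = p}. (fst p, fst p) = p"
    proof
      fix p assume "p \<in> {p \<in> ?A. ?f p = p}"
      then have "?f p = p" by blast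
      from arg_cong[of _ _ fst, OF this] have "snd p = fst p" by (simp only: fst_conv)
      then show "(fst p, fst p) = p" by (simp add: prod_eq_iff)
    qed
  qed simp
  finally show ?thesis .
qed

text \<open>Division by a Gaussian prime of norm 5 identifies this class with the representations of
  \<open>(8N + 2)/5\<close>.\<close>

lemma two_square_reps_class_3:
  "card {p \<in> two_square_reps N. fst p mod 5 = 3} =
    (if N mod 5 = 1 then card (two_square_reps ((N - 1) div 5)) else 0)"
proof (cases "N mod 5 = 1")
  case True
  define K where "K = (N - 1) div 5"
  have N: "N = 5 * K + 1" using True unfolding K_def by presburger
  \<comment> \<open>Multiplication of u + iv by -2 + i, and \<open>?g\<close> is the division. The
    norm grows from 8K + 2 to 40K + 10 = 8(5K + 1) + 2.\<close>
  let ?f = "\<lambda>(u::int, v::int). (- (2 * u + v), u - 2 * v)"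
  let ?g = "\<lambda>(x::int, y::int). ((y - 2 * x) div 5, (- x - 2 * y) div 5)"
  have "bij_betw ?f (two_square_reps K) {p \<in> two_square_reps N. fst p mod 5 = 3}"
  proof (rule bij_betw_byWitness[where f' = ?g])
    show "\<forall>p\<in>two_square_reps K. ?g (?f p) = p" by auto
    show "\<forall>p\<in>{p \<in> two_square_reps N. fst p mod 5 = 3}. ?f (?g p) = p"
    proof
      fix p assume p: "p \<in> {p \<in> two_square_reps N. fst p mod 5 = 3}"
      obtain x y where [simp]: "p = (x, y)" by fastforce
      from p have "x mod 5 = 3" "(2 * x + y) mod 5 = 2" by (auto simp: two_square_reps_def)
      then have "(y - 2 * x) mod 5 = 0" "(- x - 2 * y) mod 5 = 0"
        using mod_5_linear_combination[of x 3 y "y - 2 * x" "- 2" 1] mod_5_linear_combination[of x 3 y "- x - 2 * y" "- 1" "- 2"]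
        by simp_all
      then have "5 dvd y - 2 * x" "5 dvd - x - 2 * y" by (simp_all only: dvd_eq_mod_eq_0)
      then obtain u v where uv: "y - 2 * x = 5 * u" "- x - 2 * y = 5 * v" by (auto elim!: dvdE)
      then show "?f (?g p) = p" by simp
    qed
    show "?f ` two_square_reps K \<subseteq> {p \<in> two_square_reps N. fst p mod 5 = 3}"
    proof
      fix p assume "p \<in> ?f ` two_square_reps K"
      then obtain u v where uv: "p = (- (2 * u + v), u - 2 * v)" "odd u" "odd v"
          "(2 * u + v) mod 5 = 2" "u * u + v * v = 8 * int K + 2"
        by (auto simp: two_square_reps_def)
      have "(- (2 * u + v)) mod 5 = (- ((2 * u + v) mod 5)) mod 5" by (simp only: mod_minus_eq)
      then have "(- (2 * u + v)) mod 5 = 3" using uv(4) by simp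
      moreover have "2 * (- (2 * u + v)) + (u - 2 * v) = 2 * u + v + 5 * (- u - v)" by simp
      then have "(2 * (- (2 * u + v)) + (u - 2 * v)) mod 5 = 2"
        using uv(4) by (simp only: mod_mult_self2)
      moreover have "(- (2 * u + v)) * (- (2 * u + v)) + (u - 2 * v) * (u - 2 * v) = 8 * int N + 2"
        using uv(5) N by (simp add: algebra_simps)
      ultimately show "p \<in> {p \<in> two_square_reps N. fst p mod 5 = 3}"
        using uv(1-3) by (simp add: two_square_reps_def)
    qed
    show "?g ` {p \<in> two_square_reps N. fst p mod 5 = 3} \<subseteq> two_square_reps K"
    proof
      fix q assume "q \<in> ?g ` {p \<in> two_square_reps N. fst p mod 5 = 3}"
      then obtain x y where xy: "q = ((y - 2 * x) div 5, (- x - 2 * y) div 5)" "odd x" "odd y"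
          "x mod 5 = 3" "(2 * x + y) mod 5 = 2" "x * x + y * y = 8 * int N + 2"
        by (auto simp: two_square_reps_def)
      then have "(y - 2 * x) mod 5 = 0" "(- x - 2 * y) mod 5 = 0"
        using mod_5_linear_combination[of x 3 y "y - 2 * x" "- 2" 1] mod_5_linear_combination[of x 3 y "- x - 2 * y" "- 1" "- 2"]
        by simp_all
      then have "5 dvd y - 2 * x" "5 dvd - x - 2 * y" by (simp_all only: dvd_eq_mod_eq_0)
      then obtain u v where uv: "y - 2 * x = 5 * u" "- x - 2 * y = 5 * v" by (auto elim!: dvdE)
      then have x: "x = - (2 * u + v)" and y: "y = u - 2 * v" by linarith+
      have "odd u" "odd v" using xy(2,3) x y by auto
      moreover have "2 * u + v = - x" using x by simp
      then have "(2 * u + v) mod 5 = (- (x mod 5)) mod 5" by (simp only: mod_minus_eq)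
      then have "(2 * u + v) mod 5 = 2" using xy(4) by simp
      moreover have "u * u + v * v = 8 * int K + 2"
        using xy(6) N unfolding x y by (simp add: algebra_simps)
      ultimately show "q \<in> two_square_reps K" using xy(1) uv by (simp add: two_square_reps_def)
    qed
  qed
  then show ?thesis using True by (simp add: bij_betw_same_card K_def)
next
  case False
  \<comment> \<open>With x = 3 and y = 1 modulo 5 the sum of squares is divisible by 5, which forces
    N = 1 modulo 5.\<close>
  have "{p \<in> two_square_reps N. fst p mod 5 = 3} = {}"
  proof (rule ccontr)
    assume "{p \<in> two_square_reps N. fst p mod 5 = 3} \<noteq> {}"
    then obtain x y where xy: "x mod 5 = 3" "(2 * x + y) mod 5 = 2" "x * x + y * y = 8 * int N + 2"
      by (auto simp: two_square_reps_def)
    then have "y mod 5 = 1" using mod_5_linear_combination[of x 3 y y 0 1] by simp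
    then have "x = 5 * (x div 5) + 3" "y = 5 * (y div 5) + 1"
      using xy(1) div_mult_mod_eq[of x 5] div_mult_mod_eq[of y 5] by linarith+
    then obtain a b where "x = 5 * a + 3" "y = 5 * b + 1" by blast
    then have "x * x + y * y = 5 * (5 * a * a + 6 * a + 5 * b * b + 2 * b + 2)" by (simp add: algebra_simps)
    then have "(x * x + y * y) mod 5 = 0" by simp
    then have "(8 * int N + 2) mod 5 = 0" using xy(3) by simp
    then show False using False by presburger
  qed
  then have "card {p \<in> two_square_reps N. fst p mod 5 = 3} = 0" by (simp only: card.empty)
  then show ?thesis using False by simp
qed

lemma card_two_square_reps:
  "(of_nat (card (two_square_reps N)) :: bit) = of_nat (card (sq_roots N 2)) + of_nat (card (sq_roots N 4)) +
     (if N mod 5 = 1 then of_nat (card (two_square_reps ((N - 1) div 5))) else 0)"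
proof -
  let ?C = "\<lambda>c. {p \<in> two_square_reps N. fst p mod 5 = c}"
  have "two_square_reps N = (\<Union>c\<in>{0,1,2,3,4::int}. ?C c)"
  proof -
    have "x mod 5 = 0 \<or> x mod 5 = 1 \<or> x mod 5 = 2 \<or> x mod 5 = 3 \<or> x mod 5 = 4" for x :: int
      by presburger
    then show ?thesis by auto
  qed
  also have "card \<dots> = (\<Sum>c\<in>{0,1,2,3,4}. card (?C c))"
    by (rule card_UN_disjoint) (auto simp: finite_two_square_reps)
  also have "\<dots> = card (?C 0) + card (?C 1) + card (?C 2) + card (?C 3) + card (?C 4)" by simp
  finally show ?thesis
    by (simp only: of_nat_add two_square_reps_class_0 two_square_reps_class_1 two_square_reps_class_2
      two_square_reps_class_3 two_square_reps_class_4 add_0_left) (simp add: add_ac)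
qed

lemma sq_roots_eq:
  assumes "x * x = 4 * int N + 1"
  shows "sq_roots N c = {y \<in> {x, - x}. y mod 5 = c}"
proof -
  have "y * y = x * x \<longleftrightarrow> y = x \<or> y = - x" for y
    by (simp add: square_eq_iff)
  then show ?thesis using assms unfolding sq_roots_def by auto
qed

lemma is_sq_eq_1: "x * x = 4 * int N + 1 \<Longrightarrow> is_sq N = 1"
  unfolding is_sq_def by auto

lemma is_sq_eq_0: "(\<And>x::int. x * x \<noteq> 4 * int N + 1) \<Longrightarrow> is_sq N = 0"
  unfolding is_sq_def by auto

text \<open>Strong induction along N = 5K + 1. If x^2 = 4N + 1 with x prime to 5, exactly one of x,
  -x lies in the classes 2 and 4, and N is not 1 modulo 5. If 5 divides x, neither class
  contributes, and the missing unit returns from the second summand for K.\<close>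

lemma card_two_square_reps_eq:
  "(of_nat (card (two_square_reps N)) :: bit) =
     is_sq N + (if N mod 5 = 1 then is_sq ((N - 1) div 5) else 0)"
proof (induction N rule: less_induct)
  case (less N)
  have IH: "(of_nat (card (two_square_reps K)) :: bit) =
     is_sq K + (if K mod 5 = 1 then is_sq ((K - 1) div 5) else 0)" if "N = 5 * K + 1" for K
    using less[of K] that by simp
  show ?case
  proof (cases "\<exists>x::int. x * x = 4 * int N + 1")
    case False
    then have roots: "sq_roots N c = {}" for c unfolding sq_roots_def by blast
    have "is_sq N = 0" using False by (intro is_sq_eq_0) blast
    moreover have "(of_nat (card (two_square_reps ((N - 1) div 5))) :: bit) = is_sq ((N - 1) div 5)" if "N mod 5 = 1"
    proof -
      define K where "K = (N - 1) div 5"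
      have K: "N = 5 * K + 1" using that unfolding K_def by presburger
      \<comment> \<open>With K = 5L + 1 one has 4N + 1 = 25(4L + 1), so a root for L would give one
        for N.\<close>
      have "is_sq ((K - 1) div 5) = 0" if "K mod 5 = 1"
      proof (rule is_sq_eq_0)
        fix x :: int
        define L where "L = (K - 1) div 5"
        have L: "K = 5 * L + 1" using that unfolding L_def by presburger
        show "x * x \<noteq> 4 * int ((K - 1) div 5) + 1"
        proof
          assume "x * x = 4 * int ((K - 1) div 5) + 1"
          then have "(5 * x) * (5 * x) = 4 * int N + 1" using K L by (simp flip: L_def)
          then show False using False by blast
        qed
      qed
      then show ?thesis unfolding K_def[symmetric] IH[OF K] by simp
    qed
    ultimately show ?thesis by (subst card_two_square_reps) (simp add: roots)
  next
    case True
    then obtain x :: int where x: "x * x = 4 * int N + 1" by blast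
    define k r where "k = x div 5" and "r = x mod 5"
    have xk: "x = 5 * k + r" by (simp add: k_def r_def)
    define t where "t = 5 * k * k + 2 * k * r"
    have t: "4 * int N + 1 = 5 * t + r * r" unfolding x[symmetric] xk t_def by (simp add: algebra_simps)
    have mx: "(- x) mod 5 = (- r) mod 5" by (simp add: r_def mod_minus_eq)
    have sq: "is_sq N = 1" using x by (rule is_sq_eq_1)
    have "r = 0 \<or> r = 1 \<or> r = 2 \<or> r = 3 \<or> r = 4" unfolding r_def by presburger
    then consider "r = 0" | "r = 1 \<or> r = 4" | "r = 2 \<or> r = 3" by blast
    then show ?thesis
    proof cases
      case 1
      then have roots: "sq_roots N 2 = {}" "sq_roots N 4 = {}"
        unfolding sq_roots_eq[OF x] using mx r_def by auto
      have kk: "4 * int N + 1 = 25 * (k * k)" using x xk 1 by simp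
      have "odd (25 * (k * k))" unfolding kk[symmetric] by simp
      then have "odd k" by simp
      then obtain z where z: "k = 2 * z + 1" by (auto elim: oddE)
      \<comment> \<open>The index two levels down: 4L + 1 = k^2 and N = 25L + 6. The natural number
        exists since z(z + 1) is nonnegative also for negative z.\<close>
      define L where "L = nat (z * (z + 1))"
      have L: "int L = z * (z + 1)"
        unfolding L_def by (cases "z \<ge> 0") (simp_all add: zero_le_mult_iff)
      have "4 * int N = 4 * (25 * int L + 6)" using kk unfolding L z by (simp add: algebra_simps)
      then have "int N = int (5 * (5 * L + 1) + 1)" by simp
      then have N: "N = 5 * (5 * L + 1) + 1" by (simp only: of_nat_eq_iff)
      have "k * k = 4 * int L + 1" unfolding L z by (simp add: algebra_simps)
      then have sqL: "is_sq L = 1" by (rule is_sq_eq_1)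
      have "N mod 5 = 1" unfolding N by (simp only: mod_mult_self4) simp
      moreover have "(N - 1) div 5 = 5 * L + 1" using N by simp
      moreover note m = calculation
      have "(of_nat (card (two_square_reps (5 * L + 1))) :: bit) = is_sq (5 * L + 1) + is_sq L"
        unfolding IH[OF N] by simp
      then show ?thesis using sq sqL by (subst card_two_square_reps) (simp add: roots m add.commute del: One_nat_def)
    next
      case 2
      then have "card (sq_roots N 4) = 1" "sq_roots N 2 = {}"
      proof -
        have "sq_roots N 4 = (if r = 4 then {x} else {- x})" "sq_roots N 2 = {}"
          unfolding sq_roots_eq[OF x] using mx r_def 2 by auto
        then show "card (sq_roots N 4) = 1" "sq_roots N 2 = {}" by auto
      qed
      moreover have "N mod 5 \<noteq> 1"
      proof -
        have "4 * int N + 1 = 5 * t + 1 \<or> 4 * int N + 1 = 5 * t + 16" using t 2 by auto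
        then show ?thesis by presburger
      qed
      ultimately show ?thesis using sq by (subst card_two_square_reps) simp
    next
      case 3
      then have "card (sq_roots N 2) = 1" "sq_roots N 4 = {}"
      proof -
        have "sq_roots N 2 = (if r = 2 then {x} else {- x})" "sq_roots N 4 = {}"
          unfolding sq_roots_eq[OF x] using mx r_def 3 by auto
        then show "card (sq_roots N 2) = 1" "sq_roots N 4 = {}" by auto
      qed
      moreover have "N mod 5 \<noteq> 1"
      proof -
        have "4 * int N + 1 = 5 * t + 4 \<or> 4 * int N + 1 = 5 * t + 9" using t 3 by auto
        then show ?thesis by presburger
      qed
      ultimately show ?thesis using sq by (subst card_two_square_reps) simp
    qed
  qed
qed

section \<open>From theta series to sums of two squares, and the level 5 relation\<close>

lemma theta_product_nth:
  assumes "a > 0" "b > 0" "c > 0" "d > 0"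
  shows "(theta a b * theta c d) $ n =
    of_nat (card {(i, j). theta_exp a b i + theta_exp c d j = int n})"
proof -
  let ?e = "\<lambda>p. theta_exp a b (fst p) + theta_exp c d (snd p)"
  have nn: "theta_exp a b i \<ge> 0" "theta_exp c d i \<ge> 0" for i
    using assms theta_exp_nonneg by auto
  have fin: "finite {p. ?e p \<le> int m}" for m
  proof (rule finite_subset)
    show "{p. ?e p \<le> int m} \<subseteq> {i. theta_exp a b i \<le> int m} \<times> {j. theta_exp c d j \<le> int m}"
    proof
      fix p assume "p \<in> {p. ?e p \<le> int m}"
      then have "?e p \<le> int m" by simp
      then have "theta_exp a b (fst p) \<le> int m" "theta_exp c d (snd p) \<le> int m"
        using nn(1)[of "fst p"] nn(2)[of "snd p"] by linarith+
      then show "p \<in> {i. theta_exp a b i \<le> int m} \<times> {j. theta_exp c d j \<le> int m}"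
        by (auto simp: mem_Times_iff)
    qed
  qed (use assms in \<open>auto intro: finite_theta_exp_le\<close>)
  have "theta a b * theta c d = fps_sum (\<lambda>(i, j). Xpow (theta_exp a b i) * Xpow (theta_exp c d j))"
    unfolding theta_def by (intro fps_sum_mult theta_summable assms)
  also have "\<dots> = fps_sum (\<lambda>p. Xpow (?e p))"
    by (rule arg_cong[of _ _ fps_sum]) (auto simp: Xpow_add nn)
  also have "\<dots> $ n = of_nat (card {p. ?e p = int n})"
    by (rule fps_sum_Xpow_nth) (use fin nn in \<open>auto intro: add_nonneg_nonneg\<close>)
  also have "{p. ?e p = int n} = {(i, j). theta_exp a b i + theta_exp c d j = int n}" by auto
  finally show ?thesis .
qed

lemma theta_product_nth_two_squares:
  "(theta 1 4 * theta 2 3) $ N = of_nat (card (two_square_reps N))"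
proof -
  let ?S = "{(m, n). theta_exp 1 4 m + theta_exp 2 3 n = int N}"
  let ?f = "\<lambda>(m, n). (4 * m - 2 * n - 1, 2 * m + 4 * n - 1 :: int)"
  \<comment> \<open>Solves 2x + y = 10m - 3 and 2y - x = 10n - 1 for m and n.\<close>
  let ?g = "\<lambda>(x, y). ((2 * x + y + 3) div 10, (2 * y - x + 1) div 10 :: int)"
  have S: "(m, n) \<in> ?S \<longleftrightarrow> 5 * (m * m) - 3 * m + 5 * (n * n) - n = 2 * int N" for m n
  proof -
    have "2 * (theta_exp 1 4 m + theta_exp 2 3 n) = 5 * (m * m) - 3 * m + 5 * (n * n) - n"
      unfolding distrib_left two_theta_exp by (simp add: algebra_simps)
    then show ?thesis by auto
  qed
  have sum: "x * x + y * y = 4 * (5 * (m * m) - 3 * m + 5 * (n * n) - n) + 2"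
    if "x = 4 * m - 2 * n - 1" "y = 2 * m + 4 * n - 1" for x y m n :: int
    unfolding that by (simp add: algebra_simps)
  have inv: "\<exists>m n. x = 4 * m - 2 * n - 1 \<and> y = 2 * m + 4 * n - 1"
    if "(x, y) \<in> two_square_reps N" for x y
  proof -
    have h: "odd x" "odd y" "(2 * x + y) mod 5 = 2" using that by (auto simp: two_square_reps_def)
    have "(2 * x + y) mod 10 = 7" using h(2,3) by presburger
    then obtain m where m: "2 * x + y = 10 * m + 7" using div_mult_mod_eq[of "2 * x + y" 10] by (metis mult.commute)
    have "y = 10 * m + 7 - 2 * x" using m by simp
    moreover obtain z where "x = 2 * z + 1" using h(1) by (auto elim: oddE)
    \<comment> \<open>The residue 7 = 10 - 3 shifts the first index by one; x = 2z + 1 then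
      determines the second.\<close>
    ultimately have "x = 4 * (m + 1) - 2 * (2 * m + 1 - z) - 1 \<and> y = 2 * (m + 1) + 4 * (2 * m + 1 - z) - 1"
      by simp
    then show ?thesis by blast
  qed
  have "bij_betw ?f ?S (two_square_reps N)"
  proof (rule bij_betw_byWitness[where f' = ?g])
    show "\<forall>p\<in>?S. ?g (?f p) = p" by auto
    show "\<forall>p\<in>two_square_reps N. ?f (?g p) = p"
    proof
      fix p assume p: "p \<in> two_square_reps N"
      obtain x y where [simp]: "p = (x, y)" by fastforce
      have "(x, y) \<in> two_square_reps N" using p by simp
      from inv[OF this] obtain m n where "x = 4 * m - 2 * n - 1" "y = 2 * m + 4 * n - 1" by blast
      then show "?f (?g p) = p" by simp
    qed
    show "?f ` ?S \<subseteq> two_square_reps N"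
    proof
      fix p assume "p \<in> ?f ` ?S"
      then obtain m n where p: "p = (4 * m - 2 * n - 1, 2 * m + 4 * n - 1)" "(m, n) \<in> ?S" by auto
      have "2 * (4 * m - 2 * n - 1) + (2 * m + 4 * n - 1) = 2 + 5 * (2 * m - 1)" by simp
      then have "(2 * (4 * m - 2 * n - 1) + (2 * m + 4 * n - 1)) mod 5 = 2" by (simp only: mod_mult_self2) simp
      moreover have "(4 * m - 2 * n - 1) * (4 * m - 2 * n - 1) + (2 * m + 4 * n - 1) * (2 * m + 4 * n - 1) = 8 * int N + 2"
        unfolding sum[OF refl refl] p(2)[unfolded S] by simp
      ultimately show "p \<in> two_square_reps N" unfolding p two_square_reps_def by simp
    qed
    show "?g ` two_square_reps N \<subseteq> ?S"
    proof
      fix q assume "q \<in> ?g ` two_square_reps N"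
      then obtain x y where q: "q = ?g (x, y)" "(x, y) \<in> two_square_reps N" by auto
      then obtain m n where mn: "x = 4 * m - 2 * n - 1" "y = 2 * m + 4 * n - 1" using inv by blast
      have "x * x + y * y = 8 * int N + 2" using q(2) by (simp add: two_square_reps_def)
      then have "4 * (5 * (m * m) - 3 * m + 5 * (n * n) - n) + 2 = 8 * int N + 2" unfolding sum[OF mn] .
      moreover have "E = 2 * int N" if "4 * E + 2 = 8 * int N + 2" for E using that by simp
      ultimately have "(m, n) \<in> ?S" unfolding S by blast
      moreover have "q = (m, n)" using q(1) mn by simp
      ultimately show "q \<in> ?S" by simp
    qed
  qed
  then show ?thesis by (subst theta_product_nth) (auto simp: bij_betw_same_card)
qed

text \<open>Eight times the exponent 2j^2 - j, plus 1, is (4j - 1)^2. Of two opposite odd roots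
  exactly one is -1 modulo 4, so each triangular number is attained once.\<close>

lemma euler_1_cube_nth: "(euler 1 ^ 3 :: bit fps) $ n = is_sq (2 * n)"
proof -
  let ?S = "{j. theta_exp 1 3 j = int n}"
  have S: "j \<in> ?S \<longleftrightarrow> (4 * j - 1) * (4 * j - 1) = 4 * int (2 * n) + 1" for j
  proof -
    have "4 * (2 * theta_exp 1 3 j) + 1 = (4 * j - 1) * (4 * j - 1)"
      unfolding two_theta_exp by (simp add: algebra_simps)
    then show ?thesis by auto
  qed
  have "of_nat (card ?S) = is_sq (2 * n)"
  proof (cases "\<exists>x::int. x * x = 4 * int (2 * n) + 1")
    case True
    then obtain x :: int where x: "x * x = 4 * int (2 * n) + 1" by blast
    have "odd (x * x)" unfolding x by simp
    then have "odd x" by simp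
    then have "(\<exists>j. x = 4 * j - 1) \<or> (\<exists>j. x = - (4 * j - 1))" by presburger
    then obtain j where j: "x = 4 * j - 1 \<or> x = - (4 * j - 1)" by blast
    have "?S = {j}"
    proof (rule set_eqI)
      fix i
      have "i \<in> ?S \<longleftrightarrow> (4 * i - 1) * (4 * i - 1) = x * x" unfolding S x ..
      also have "\<dots> \<longleftrightarrow> 4 * i - 1 = x \<or> 4 * i - 1 = - x" by (rule square_eq_iff)
      also have "\<dots> \<longleftrightarrow> i = j" using j by presburger
      finally show "i \<in> ?S \<longleftrightarrow> i \<in> {j}" by simp
    qed
    then show ?thesis using is_sq_eq_1[OF x] by simp
  next
    case False
    then have "?S = {}" using S by blast
    moreover have "is_sq (2 * n) = 0" using False by (intro is_sq_eq_0) blast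
    ultimately show ?thesis by simp
  qed
  then show ?thesis unfolding euler_1_cube by (simp add: theta_nth)
qed

lemma is_sq_odd: "odd N \<Longrightarrow> is_sq N = 0"
proof (rule is_sq_eq_0)
  fix x :: int assume "odd N"
  then obtain m where m: "N = 2 * m + 1" by (auto elim: oddE)
  show "x * x \<noteq> 4 * int N + 1"
  proof
    assume x: "x * x = 4 * int N + 1"
    then have "odd (x * x)" by simp
    then have "odd x" by simp
    then obtain z where "x = 2 * z + 1" by (auto elim: oddE)
    then have "4 * (z * (z + 1)) = 4 * int N" using x by (simp add: algebra_simps)
    then have "z * (z + 1) = int N" by simp
    moreover have "even (z * (z + 1))" by simp
    ultimately show False using \<open>odd N\<close> by simp
  qed
qed

lemma euler_pow_compose:
  assumes "k > 0"
  shows "((euler m :: bit fps) ^ n) oo fps_X ^ k = euler (k * m) ^ n"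
proof -
  have "(fps_X ^ k :: bit fps) $ 0 = 0" using assms by simp
  from fps_compose_power[OF this, of "euler m" n] show ?thesis using assms by (simp add: euler_compose)
qed

text \<open>By Frobenius f_1^6 = f_2^3, which is f_1^3 in q^2. Its odd coefficients vanish, as does
  \<open>is_sq\<close> at odd arguments because z(z + 1) is even.\<close>

lemma euler_1_pow_6_nth: "(euler 1 ^ 6 :: bit fps) $ n = is_sq n"
proof -
  have "(euler 1 ^ 6 :: bit fps) = (euler 1 ^ 2) ^ 3" by (simp flip: power_mult)
  also have "\<dots> = euler 1 ^ 3 oo fps_X ^ 2" by (simp add: euler_square euler_pow_compose del: One_nat_def)
  finally have "(euler 1 ^ 6 :: bit fps) $ n = (if even n then is_sq (2 * (n div 2)) else 0)"
    by (simp add: fps_compose_X_power_nth euler_1_cube_nth del: One_nat_def)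
  then show ?thesis by (simp add: is_sq_odd)
qed

theorem euler_level_5_relation:
  "(euler 1 * euler 5 :: bit fps) = euler 1 ^ 6 + fps_X * euler 5 ^ 6"
proof (rule fps_ext)
  fix N
  have "euler 5 ^ 6 = (euler 1 ^ 6 :: bit fps) oo fps_X ^ 5"
    by (simp add: euler_pow_compose)
  then have nth: "(euler 5 ^ 6 :: bit fps) $ k = (if 5 dvd k then is_sq (k div 5) else 0)" for k
    by (simp add: fps_compose_X_power_nth euler_1_pow_6_nth del: One_nat_def)
  have "(euler 1 * euler 5 :: bit fps) $ N = is_sq N + (if N mod 5 = 1 then is_sq ((N - 1) div 5) else 0)"
    unfolding euler_1_times_5 theta_product_nth_two_squares by (rule card_two_square_reps_eq)
  also have "(if N mod 5 = 1 then is_sq ((N - 1) div 5) else 0) = (fps_X * euler 5 ^ 6 :: bit fps) $ N"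
  proof (cases "N = 0")
    case False
    then have "N mod 5 = 1 \<longleftrightarrow> 5 dvd N - 1" by presburger
    then show ?thesis using False by (simp add: nth)
  qed simp
  finally show "(euler 1 * euler 5 :: bit fps) $ N = (euler 1 ^ 6 + fps_X * euler 5 ^ 6) $ N"
    by (simp add: euler_1_pow_6_nth del: One_nat_def)
qed

subsection \<open>The Durfee rectangle identity\<close>

text \<open>The exponent m(m + s) is the area of the largest rectangle of shape m by m + s in a
  partition diagram; the two reciprocals count what lies beside and below it.\<close>

definition durfee :: "nat \<Rightarrow> bit fps" where
  "durfee s = fps_sum (\<lambda>m::nat. fps_X ^ (m * (m + s)) * (qfact_inv 1 (int m) * qfact_inv 1 (int (m + s))))"

lemma fps_summable_X_power_mult:
  assumes "\<And>m::nat. m \<le> e m"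
  shows "fps_summable (\<lambda>m. fps_X ^ e m * F m :: bit fps)"
proof -
  have "finite {i. int (e i) \<le> int n}" for n
    by (rule finite_subset[of _ "{..n}"]) (use assms order_trans in auto)
  from fps_summable_Xpow_mult[OF this, of F] show ?thesis by simp
qed

lemma durfee_summable:
  "fps_summable (\<lambda>m::nat. fps_X ^ (m * (m + s) + m * t) * F m :: bit fps)"
proof (rule fps_summable_X_power_mult)
  fix m :: nat
  show "m \<le> m * (m + s) + m * t" by (cases m) auto
qed

lemma qfact_inv_nat: "qfact_inv 1 (int n) = (1 + fps_X ^ Suc n) * qfact_inv 1 (int (Suc n))"
proof -
  have "int (Suc n) - 1 = int n" by simp
  then show ?thesis
    using qfact_inv_minus_one[of 1 "int (Suc n)"] by (simp only: of_nat_1 mult_1_left Xpow_int zero_less_one)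
qed

text \<open>After bringing both series to the factor with index m + s + 1, the bracket is (1 + q^m)
  + q^(m+s+1). The first summand lowers the index of the other factor, and a shift of m turns it
  into the series for s + 2.\<close>

lemma durfee_diff: "durfee s + durfee (Suc s) = fps_X ^ Suc s * (durfee (Suc s) + durfee (Suc (Suc s)))"
proof -
  let ?g = "qfact_inv 1"
  let ?A = "\<lambda>m::nat. fps_X ^ (m * (m + s)) * ((1 + fps_X ^ m) * ?g (int m) * ?g (int (m + Suc s)))"
  let ?B = "\<lambda>m::nat. fps_X ^ (m * (m + s)) * (fps_X ^ (m + Suc s) * ?g (int m) * ?g (int (m + Suc s)))"
  let ?C = "\<lambda>m::nat. fps_X ^ (m * (m + Suc s)) * (fps_X ^ m * ?g (int m) * ?g (int (m + Suc (Suc s))))"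
  note sm = durfee_summable[of _ 0, simplified]
  have "durfee s + durfee (Suc s) = fps_sum (\<lambda>m::nat.
      fps_X ^ (m * (m + s)) * (?g (int m) * ?g (int (m + s))) +
      fps_X ^ (m * (m + Suc s)) * (?g (int m) * ?g (int (m + Suc s))))"
    unfolding durfee_def by (rule fps_sum_add[symmetric]; rule sm)
  also have "\<dots> = fps_sum (\<lambda>m. ?A m + ?B m)"
  proof (rule arg_cong[of _ _ fps_sum], rule ext)
    fix m :: nat
    have "?g (int (m + s)) = (1 + fps_X ^ (m + Suc s)) * ?g (int (m + Suc s))"
      using qfact_inv_nat[of "m + s"] by simp
    then show "fps_X ^ (m * (m + s)) * (?g (int m) * ?g (int (m + s))) +
      fps_X ^ (m * (m + Suc s)) * (?g (int m) * ?g (int (m + Suc s))) = ?A m + ?B m"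
      by (simp add: algebra_simps power_add)
  qed
  also have "\<dots> = fps_sum ?A + fps_sum ?B"
    by (rule fps_sum_add; rule sm)
  also have "fps_sum ?A = fps_sum (\<lambda>m. ?A (Suc m))"
  proof (rule fps_sum_reindex[symmetric])
    fix m :: nat assume "m \<notin> range Suc"
    then have "m = 0" by (cases m) auto
    then show "?A m = 0" by simp
  qed (simp_all add: sm)
  also have "(\<lambda>m. ?A (Suc m)) = (\<lambda>m. fps_X ^ Suc s * ?C m)"
  proof
    fix m :: nat
    have q: "(1 + fps_X ^ Suc m) * ?g (int (Suc m)) = ?g (int m)"
      using qfact_inv_nat[of m] by (rule sym)
    have "Suc m * (Suc m + s) = Suc s + (m * (m + Suc s) + m)" by (simp add: algebra_simps)
    then have p: "(fps_X ^ (Suc m * (Suc m + s)) :: bit fps) = fps_X ^ Suc s * (fps_X ^ (m * (m + Suc s)) * fps_X ^ m)"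
      by (simp only: power_add)
    have i: "Suc m + Suc s = m + Suc (Suc s)" by simp
    show "?A (Suc m) = fps_X ^ Suc s * ?C m"
      unfolding p q i by (simp only: mult_ac)
  qed
  also have "fps_sum \<dots> = fps_X ^ Suc s * fps_sum ?C"
    by (rule fps_sum_mult_left) (rule sm)
  also have "fps_sum ?B = fps_sum (\<lambda>m. fps_X ^ Suc s * (fps_X ^ (m * (m + Suc s)) * (?g (int m) * ?g (int (m + Suc s)))))"
    by (rule arg_cong[of _ _ fps_sum]) (simp add: fun_eq_iff power_add algebra_simps)
  also have "\<dots> = fps_X ^ Suc s * durfee (Suc s)"
    unfolding durfee_def by (rule fps_sum_mult_left) (rule sm)
  also have "fps_sum ?C = durfee (Suc (Suc s))"
    unfolding durfee_def by (rule arg_cong[of _ _ fps_sum]) (simp add: fun_eq_iff power_add algebra_simps)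
  finally show ?thesis by (simp only: distrib_left add.commute)
qed

text \<open>Each use of the recurrence contributes at least one factor X to the difference of
  consecutive series, so the difference is divisible by every power of X.\<close>

lemma durfee_const: "durfee s = durfee (Suc s)"
proof -
  have "fps_X ^ n dvd durfee s + durfee (Suc s)" for n
  proof (induction n arbitrary: s)
    case (Suc n)
    have "fps_X * fps_X ^ n dvd fps_X ^ Suc s * (durfee (Suc s) + durfee (Suc (Suc s)))"
      by (intro mult_dvd_mono Suc) simp
    then show ?case unfolding durfee_diff[of s] by simp
  qed simp
  then show ?thesis by (intro fps_eq_if_dvd_diff) (simp add: fps_bit_minus)
qed

text \<open>Independence of s permits s to grow; then only the term m = 0 survives.\<close>

lemma durfee_eq: "durfee s = inverse (euler 1)"
proof (rule fps_eq_if_dvd_diff)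
  fix n :: nat
  have shift: "durfee s = durfee (s + n)"
    by (induction n) (use durfee_const in auto)
  let ?F = "\<lambda>m::nat. fps_X ^ (m * (m + (s + n))) * (qfact_inv 1 (int m) * qfact_inv 1 (int (m + (s + n))))"
  let ?G = "\<lambda>m::nat. if m = 0 then inverse (euler 1) else 0 :: bit fps"
  have G: "fps_summable ?G" unfolding fps_summable_def
    by (rule allI, rule finite_subset[of _ "{0}"]) auto
  have sumG: "fps_sum ?G = inverse (euler 1)"
  proof (rule fps_ext)
    fix k
    have "fps_sum ?G $ k = (\<Sum>m\<in>{0}. ?G m $ k)" by (rule fps_sum_nth_superset) (auto split: if_splits)
    then show "fps_sum ?G $ k = inverse (euler 1) $ k" by simp
  qed
  have "fps_X ^ n dvd fps_sum ?F - fps_sum ?G"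
  proof (rule fps_bit_sum_dvd_diff[OF _ G])
    show "fps_summable ?F" using durfee_summable[of "s + n" 0] by simp
    fix m :: nat
    show "fps_X ^ n dvd ?F m - ?G m"
    proof (cases m)
      case 0
      then show ?thesis using qfact_inv_dvd_diff[of 1 n "int (s + n)"] by (simp add: euler_def)
    next
      case (Suc k)
      have "fps_X ^ n dvd (fps_X ^ (m * (m + (s + n))) :: bit fps)"
        by (rule le_imp_power_dvd) (simp add: Suc)
      then show ?thesis using Suc by simp
    qed
  qed
  then have "fps_X ^ n dvd durfee (s + n) - inverse (euler 1)"
    unfolding durfee_def sumG .
  then show "fps_X ^ n dvd durfee s - inverse (euler 1)" by (simp only: shift)
qed

section \<open>The bilateral form of the rectangle identity\<close>

abbreviation qinv :: "int \<Rightarrow> bit fps" where "qinv \<equiv> qfact_inv 1"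

lemma finite_int_square_le: "finite {n::int. n * n \<le> int k}"
  by (rule finite_int_le_if_ge_abs) (rule abs_le_square_int)

text \<open>The limiting case of Bailey's lemma: with n = m + r the exponent n^2 is r^2 + m(m + 2r),
  so the sum is the rectangle series with s = 2r. Terms with n < r vanish, and the sign of r is
  immaterial.\<close>

lemma durfee_sum: "fps_sum (\<lambda>n. Xpow (n * n) * (qinv (n - r) * qinv (n + r))) = Xpow (r * r) * inverse (euler 1)"
proof -
  have *: "fps_sum (\<lambda>n. Xpow (n * n) * (qinv (n - int r) * qinv (n + int r))) = Xpow (int r * int r) * inverse (euler 1)" for r :: nat
  proof -
    let ?F = "\<lambda>n. Xpow (n * n) * (qinv (n - int r) * qinv (n + int r))"
    let ?G = "\<lambda>m::nat. fps_X ^ (m * (m + 2 * r)) * (qfact_inv 1 (int m) * qfact_inv 1 (int (m + 2 * r)))"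
    have "fps_sum (\<lambda>m::nat. ?F (int m + int r)) = fps_sum ?F"
    proof (rule fps_sum_reindex)
      show "fps_summable ?F" by (intro fps_summable_Xpow_mult finite_int_square_le)
      fix n :: int assume n: "n \<notin> range (\<lambda>m::nat. int m + int r)"
      have "n - int r < 0"
      proof (rule ccontr)
        assume "\<not> n - int r < 0"
        then have "n = int (nat (n - int r)) + int r" by simp
        then show False using n by blast
      qed
      then show "?F n = 0" by simp
    qed (auto simp: inj_def)
    moreover have "(\<lambda>m::nat. ?F (int m + int r)) = (\<lambda>m. Xpow (int r * int r) * ?G m)"
    proof
      fix m :: nat
      have "(int m + int r) * (int m + int r) = int r * int r + int (m * (m + 2 * r))" by (simp add: algebra_simps)
      then have "Xpow ((int m + int r) * (int m + int r)) = Xpow (int r * int r) * fps_X ^ (m * (m + 2 * r))"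
        by (simp only: Xpow_add Xpow_int of_nat_0_le_iff zero_le_square)
      moreover have "int m + int r - int r = int m" "int m + int r + int r = int (m + 2 * r)" by simp_all
      ultimately show "?F (int m + int r) = Xpow (int r * int r) * ?G m" by (simp only: mult.assoc)
    qed
    ultimately have "fps_sum ?F = fps_sum (\<lambda>m. Xpow (int r * int r) * ?G m)" by (simp only:)
    also have "\<dots> = Xpow (int r * int r) * durfee (2 * r)"
      unfolding durfee_def by (rule fps_sum_mult_left) (use durfee_summable[of "2 * r" 0] in simp)
    finally have "fps_sum ?F = Xpow (int r * int r) * durfee (2 * r)" .
    then show ?thesis by (simp add: durfee_eq)
  qed
  show ?thesis
  proof (cases "r \<ge> 0")
    case True
    then show ?thesis using *[of "nat r"] by simp
  next
    case False
    then show ?thesis using *[of "nat (- r)"] by (simp add: mult.commute)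
  qed
qed

subsection \<open>A polynomial form of Euler's pentagonal number theorem\<close>

text \<open>The exponents are the generalised pentagonal numbers j(3j + 1)/2 for j = 2r and j = 2r +
  1. The reciprocals are q-binomial coefficients with upper index 2n over (q)_(2n), placed at the
  Bailey indices 3r and 3r + 2. The companion \<open>pent_odd\<close> has upper index 2n + 1, since
  the q-Pascal rule raises that index by one at a time.\<close>

definition pent_even :: "int \<Rightarrow> int \<Rightarrow> bit fps" where
  "pent_even n r = Xpow (6 * (r * r) + r) * (qinv (n - 3 * r) * qinv (n + 3 * r)) +
     Xpow (6 * (r * r) + 7 * r + 2) * (qinv (n - 3 * r - 2) * qinv (n + 3 * r + 2))"

definition pent_odd :: "int \<Rightarrow> int \<Rightarrow> bit fps" where
  "pent_odd n r = Xpow (6 * (r * r) + r) * (qinv (n - 3 * r) * qinv (n + 1 + 3 * r)) +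
     Xpow (6 * (r * r) + 7 * r + 2) * (qinv (n - 1 - 3 * r) * qinv (n + 2 + 3 * r))"

lemma pent_exp_bounds: "\<bar>r\<bar> \<le> 6 * (r * r) + r" "\<bar>r\<bar> \<le> 6 * (r * r) + 7 * r + 2" for r :: int
proof -
  show "\<bar>r\<bar> \<le> 6 * (r * r) + r" using abs_le_square_int[of r] by linarith
  show "\<bar>r\<bar> \<le> 6 * (r * r) + 7 * r + 2"
  proof (cases "r \<ge> 0")
    case False
    show ?thesis
    proof (cases "r = - 1")
      case False
      then have "0 \<le> (r + 2) * r" using \<open>\<not> r \<ge> 0\<close> by (simp add: zero_le_mult_iff)
      then have "0 \<le> r * r + 2 * r" by (simp add: algebra_simps)
      then show ?thesis using \<open>\<not> r \<ge> 0\<close> False by linarith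
    qed simp
  next
    case True
    have "0 \<le> r * r" by simp
    then show ?thesis using True by linarith
  qed
qed

lemma finite_pent_exp_le:
  "finite {r. 6 * (r * r) + r \<le> int n}" "finite {r. 6 * (r * r) + 7 * r + 2 \<le> int n}"
  by (rule finite_int_le_if_ge_abs, rule pent_exp_bounds)+

lemma pent_summable: "fps_summable (pent_even n)" "fps_summable (pent_odd n)"
  unfolding pent_even_def[abs_def] pent_odd_def[abs_def]
  by (intro fps_summable_add fps_summable_Xpow_mult finite_pent_exp_le)+

lemma qinv_pascal:
  "(1 + Xpow (i + k)) * (qinv i * qinv k) = qinv (i - 1) * qinv k + Xpow i * (qinv i * qinv (k - 1))"
  using qfact_inv_pascal[of 1 i k] by simp

text \<open>The q-Pascal rule leaves one extra term in each half. For every single r the two extra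
  terms coincide, and they cancel in characteristic two.\<close>

lemma pent_odd_even:
  "(1 + Xpow (2 * n + 1)) * pent_odd n r = pent_even n r"
proof -
  let ?a = "6 * (r * r) + r" and ?b = "6 * (r * r) + 7 * r + 2"
  have nn: "?a \<ge> 0" "?b \<ge> 0" using pent_exp_bounds[of r] by linarith+
  have A: "(1 + Xpow (2 * n + 1)) * (qinv (n - 3 * r) * qinv (n + 1 + 3 * r)) =
     qinv (n - 3 * r) * qinv (n + 3 * r) +
     Xpow (n + 1 + 3 * r) * (qinv (n + 1 + 3 * r) * qinv (n - 1 - 3 * r))"
    using qinv_pascal[of "n + 1 + 3 * r" "n - 3 * r"] by (simp add: algebra_simps)
  have B: "(1 + Xpow (2 * n + 1)) * (qinv (n - 1 - 3 * r) * qinv (n + 2 + 3 * r)) =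
     qinv (n - 3 * r - 2) * qinv (n + 3 * r + 2) +
     Xpow (n - 1 - 3 * r) * (qinv (n - 1 - 3 * r) * qinv (n + 1 + 3 * r))"
    using qinv_pascal[of "n - 1 - 3 * r" "n + 2 + 3 * r"] by (simp add: algebra_simps)
  have C: "Xpow ?a * (Xpow (n + 1 + 3 * r) * (qinv (n + 1 + 3 * r) * qinv (n - 1 - 3 * r))) =
     Xpow ?b * (Xpow (n - 1 - 3 * r) * (qinv (n - 1 - 3 * r) * qinv (n + 1 + 3 * r)))"
  proof (cases "n + 1 + 3 * r < 0 \<or> n - 1 - 3 * r < 0")
    case False
    then have "Xpow ?a * Xpow (n + 1 + 3 * r) = Xpow (?a + (n + 1 + 3 * r))"
        "Xpow ?b * Xpow (n - 1 - 3 * r) = Xpow (?b + (n - 1 - 3 * r))"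
      using nn by (intro Xpow_add[symmetric]; linarith)+
    moreover have "?a + (n + 1 + 3 * r) = ?b + (n - 1 - 3 * r)" by simp
    ultimately have "Xpow ?a * Xpow (n + 1 + 3 * r) = Xpow ?b * Xpow (n - 1 - 3 * r)" by simp
    then show ?thesis by (simp only: mult.assoc[symmetric]) (simp only: mult_ac)
  qed auto
  have "(1 + Xpow (2 * n + 1)) * pent_odd n r =
      Xpow ?a * ((1 + Xpow (2 * n + 1)) * (qinv (n - 3 * r) * qinv (n + 1 + 3 * r))) +
      Xpow ?b * ((1 + Xpow (2 * n + 1)) * (qinv (n - 1 - 3 * r) * qinv (n + 2 + 3 * r)))"
    unfolding pent_odd_def distrib_left by (simp only: mult.left_commute)
  also have "\<dots> = pent_even n r"
    unfolding A B distrib_left C pent_even_def by (simp add: add_ac)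
  finally show ?thesis .
qed

lemma sum_pent_odd: "(1 + Xpow (2 * n + 1)) * fps_sum (pent_odd n) = fps_sum (pent_even n)"
  using fps_sum_mult_left[OF pent_summable(2), of "1 + Xpow (2 * n + 1)" n] by (simp add: pent_odd_even)

text \<open>Now the extra term of the first half at r matches that of the second half at r - 1, so
  the cancellation takes place only in the sum over all r.\<close>

lemma sum_pent_even: "(1 + Xpow (2 * n + 2)) * fps_sum (pent_even (n + 1)) = fps_sum (pent_odd n)"
proof -
  let ?a = "\<lambda>r::int. 6 * (r * r) + r" and ?b = "\<lambda>r::int. 6 * (r * r) + 7 * r + 2"
  let ?A = "\<lambda>r. Xpow (?a r) * (Xpow (n + 1 - 3 * r) * (qinv (n + 1 - 3 * r) * qinv (n + 3 * r)))"
  let ?B = "\<lambda>r. Xpow (?b r) * (Xpow (n + 3 + 3 * r) * (qinv (n + 3 + 3 * r) * qinv (n - 2 - 3 * r)))"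
  have nn: "?a r \<ge> 0" "?b r \<ge> 0" for r using pent_exp_bounds[of r] by linarith+
  have sm: "fps_summable ?A" "fps_summable ?B"
    by (intro fps_summable_Xpow_mult finite_pent_exp_le)+
  have "(1 + Xpow (2 * n + 2)) * fps_sum (pent_even (n + 1)) =
      fps_sum (\<lambda>r. (1 + Xpow (2 * n + 2)) * pent_even (n + 1) r)"
    by (rule fps_sum_mult_left[OF pent_summable(1), symmetric])
  also have "\<dots> = fps_sum (\<lambda>r. pent_odd n r + (?A r + ?B r))"
  proof (rule arg_cong[of _ _ fps_sum], rule ext)
    fix r
    have A: "(1 + Xpow (2 * n + 2)) * (qinv (n + 1 - 3 * r) * qinv (n + 1 + 3 * r)) =
       qinv (n - 3 * r) * qinv (n + 1 + 3 * r) +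
       Xpow (n + 1 - 3 * r) * (qinv (n + 1 - 3 * r) * qinv (n + 3 * r))"
      using qinv_pascal[of "n + 1 - 3 * r" "n + 1 + 3 * r"] by (simp add: algebra_simps)
    have B: "(1 + Xpow (2 * n + 2)) * (qinv (n + 1 - 3 * r - 2) * qinv (n + 1 + 3 * r + 2)) =
       qinv (n - 1 - 3 * r) * qinv (n + 2 + 3 * r) +
       Xpow (n + 3 + 3 * r) * (qinv (n + 3 + 3 * r) * qinv (n - 2 - 3 * r))"
      using qinv_pascal[of "n + 3 + 3 * r" "n - 1 - 3 * r"] by (simp add: algebra_simps)
    have "(1 + Xpow (2 * n + 2)) * pent_even (n + 1) r =
        Xpow (?a r) * ((1 + Xpow (2 * n + 2)) * (qinv (n + 1 - 3 * r) * qinv (n + 1 + 3 * r))) +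
        Xpow (?b r) * ((1 + Xpow (2 * n + 2)) * (qinv (n + 1 - 3 * r - 2) * qinv (n + 1 + 3 * r + 2)))"
      unfolding pent_even_def distrib_left by (simp only: mult.left_commute)
    also have "\<dots> = pent_odd n r + (?A r + ?B r)"
      unfolding A B distrib_left pent_odd_def by (simp add: add_ac)
    finally show "(1 + Xpow (2 * n + 2)) * pent_even (n + 1) r = pent_odd n r + (?A r + ?B r)" .
  qed
  also have "\<dots> = fps_sum (pent_odd n) + (fps_sum ?A + fps_sum ?B)"
    using sm by (simp add: fps_sum_add fps_summable_add pent_summable)
  also have "fps_sum ?B = fps_sum (\<lambda>r. ?B (r - 1))"
    by (rule fps_sum_reindex[symmetric])
      (use sm(2) in \<open>auto simp: inj_def intro: surjI[of _ "\<lambda>j. j + 1"]\<close>)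
  also have "(\<lambda>r. ?B (r - 1)) = ?A"
  proof
    fix r
    show "?B (r - 1) = ?A r"
    proof (cases "n + 1 - 3 * r < 0 \<or> n + 3 * r < 0")
      case False
      have "Xpow (?a r) * Xpow (n + 1 - 3 * r) = Xpow (?a r + (n + 1 - 3 * r))"
        by (rule Xpow_add[symmetric, OF nn(1)]) (use False in linarith)
      moreover have "Xpow (?b (r - 1)) * Xpow (n + 3 * r) = Xpow (?b (r - 1) + (n + 3 * r))"
        by (rule Xpow_add[symmetric, OF nn(2)]) (use False in linarith)
      moreover have "?a r + (n + 1 - 3 * r) = ?b (r - 1) + (n + 3 * r)" by (simp add: algebra_simps)
      ultimately have "Xpow (?b (r - 1)) * Xpow (n + 3 * r) = Xpow (?a r) * Xpow (n + 1 - 3 * r)" by simp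
      moreover have "n + 3 + 3 * (r - 1) = n + 3 * r" "n - 2 - 3 * (r - 1) = n + 1 - 3 * r" by simp_all
      ultimately show ?thesis by (simp only: mult.assoc[symmetric]) (simp only: mult_ac)
    qed auto
  qed
  finally show ?thesis by simp
qed

text \<open>Both sides satisfy the same alternating recurrence, whose factors 1 + q^(2n+1) and 1 +
  q^(2n+2) are nonzero for n >= 0.\<close>

lemma sum_pent:
  "fps_sum (pent_even (int n)) = qinv (2 * int n) \<and> fps_sum (pent_odd (int n)) = qinv (2 * int n + 1)"
proof -
  have odd: "fps_sum (pent_odd n) = qinv (2 * n + 1)" if "n \<ge> 0" "fps_sum (pent_even n) = qinv (2 * n)" for n
  proof -
    have "(1 + Xpow (2 * n + 1)) * fps_sum (pent_odd n) = (1 + Xpow (2 * n + 1)) * qinv (2 * n + 1)"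
      using sum_pent_odd[of n] that(2) qfact_inv_minus_one[of 1 "2 * n + 1"] by simp
    then show ?thesis using one_plus_Xpow_nonzero[of "2 * n + 1"] that(1) by simp
  qed
  have "fps_sum (pent_even (int n)) = qinv (2 * int n)"
  proof (induction n)
    case 0
    have "fps_sum (pent_even 0) $ k = (1 :: bit fps) $ k" for k
    proof -
      have "fps_sum (pent_even 0) $ k = (\<Sum>r\<in>{0}. pent_even 0 r $ k)"
      proof (rule fps_sum_nth_superset)
        fix r assume "pent_even 0 r $ k \<noteq> 0"
        then show "r \<in> {0}"
          by (cases "r < 0"; cases "r > 0") (auto simp: pent_even_def)
      qed simp
      also have "\<dots> = (1 :: bit fps) $ k" by (simp add: pent_even_def)
      finally show ?thesis .
    qed
    then show ?case by (simp add: fps_eq_iff)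
  next
    case (Suc n)
    have "(1 + Xpow (2 * int n + 2)) * fps_sum (pent_even (int n + 1)) = qinv (2 * int n + 1)"
      using sum_pent_even[of "int n"] odd[OF _ Suc] by simp
    also have "\<dots> = (1 + Xpow (2 * int n + 2)) * qinv (2 * int n + 2)"
      using qfact_inv_minus_one[of 1 "2 * int n + 2"] by (simp add: algebra_simps)
    finally have "fps_sum (pent_even (int n + 1)) = qinv (2 * int n + 2)"
      using one_plus_Xpow_nonzero[of "2 * int n + 2"] by simp
    then show ?case by (simp add: algebra_simps)
  qed
  with odd[of "int n"] show ?thesis by simp
qed

subsection \<open>Rogers--Ramanujan type identities modulo 20\<close>

text \<open>Extends the identities to negative n, where both sides are 0 because the two indices
  have negative sum. Bilateral sums over n can then be formed.\<close>

lemma sum_pent_int: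
  "fps_sum (pent_even n) = qinv (2 * n)" "fps_sum (pent_odd n) = qinv (2 * n + 1)"
proof -
  have zero: "qinv i * qinv j = 0" if "i + j < 0" for i j
    using that by (cases "i < 0") auto
  show "fps_sum (pent_even n) = qinv (2 * n)"
  proof (cases "n \<ge> 0")
    case True
    then show ?thesis using sum_pent[of "nat n"] by simp
  next
    case False
    then have "pent_even n = (\<lambda>r. 0)" by (simp add: pent_even_def fun_eq_iff zero del: One_nat_def)
    then show ?thesis using False by (simp add: fps_sum_def fps_zero_def)
  qed
  show "fps_sum (pent_odd n) = qinv (2 * n + 1)"
  proof (cases "n \<ge> 0")
    case True
    then show ?thesis using sum_pent[of "nat n"] by simp
  next
    case False
    then have "pent_odd n = (\<lambda>r. 0)" by (simp add: pent_odd_def fun_eq_iff zero del: One_nat_def)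
    then show ?thesis using False by (simp add: fps_sum_def fps_zero_def)
  qed
qed

lemma fps_summable_double:
  assumes "\<And>r. \<bar>r\<bar> \<le> e r"
  shows "fps_summable (\<lambda>(n::int, r::int). Xpow (n * n) * (Xpow (e r) * G n r))"
proof -
  have nn: "e r \<ge> 0" for r using assms[of r] by linarith
  have "finite {p. (case p of (n, r) \<Rightarrow> n * n + e r) \<le> int k}" for k
  proof (rule finite_subset)
    show "{p. (case p of (n, r) \<Rightarrow> n * n + e r) \<le> int k} \<subseteq> {n. n * n \<le> int k} \<times> {r. e r \<le> int k}"
    proof (clarsimp, intro conjI)
      fix n r assume h: "n * n + e r \<le> int k"
      show "n * n \<le> int k" using h nn[of r] by linarith
      have "0 \<le> n * n" by simp
      then show "e r \<le> int k" using h by linarith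
    qed
    show "finite ({n. n * n \<le> int k} \<times> {r. e r \<le> int k})"
      using finite_int_square_le finite_int_le_if_ge_abs[OF assms] by blast
  qed
  from fps_summable_Xpow_mult[OF this, of "\<lambda>(n, r). G n r"] show ?thesis
    by (simp add: case_prod_unfold Xpow_add nn mult.assoc)
qed

lemma fps_sum_Xpow_square_qinv:
  assumes "r * r + e = d" "e \<ge> 0"
  shows "fps_sum (\<lambda>n. Xpow (n * n) * (Xpow e * (qinv (n - r) * qinv (n + r)))) = Xpow d * inverse (euler 1)"
    and "fps_summable (\<lambda>n. Xpow (n * n) * (Xpow e * (qinv (n - r) * qinv (n + r))))"
proof -
  have "fps_sum (\<lambda>n. Xpow (n * n) * (Xpow e * (qinv (n - r) * qinv (n + r)))) =
      fps_sum (\<lambda>n. Xpow e * (Xpow (n * n) * (qinv (n - r) * qinv (n + r))))"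
    by (simp only: mult.left_commute)
  also have "\<dots> = Xpow e * fps_sum (\<lambda>n. Xpow (n * n) * (qinv (n - r) * qinv (n + r)))"
    by (intro fps_sum_mult_left fps_summable_Xpow_mult finite_int_square_le)
  also have "\<dots> = Xpow d * inverse (euler 1)"
    unfolding durfee_sum assms(1)[symmetric] using assms(2) by (simp add: Xpow_add mult_ac)
  finally show "fps_sum (\<lambda>n. Xpow (n * n) * (Xpow e * (qinv (n - r) * qinv (n + r)))) = Xpow d * inverse (euler 1)" .
  show "fps_summable (\<lambda>n. Xpow (n * n) * (Xpow e * (qinv (n - r) * qinv (n + r))))"
    by (intro fps_summable_Xpow_mult finite_int_square_le)
qed

text \<open>These four exponents are the square of a Bailey index plus a pentagonal exponent, as in
  \<open>exp_split\<close>. Five times the first two are the values of 3j^2 - j at j = -5r and j =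
  -5r - 3; five times the last two, minus 1, are those at -5r - 1 and -5r - 2.\<close>

definition X10_exp1 :: "int \<Rightarrow> int" where "X10_exp1 r = 15 * (r * r) + r"
definition X10_exp2 :: "int \<Rightarrow> int" where "X10_exp2 r = 15 * (r * r) + 19 * r + 6"
definition chi10_exp1 :: "int \<Rightarrow> int" where "chi10_exp1 r = 15 * (r * r) + 7 * r + 1"
definition chi10_exp2 :: "int \<Rightarrow> int" where "chi10_exp2 r = 15 * (r * r) + 13 * r + 3"

lemma exp_split:
  "(3 * r) * (3 * r) + (6 * (r * r) + r) = X10_exp1 r"
  "(3 * r + 2) * (3 * r + 2) + (6 * (r * r) + 7 * r + 2) = X10_exp2 r"
  "(3 * r + 1) * (3 * r + 1) + (6 * (r * r) + r) = chi10_exp1 r"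
  "(3 * r + 1) * (3 * r + 1) + (6 * (r * r) + 7 * r + 2) = chi10_exp2 r"
  by (simp_all add: X10_exp1_def X10_exp2_def chi10_exp1_def chi10_exp2_def algebra_simps)

lemma exp_bounds:
  "\<bar>r\<bar> \<le> X10_exp1 r" "\<bar>r\<bar> \<le> X10_exp2 r" "\<bar>r\<bar> \<le> chi10_exp1 r" "\<bar>r\<bar> \<le> chi10_exp2 r"
  unfolding exp_split[symmetric]
  using pent_exp_bounds[of r] zero_le_square[of "3 * r"] zero_le_square[of "3 * r + 1"] zero_le_square[of "3 * r + 2"]
  by linarith+

lemma exp_summable:
  "fps_summable (\<lambda>r. Xpow (X10_exp1 r))" "fps_summable (\<lambda>r. Xpow (X10_exp2 r))"
  "fps_summable (\<lambda>r. Xpow (chi10_exp1 r))" "fps_summable (\<lambda>r. Xpow (chi10_exp2 r))"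
  by (intro fps_summable_Xpow finite_int_le_if_ge_abs exp_bounds)+

text \<open>The expansion of 1/(q)_(2n) is inserted, the summations over n and r are exchanged, and
  the limiting Bailey lemma evaluates the sum over n.\<close>

lemma X10_sum:
  "fps_sum (\<lambda>n. Xpow (n * n) * qinv (2 * n)) =
    (fps_sum (\<lambda>r. Xpow (X10_exp1 r)) + fps_sum (\<lambda>r. Xpow (X10_exp2 r))) * inverse (euler 1)"
proof -
  let ?a = "\<lambda>r::int. 6 * (r * r) + r" and ?b = "\<lambda>r::int. 6 * (r * r) + 7 * r + 2"
  have nn: "?a r \<ge> 0" "?b r \<ge> 0" for r using pent_exp_bounds[of r] by linarith+
  let ?F = "\<lambda>n r. Xpow (n * n) * (Xpow (?a r) * (qinv (n - 3 * r) * qinv (n + 3 * r)))"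
  let ?G = "\<lambda>n r. Xpow (n * n) * (Xpow (?b r) * (qinv (n - (3 * r + 2)) * qinv (n + (3 * r + 2))))"
  have sm: "fps_summable (\<lambda>p. ?F (fst p) (snd p) + ?G (fst p) (snd p))"
    using fps_summable_add[OF fps_summable_double[OF pent_exp_bounds(1)] fps_summable_double[OF pent_exp_bounds(2)]]
    by (simp add: case_prod_unfold)
  have "fps_sum (\<lambda>n. Xpow (n * n) * qinv (2 * n)) = fps_sum (\<lambda>n. fps_sum (\<lambda>r. ?F n r + ?G n r))"
  proof (rule arg_cong[of _ _ fps_sum], rule ext)
    fix n
    have "Xpow (n * n) * qinv (2 * n) = fps_sum (\<lambda>r. Xpow (n * n) * pent_even n r)"
      unfolding sum_pent_int[symmetric] by (rule fps_sum_mult_left[OF pent_summable(1), symmetric])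
    also have "(\<lambda>r. Xpow (n * n) * pent_even n r) = (\<lambda>r. ?F n r + ?G n r)"
      by (simp add: pent_even_def distrib_left fun_eq_iff algebra_simps)
    finally show "Xpow (n * n) * qinv (2 * n) = fps_sum (\<lambda>r. ?F n r + ?G n r)" .
  qed
  also have "\<dots> = fps_sum (\<lambda>r. fps_sum (\<lambda>n. ?F n r + ?G n r))"
    using fps_sum_swap[OF sm] by (simp only: fst_conv snd_conv)
  also have "\<dots> = fps_sum (\<lambda>r. inverse (euler 1) * (Xpow (X10_exp1 r) + Xpow (X10_exp2 r)))"
  proof (rule arg_cong[of _ _ fps_sum], rule ext)
    fix r
    note 1 = fps_sum_Xpow_square_qinv[OF exp_split(1)[of r] nn(1)]
    note 2 = fps_sum_Xpow_square_qinv[OF exp_split(2)[of r] nn(2)]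
    show "fps_sum (\<lambda>n. ?F n r + ?G n r) = inverse (euler 1) * (Xpow (X10_exp1 r) + Xpow (X10_exp2 r))"
      unfolding fps_sum_add[OF 1(2) 2(2)] 1(1) 2(1) by (simp only: distrib_left mult.commute)
  qed
  also have "\<dots> = inverse (euler 1) * fps_sum (\<lambda>r. Xpow (X10_exp1 r) + Xpow (X10_exp2 r))"
    by (intro fps_sum_mult_left fps_summable_add exp_summable)
  also have "fps_sum (\<lambda>r. Xpow (X10_exp1 r) + Xpow (X10_exp2 r)) =
      fps_sum (\<lambda>r. Xpow (X10_exp1 r)) + fps_sum (\<lambda>r. Xpow (X10_exp2 r))"
    by (rule fps_sum_add; rule exp_summable)
  finally show ?thesis by (simp only: mult.commute)
qed

text \<open>The two halves have indices (i, j - 1) and (i - 1, j). The recurrence moves both to (i,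
  j), and the additional powers of q agree and cancel. The result is symmetric about 3r + 1, as the
  limiting Bailey lemma requires.\<close>

lemma pent_odd_eq:
  "pent_odd (n - 1) r = (Xpow (6 * (r * r) + r) + Xpow (6 * (r * r) + 7 * r + 2)) *
     (qinv (n - (3 * r + 1)) * qinv (n + (3 * r + 1)))"
proof (cases "n - (3 * r + 1) < 0 \<or> n + (3 * r + 1) < 0")
  case True
  then show ?thesis by (auto simp: pent_odd_def)
next
  case False
  let ?a = "6 * (r * r) + r" and ?b = "6 * (r * r) + 7 * r + 2"
  let ?i = "n - (3 * r + 1)" and ?j = "n + (3 * r + 1)"
  have nn: "?a \<ge> 0" "?b \<ge> 0" using pent_exp_bounds[of r] by linarith+
  have "Xpow ?a * Xpow ?j = Xpow (?a + ?j)" "Xpow ?b * Xpow ?i = Xpow (?b + ?i)"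
    using False nn by (intro Xpow_add[symmetric]; linarith)+
  moreover have "?a + ?j = ?b + ?i" by simp
  ultimately have eq: "Xpow ?a * Xpow ?j = Xpow ?b * Xpow ?i" by simp
  have i: "qinv (?i - 1) = (1 + Xpow ?i) * qinv ?i" and j: "qinv (?j - 1) = (1 + Xpow ?j) * qinv ?j"
    using qfact_inv_minus_one[of 1 ?i] qfact_inv_minus_one[of 1 ?j] by simp_all
  have "pent_odd (n - 1) r = Xpow ?a * (qinv ?i * qinv (?j - 1)) + Xpow ?b * (qinv (?i - 1) * qinv ?j)"
  proof -
    have "n - 1 - 3 * r = ?i" "n - 1 + 1 + 3 * r = ?j - 1" "n - 1 - 1 - 3 * r = ?i - 1" "n - 1 + 2 + 3 * r = ?j"
      by simp_all
    then show ?thesis unfolding pent_odd_def by (simp only:)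
  qed
  also have "\<dots> = (Xpow ?a + Xpow ?b + (Xpow ?a * Xpow ?j + Xpow ?b * Xpow ?i)) * (qinv ?i * qinv ?j)"
    unfolding i j by (simp only: distrib_left distrib_right mult_1_left mult_1_right add_ac mult_ac)
  finally show ?thesis unfolding eq by simp
qed

lemma chi10_sum:
  "fps_sum (\<lambda>n. Xpow (n * n) * qinv (2 * n - 1)) =
    (fps_sum (\<lambda>r. Xpow (chi10_exp1 r)) + fps_sum (\<lambda>r. Xpow (chi10_exp2 r))) * inverse (euler 1)"
proof -
  let ?a = "\<lambda>r::int. 6 * (r * r) + r" and ?b = "\<lambda>r::int. 6 * (r * r) + 7 * r + 2"
  have nn: "?a r \<ge> 0" "?b r \<ge> 0" for r using pent_exp_bounds[of r] by linarith+
  let ?g = "\<lambda>n r. qinv (n - (3 * r + 1)) * qinv (n + (3 * r + 1))"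
  let ?F = "\<lambda>n r. Xpow (n * n) * (Xpow (?a r) * ?g n r)"
  let ?G = "\<lambda>n r. Xpow (n * n) * (Xpow (?b r) * ?g n r)"
  have sm: "fps_summable (\<lambda>p. ?F (fst p) (snd p) + ?G (fst p) (snd p))"
    using fps_summable_add[OF fps_summable_double[OF pent_exp_bounds(1)] fps_summable_double[OF pent_exp_bounds(2)]]
    by (simp add: case_prod_unfold)
  have "fps_sum (\<lambda>n. Xpow (n * n) * qinv (2 * n - 1)) = fps_sum (\<lambda>n. fps_sum (\<lambda>r. ?F n r + ?G n r))"
  proof (rule arg_cong[of _ _ fps_sum], rule ext)
    fix n
    have "qinv (2 * n - 1) = fps_sum (pent_odd (n - 1))"
      using sum_pent_int(2)[of "n - 1"] by (simp add: algebra_simps)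
    then have "Xpow (n * n) * qinv (2 * n - 1) = fps_sum (\<lambda>r. Xpow (n * n) * pent_odd (n - 1) r)"
      using fps_sum_mult_left[OF pent_summable(2), of "Xpow (n * n)" "n - 1"] by simp
    also have "(\<lambda>r. Xpow (n * n) * pent_odd (n - 1) r) = (\<lambda>r. ?F n r + ?G n r)"
      by (simp only: pent_odd_eq distrib_left distrib_right)
    finally show "Xpow (n * n) * qinv (2 * n - 1) = fps_sum (\<lambda>r. ?F n r + ?G n r)" .
  qed
  also have "\<dots> = fps_sum (\<lambda>r. fps_sum (\<lambda>n. ?F n r + ?G n r))"
    using fps_sum_swap[OF sm] by (simp only: fst_conv snd_conv)
  also have "\<dots> = fps_sum (\<lambda>r. inverse (euler 1) * (Xpow (chi10_exp1 r) + Xpow (chi10_exp2 r)))"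
  proof (rule arg_cong[of _ _ fps_sum], rule ext)
    fix r
    note 1 = fps_sum_Xpow_square_qinv[OF exp_split(3)[of r] nn(1)]
    note 2 = fps_sum_Xpow_square_qinv[OF exp_split(4)[of r] nn(2)]
    show "fps_sum (\<lambda>n. ?F n r + ?G n r) = inverse (euler 1) * (Xpow (chi10_exp1 r) + Xpow (chi10_exp2 r))"
      unfolding fps_sum_add[OF 1(2) 2(2)] 1(1) 2(1) by (simp only: distrib_left mult.commute)
  qed
  also have "\<dots> = inverse (euler 1) * fps_sum (\<lambda>r. Xpow (chi10_exp1 r) + Xpow (chi10_exp2 r))"
    by (intro fps_sum_mult_left fps_summable_add exp_summable)
  also have "fps_sum (\<lambda>r. Xpow (chi10_exp1 r) + Xpow (chi10_exp2 r)) =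
      fps_sum (\<lambda>r. Xpow (chi10_exp1 r)) + fps_sum (\<lambda>r. Xpow (chi10_exp2 r))"
    by (rule fps_sum_add; rule exp_summable)
  finally show ?thesis by (simp only: mult.commute)
qed

subsection \<open>Sections of power series\<close>

definition fps_section :: "nat \<Rightarrow> nat \<Rightarrow> 'a::comm_ring_1 fps \<Rightarrow> 'a fps" where
  "fps_section k c f = Abs_fps (\<lambda>n. f $ (k * n + c))"

lemma fps_section_nth [simp]: "fps_section k c f $ n = f $ (k * n + c)"
  by (simp add: fps_section_def)

lemma fps_section_mult_compose:
  fixes f g :: "'a::comm_ring_1 fps"
  assumes "c < k"
  shows "fps_section k c (f * (g oo fps_X ^ k)) = fps_section k c f * g"
proof (rule fps_ext)
  fix n
  have k: "k > 0" using assms by simp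
  let ?G = "g oo fps_X ^ k"
  have "fps_section k c (f * ?G) $ n = (?G * f) $ (k * n + c)" by (simp add: mult.commute)
  also have "\<dots> = (\<Sum>i=0..k * n + c. ?G $ i * f $ (k * n + c - i))" by (rule fps_mult_nth)
  also have "\<dots> = (\<Sum>i\<in>(*) k ` {0..n}. ?G $ i * f $ (k * n + c - i))"
  proof (rule sum.mono_neutral_right)
    show "(*) k ` {0..n} \<subseteq> {0..k * n + c}" by (auto intro!: trans_le_add1)
    show "\<forall>i\<in>{0..k * n + c} - (*) k ` {0..n}. ?G $ i * f $ (k * n + c - i) = 0"
    proof
      fix i assume i: "i \<in> {0..k * n + c} - (*) k ` {0..n}"
      have "\<not> k dvd i"
      proof
        assume "k dvd i"
        then obtain j where j: "i = k * j" by (auto elim: dvdE)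
        have "k * j < k * Suc n" using i j assms by simp
        then have "j < Suc n" using k mult_less_cancel1 by blast
        then show False using i j by auto
      qed
      then show "?G $ i * f $ (k * n + c - i) = 0" using k by (simp add: fps_compose_X_power_nth)
    qed
  qed simp
  also have "\<dots> = (\<Sum>j=0..n. ?G $ (k * j) * f $ (k * n + c - k * j))"
    using k by (subst sum.reindex) (auto simp: inj_on_def)
  also have "\<dots> = (\<Sum>j=0..n. g $ j * fps_section k c f $ (n - j))"
  proof (rule sum.cong)
    fix j assume "j \<in> {0..n}"
    then have "k * n + c - k * j = k * (n - j) + c" by (simp add: right_diff_distrib')
    then show "?G $ (k * j) * f $ (k * n + c - k * j) = g $ j * fps_section k c f $ (n - j)"
      using k by (simp add: fps_compose_X_power_nth)
  qed simp
  also have "\<dots> = (fps_section k c f * g) $ n" by (simp add: fps_mult_nth mult.commute[of _ g])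
  finally show "fps_section k c (f * ?G) $ n = (fps_section k c f * g) $ n" .
qed

lemma inverse_euler_compose:
  "k > 0 \<Longrightarrow> inverse (euler (k * m) :: bit fps) = inverse (euler m) oo fps_X ^ k"
  by (simp add: fps_inverse_compose euler_compose)

section \<open>The 5-dissection of f_2\<close>

lemma euler_2_nth: "(euler 2 :: bit fps) $ n = of_nat (card {j::int. 3 * (j * j) - j = int n})"
proof -
  have "theta_exp 2 4 j = 3 * (j * j) - j" for j
    using two_theta_exp[of 2 4 j] by (simp add: algebra_simps)
  then show ?thesis unfolding euler_2_theta by (simp add: theta_nth)
qed

text \<open>The values 3j^2 - j are only 0, 2 or 4 modulo 5. Signs and offsets of r are chosen so
  that the exponents of the Bailey sums appear without further substitution.\<close>

lemma pentagonal_mod_5_cases: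
  fixes j :: int
  obtains
    (0) r where "j = - 5 * r" "3 * (j * j) - j = 5 * X10_exp1 r"
  | (1) r where "j = - 5 * r - 3" "3 * (j * j) - j = 5 * X10_exp2 r"
  | (2) r where "j = - 5 * r - 1" "3 * (j * j) - j = 5 * chi10_exp1 r - 1"
  | (3) r where "j = - 5 * r - 2" "3 * (j * j) - j = 5 * chi10_exp2 r - 1"
  | (4) r where "j = - 5 * r + 1" "3 * (j * j) - j = 5 * (5 * (3 * (r * r) - r)) + 2"
proof -
  define r where "r = - (j div 5)"
  have "j mod 5 = 0 \<or> j mod 5 = 1 \<or> j mod 5 = 2 \<or> j mod 5 = 3 \<or> j mod 5 = 4" by presburger
  moreover have "j = - 5 * r + j mod 5" unfolding r_def by simp
  ultimately consider "j = - 5 * r" | "j = - 5 * r + 1" | "j = - 5 * (r - 1) - 3" | "j = - 5 * (r - 1) - 2" | "j = - 5 * (r - 1) - 1"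
    by fastforce
  then show thesis
  proof cases
    case 1
    show thesis by (rule that(1)[OF 1]) (simp add: 1 X10_exp1_def algebra_simps)
  next
    case 2
    show thesis by (rule that(5)[OF 2]) (simp add: 2 algebra_simps)
  next
    case 3
    show thesis by (rule that(2)[OF 3]) (simp add: 3 X10_exp2_def algebra_simps)
  next
    case 4
    show thesis by (rule that(4)[OF 4]) (simp add: 4 chi10_exp2_def algebra_simps)
  next
    case 5
    show thesis by (rule that(3)[OF 5]) (simp add: 5 chi10_exp1_def algebra_simps)
  qed
qed

lemma card_Un_image:
  assumes "finite A" "finite B" "inj f" "inj g" "f ` A \<inter> g ` B = {}"
  shows "card (f ` A \<union> g ` B) = card A + card B"
  using assms by (simp add: card_Un_disjoint card_image inj_on_subset[OF _ subset_UNIV])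

lemma fps_sum_exp_nth:
  "fps_sum (\<lambda>r. Xpow (X10_exp1 r)) $ n = of_nat (card {r. X10_exp1 r = int n})"
  "fps_sum (\<lambda>r. Xpow (X10_exp2 r)) $ n = of_nat (card {r. X10_exp2 r = int n})"
  "fps_sum (\<lambda>r. Xpow (chi10_exp1 r)) $ n = of_nat (card {r. chi10_exp1 r = int n})"
  "fps_sum (\<lambda>r. Xpow (chi10_exp2 r)) $ n = of_nat (card {r. chi10_exp2 r = int n})"
  by (intro fps_sum_Xpow_nth finite_int_le_if_ge_abs exp_bounds order_trans[OF abs_ge_zero exp_bounds(1)]
    order_trans[OF abs_ge_zero exp_bounds(2)] order_trans[OF abs_ge_zero exp_bounds(3)]
    order_trans[OF abs_ge_zero exp_bounds(4)])+

lemma finite_exp_eq: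
  "finite {r. X10_exp1 r = int n}" "finite {r. X10_exp2 r = int n}"
  "finite {r. chi10_exp1 r = int n}" "finite {r. chi10_exp2 r = int n}"
  subgoal by (rule finite_subset[OF _ finite_int_le_if_ge_abs[OF exp_bounds(1), of n]], force)
  subgoal by (rule finite_subset[OF _ finite_int_le_if_ge_abs[OF exp_bounds(2), of n]], force)
  subgoal by (rule finite_subset[OF _ finite_int_le_if_ge_abs[OF exp_bounds(3), of n]], force)
  subgoal by (rule finite_subset[OF _ finite_int_le_if_ge_abs[OF exp_bounds(4), of n]], force)
  done

lemma euler_2_section_0:
  "fps_section 5 0 (euler 2) = fps_sum (\<lambda>r. Xpow (X10_exp1 r)) + fps_sum (\<lambda>r. Xpow (X10_exp2 r))"
proof (rule fps_ext)
  fix n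
  let ?A = "{r. X10_exp1 r = int n}" and ?B = "{r. X10_exp2 r = int n}"
  let ?f = "\<lambda>r::int. - 5 * r" and ?g = "\<lambda>r::int. - 5 * r - 3"
  have "{j::int. 3 * (j * j) - j = int (5 * n)} = ?f ` ?A \<union> ?g ` ?B"
  proof (intro equalityI subsetI)
    fix j :: int assume "j \<in> {j. 3 * (j * j) - j = int (5 * n)}"
    then have j: "3 * (j * j) - j = 5 * int n" by simp
    show "j \<in> ?f ` ?A \<union> ?g ` ?B"
    proof (cases j rule: pentagonal_mod_5_cases)
      case (0 r)
      then have "X10_exp1 r = int n" using j by linarith
      then show ?thesis using 0(1) by blast
    next
      case (1 r)
      then have "X10_exp2 r = int n" using j by linarith
      then show ?thesis using 1(1) by blast
    qed (use j in presburger)+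
  next
    fix j :: int assume "j \<in> ?f ` ?A \<union> ?g ` ?B"
    then show "j \<in> {j. 3 * (j * j) - j = int (5 * n)}"
      by (auto simp: X10_exp1_def X10_exp2_def algebra_simps)
  qed
  also have "card \<dots> = card ?A + card ?B"
  proof (rule card_Un_image)
    show "?f ` ?A \<inter> ?g ` ?B = {}"
    proof (rule ccontr)
      assume "?f ` ?A \<inter> ?g ` ?B \<noteq> {}"
      then obtain r s where "- 5 * r = - 5 * s - (3::int)" by blast
      then show False by presburger
    qed
  qed (auto simp: finite_exp_eq inj_def)
  finally show "fps_section 5 0 (euler 2) $ n =
      (fps_sum (\<lambda>r. Xpow (X10_exp1 r)) + fps_sum (\<lambda>r. Xpow (X10_exp2 r))) $ n"
    by (simp add: euler_2_nth fps_sum_exp_nth)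
qed

text \<open>The factor X replaces 5m + 4 by 5n - 1 with n = m + 1, the shape of these exponents and
  of the series \<open>chi10\<close>, which starts at n = 1.\<close>

lemma euler_2_section_4:
  "fps_X * fps_section 5 4 (euler 2) = fps_sum (\<lambda>r. Xpow (chi10_exp1 r)) + fps_sum (\<lambda>r. Xpow (chi10_exp2 r))"
proof (rule fps_ext)
  fix n
  let ?A = "{r. chi10_exp1 r = int n}" and ?B = "{r. chi10_exp2 r = int n}"
  let ?f = "\<lambda>r::int. - 5 * r - 1" and ?g = "\<lambda>r::int. - 5 * r - 2"
  have "{j::int. 3 * (j * j) - j = 5 * int n - 1} = ?f ` ?A \<union> ?g ` ?B"
  proof (intro equalityI subsetI)
    fix j :: int assume "j \<in> {j. 3 * (j * j) - j = 5 * int n - 1}"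
    then have j: "3 * (j * j) - j = 5 * int n - 1" by simp
    show "j \<in> ?f ` ?A \<union> ?g ` ?B"
    proof (cases j rule: pentagonal_mod_5_cases)
      case (2 r)
      then have "chi10_exp1 r = int n" using j by linarith
      then show ?thesis using 2(1) by blast
    next
      case (3 r)
      then have "chi10_exp2 r = int n" using j by linarith
      then show ?thesis using 3(1) by blast
    qed (use j in presburger)+
  next
    fix j :: int assume "j \<in> ?f ` ?A \<union> ?g ` ?B"
    then show "j \<in> {j. 3 * (j * j) - j = 5 * int n - 1}"
      by (auto simp: chi10_exp1_def chi10_exp2_def algebra_simps)
  qed
  also have "card \<dots> = card ?A + card ?B"
  proof (rule card_Un_image)
    show "?f ` ?A \<inter> ?g ` ?B = {}"
    proof (rule ccontr)
      assume "?f ` ?A \<inter> ?g ` ?B \<noteq> {}"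
      then obtain r s where "- 5 * r - 1 = - 5 * s - (2::int)" by blast
      then show False by presburger
    qed
  qed (auto simp: finite_exp_eq inj_def)
  finally have card: "card {j::int. 3 * (j * j) - j = 5 * int n - 1} = card ?A + card ?B" .
  show "(fps_X * fps_section 5 4 (euler 2)) $ n =
      (fps_sum (\<lambda>r. Xpow (chi10_exp1 r)) + fps_sum (\<lambda>r. Xpow (chi10_exp2 r))) $ n"
  proof (cases n)
    case 0
    have "3 * (j * j) - j \<noteq> - 1" for j :: int
      using abs_le_square_int[of j] by linarith
    then have "{j::int. 3 * (j * j) - j = 5 * int n - 1} = {}" using 0 by simp
    then have "card ?A + card ?B = 0" using card by simp
    then show ?thesis using 0 by (simp add: fps_sum_exp_nth)
  next
    case (Suc m)
    then have "(fps_X * fps_section 5 4 (euler 2) :: bit fps) $ n = of_nat (card {j::int. 3 * (j * j) - j = int (5 * m + 4)})"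
      by (simp add: euler_2_nth)
    also have "int (5 * m + 4) = 5 * int n - 1" using Suc by simp
    finally show ?thesis unfolding card by (simp only: fps_add_nth fps_sum_exp_nth of_nat_add)
  qed
qed

text \<open>Only j = 1 modulo 5 contributes, with values 25(3r^2 - r) + 2, so the section is f_2 in
  q^5.\<close>

lemma euler_2_section_2: "fps_section 5 2 (euler 2) = (euler 10 :: bit fps)"
proof (rule fps_ext)
  fix n
  let ?A = "{r::int. 5 * (3 * (r * r) - r) = int n}"
  let ?f = "\<lambda>r::int. - 5 * r + 1"
  have "{j::int. 3 * (j * j) - j = int (5 * n + 2)} = ?f ` ?A"
  proof (intro equalityI subsetI)
    fix j :: int assume "j \<in> {j. 3 * (j * j) - j = int (5 * n + 2)}"
    then have j: "3 * (j * j) - j = 5 * int n + 2" by simp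
    show "j \<in> ?f ` ?A"
    proof (cases j rule: pentagonal_mod_5_cases)
      case (4 r)
      then have "5 * (3 * (r * r) - r) = int n" using j by linarith
      then show ?thesis using 4(1) by blast
    qed (use j in presburger)+
  next
    fix j :: int assume "j \<in> ?f ` ?A"
    then obtain r where r: "j = - 5 * r + 1" "5 * (3 * (r * r) - r) = int n" by blast
    have "3 * (j * j) - j = 5 * (5 * (3 * (r * r) - r)) + 2" unfolding r(1) by (simp add: algebra_simps)
    then show "j \<in> {j. 3 * (j * j) - j = int (5 * n + 2)}" unfolding r(2) by simp
  qed
  also have "card \<dots> = card ?A" by (rule card_image) (simp add: inj_on_def)
  finally have L: "fps_section 5 2 (euler 2) $ n = (of_nat (card ?A) :: bit)" by (simp add: euler_2_nth)
  have "(euler 10 :: bit fps) = euler 2 oo fps_X ^ 5" using euler_compose[of 5 2, where ?'a = bit] by simp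
  then have R: "(euler 10 :: bit fps) $ n = (if 5 dvd n then euler 2 $ (n div 5) else 0)"
    by (simp add: fps_compose_X_power_nth)
  show "fps_section 5 2 (euler 2) $ n = (euler 10 :: bit fps) $ n"
  proof (cases "5 dvd n")
    case True
    then obtain m where m: "n = 5 * m" by (auto elim: dvdE)
    have "5 * E = int (5 * m) \<longleftrightarrow> E = int m" for E by simp
    then have "?A = {j::int. 3 * (j * j) - j = int m}" unfolding m by (simp only:)
    then have "of_nat (card ?A) = (euler 2 :: bit fps) $ m" by (simp only: euler_2_nth)
    then show ?thesis unfolding L R using m by simp
  next
    case False
    have "?A = {}"
    proof (rule ccontr)
      assume "?A \<noteq> {}"
      then obtain r :: int where "5 * (3 * (r * r) - r) = int n" by blast
      then have "int 5 dvd int n" by (metis dvd_triv_left of_nat_numeral)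
      then show False using False by (simp only: of_nat_dvd_iff)
    qed
    then show ?thesis unfolding L R using False by simp
  qed
qed

lemma euler_2_section_1_3: "c = 1 \<or> c = 3 \<Longrightarrow> fps_section 5 c (euler 2) = (0 :: bit fps)"
proof (rule fps_ext)
  fix n assume c: "c = 1 \<or> c = 3"
  have "{j::int. 3 * (j * j) - j = int (5 * n + c)} = {}"
  proof (rule ccontr)
    assume "{j::int. 3 * (j * j) - j = int (5 * n + c)} \<noteq> {}"
    then obtain j :: int where j: "3 * (j * j) - j = 5 * int n + int c" by auto
    from c show False
    proof
      assume "c = 1"
      then have j1: "3 * (j * j) - j = 5 * int n + 1" using j by simp
      show False by (cases j rule: pentagonal_mod_5_cases) (use j1 in presburger)+
    next
      assume "c = 3"
      then have j3: "3 * (j * j) - j = 5 * int n + 3" using j by simp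
      show False by (cases j rule: pentagonal_mod_5_cases) (use j3 in presburger)+
    qed
  qed
  then show "fps_section 5 c (euler 2) $ n = (0 :: bit fps) $ n" by (simp add: euler_2_nth)
qed

subsection \<open>Change of coefficients\<close>

text \<open>The target ring is left open: with \<open>complex\<close> it connects integral series to
  Taylor expansions, with \<open>bit\<close> it is reduction modulo 2.\<close>

definition of_int_fps :: "int fps \<Rightarrow> 'a::comm_ring_1 fps" where
  "of_int_fps f = Abs_fps (\<lambda>n. of_int (f $ n))"

lemma of_int_fps_nth [simp]: "of_int_fps f $ n = of_int (f $ n)"
  by (simp add: of_int_fps_def)

lemma of_int_fps_mult: "of_int_fps (f * g) = of_int_fps f * of_int_fps g"
  by (simp add: fps_eq_iff fps_mult_nth)

lemma of_int_fps_diff: "of_int_fps (f - g) = of_int_fps f - of_int_fps g"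
  by (simp add: fps_eq_iff)

lemma of_int_fps_add: "of_int_fps (f + g) = of_int_fps f + of_int_fps g"
  by (simp add: fps_eq_iff)

lemma of_int_fps_uminus: "of_int_fps (- f) = - of_int_fps f"
  by (simp add: fps_eq_iff)

lemma of_int_fps_1 [simp]: "of_int_fps 1 = 1"
  by (simp add: fps_eq_iff fps_one_def)

lemma of_int_fps_X [simp]: "of_int_fps fps_X = fps_X"
  by (simp add: fps_eq_iff fps_X_def)

lemma of_int_fps_power: "of_int_fps (f ^ n) = of_int_fps f ^ n"
  by (induction n) (simp_all add: of_int_fps_mult)

lemma of_int_fps_prod: "of_int_fps (\<Prod>i\<in>A. f i) = (\<Prod>i\<in>A. of_int_fps (f i))"
  by (induction A rule: infinite_finite_induct) (simp_all add: of_int_fps_mult)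

lemma of_int_fps_eprod: "of_int_fps (eprod S) = eprod S"
proof (rule fps_ext)
  fix n
  have "of_int_fps (\<Prod>s\<in>S \<inter> {1..n}. 1 - fps_X ^ s) = (\<Prod>s\<in>S \<inter> {1..n}. 1 - fps_X ^ s :: 'a fps)"
    by (simp add: of_int_fps_prod of_int_fps_diff of_int_fps_power)
  then have "of_int_fps (\<Prod>s\<in>S \<inter> {1..n}. 1 - fps_X ^ s) $ n = (\<Prod>s\<in>S \<inter> {1..n}. 1 - fps_X ^ s :: 'a fps) $ n"
    by (rule arg_cong)
  then show "of_int_fps (eprod S) $ n = (eprod S :: 'a fps) $ n"
    by (simp add: eprod_def)
qed

lemma of_int_fps_euler: "of_int_fps (euler k) = euler k"
  by (simp add: euler_def of_int_fps_eprod)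

lemma of_int_fps_inverse_unique:
  assumes "f * g = (1 :: int fps)"
  shows "of_int_fps g = inverse (of_int_fps f :: 'a::field fps)"
proof -
  have "of_int_fps f * (of_int_fps g :: 'a fps) = 1"
    using assms by (simp flip: of_int_fps_mult)
  then show ?thesis by (rule fps_inverse_unique[symmetric])
qed

subsection \<open>The mock theta functions modulo two\<close>

text \<open>Modulo 2 the factors 1 + q^(k+1) of (-q, q)_m become 1 - q^(k+1), so the denominators
  turn into (q)_m.\<close>

lemma of_int_fps_qpoch_inverse:
  "of_int_fps (fps_right_inverse (qpoch (- fps_X) fps_X m) 1) = qinv (int m)"
proof -
  have "of_int_fps (fps_right_inverse (qpoch (- fps_X) fps_X m) 1) =
      inverse (of_int_fps (qpoch (- fps_X) fps_X m) :: bit fps)"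
    by (rule of_int_fps_inverse_unique) (rule qpoch_inverse)
  also have "of_int_fps (qpoch (- fps_X) fps_X m) = (\<Prod>k<m. 1 - fps_X ^ Suc k :: bit fps)"
    by (simp add: qpoch_def of_int_fps_prod of_int_fps_add of_int_fps_mult of_int_fps_power fps_bit_minus)
  also have "\<dots> = (\<Prod>k=1..m. 1 - fps_X ^ (1 * k))"
    by (induction m) (simp_all add: mult.commute)
  finally show ?thesis by (simp add: qfact_inv_def)
qed

text \<open>Term n has order at least n, so coefficient k of the partial sums is constant from k + 1
  terms on. This links the topological sum to \<open>fps_sum\<close>.\<close>

lemma suminf_fps_nth:
  fixes t :: "nat \<Rightarrow> int fps"
  assumes "\<And>n k. k < n \<Longrightarrow> t n $ k = 0"
  shows "suminf t $ k = (\<Sum>n\<le>k. t n $ k)"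
proof -
  define G where "G = Abs_fps (\<lambda>k. \<Sum>n\<le>k. t n $ k)"
  have "t sums G"
    unfolding sums_def
  proof (rule tendsto_fpsI)
    fix k
    show "\<forall>\<^sub>F N in sequentially. (\<Sum>i<N. t i) $ k = G $ k"
    proof (rule eventually_sequentiallyI[of "Suc k"])
      fix N assume N: "N \<ge> Suc k"
      have "(\<Sum>i<N. t i) $ k = (\<Sum>i<N. t i $ k)" by (simp add: fps_sum_nth)
      also have "\<dots> = (\<Sum>n\<le>k. t n $ k)"
        by (rule sum.mono_neutral_right) (use N assms in auto)
      finally show "(\<Sum>i<N. t i) $ k = G $ k" by (simp add: G_def)
    qed
  qed
  then have "suminf t = G" by (rule sums_unique[symmetric])
  then show ?thesis by (simp add: G_def)
qed

lemma of_int_fps_suminf: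
  fixes t :: "nat \<Rightarrow> int fps" and e :: "nat \<Rightarrow> nat"
  assumes "\<And>n. t n = (- 1) ^ n * fps_X ^ e n * u n" "\<And>n. n \<le> e n"
  shows "of_int_fps (suminf t) = (fps_sum (\<lambda>n. fps_X ^ e n * of_int_fps (u n)) :: bit fps)"
proof (rule fps_ext)
  fix k
  let ?F = "\<lambda>n. fps_X ^ e n * of_int_fps (u n) :: bit fps"
  have t: "t n = fps_X ^ e n * ((- 1) ^ n * u n)" for n by (simp add: assms(1) mult_ac)
  have tF: "(of_int_fps (t n) :: bit fps) = ?F n" for n
  proof -
    have "of_int_fps ((- 1) ^ n) = (1 :: bit fps)"
      by (simp add: of_int_fps_power of_int_fps_uminus fps_bit_uminus)
    then show ?thesis by (simp add: assms(1) of_int_fps_mult of_int_fps_power)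
  qed
  have "t n $ k = 0" if "k < n" for n k
    using that assms(2)[of n] unfolding t by (simp add: fps_X_power_mult_nth)
  then have "suminf t $ k = (\<Sum>n\<le>k. t n $ k)" by (rule suminf_fps_nth)
  then have "of_int_fps (suminf t) $ k = (\<Sum>n\<le>k. (of_int_fps (t n) :: bit fps) $ k)" by simp
  also have "\<dots> = (\<Sum>n\<le>k. ?F n $ k)" by (simp only: tF)
  also have "\<dots> = fps_sum ?F $ k"
  proof (rule fps_sum_nth_superset[symmetric])
    fix n assume "?F n $ k \<noteq> 0"
    then show "n \<in> {..k}" using assms(2)[of n] by (auto simp: fps_X_power_mult_nth split: if_splits)
  qed simp
  finally show "of_int_fps (suminf t) $ k = fps_sum ?F $ k" .
qed

lemma of_int_fps_X10:
  "of_int_fps X10 = fps_section 5 0 (euler 2) * inverse (euler 1 :: bit fps)"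
proof -
  have "of_int_fps X10 = (fps_sum (\<lambda>n. fps_X ^ (n\<^sup>2) *
      of_int_fps (fps_right_inverse (qpoch (- fps_X) fps_X (2 * n)) 1)) :: bit fps)"
    unfolding X10_def by (rule of_int_fps_suminf) (simp_all add: power2_nat_le_imp_le self_le_power power2_eq_square)
  also have "\<dots> = fps_sum (\<lambda>n::nat. Xpow (int n * int n) * qinv (2 * int n))"
  proof (rule arg_cong[of _ _ fps_sum], rule ext)
    fix n :: nat
    have "int n * int n = int (n\<^sup>2)" "2 * int n = int (2 * n)"
      by (simp_all add: power2_eq_square)
    then show "fps_X ^ (n\<^sup>2) * of_int_fps (fps_right_inverse (qpoch (- fps_X) fps_X (2 * n)) 1) =
        Xpow (int n * int n) * qinv (2 * int n)"
      by (simp only: of_int_fps_qpoch_inverse Xpow_int)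
  qed
  \<comment> \<open>Negative n may be added, since \<open>qinv (2 * n)\<close> is 0 there.\<close>
  also have "\<dots> = fps_sum (\<lambda>n. Xpow (n * n) * qinv (2 * n))"
  proof (rule fps_sum_reindex)
    show "fps_summable (\<lambda>n. Xpow (n * n) * qinv (2 * n))"
      by (intro fps_summable_Xpow_mult finite_int_square_le)
    fix n :: int assume "n \<notin> range int"
    then have "n < 0" by (metis int_eq_iff not_less rangeI)
    then show "Xpow (n * n) * qinv (2 * n) = 0" by simp
  qed simp
  finally show ?thesis unfolding X10_sum euler_2_section_0 .
qed

lemma of_int_fps_chi10:
  "of_int_fps chi10 = fps_X * fps_section 5 4 (euler 2) * inverse (euler 1 :: bit fps)"
proof -
  have "of_int_fps chi10 = (fps_sum (\<lambda>n. fps_X ^ ((n + 1)\<^sup>2) *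
      of_int_fps (fps_right_inverse (qpoch (- fps_X) fps_X (2 * n + 1)) 1)) :: bit fps)"
    unfolding chi10_def by (rule of_int_fps_suminf) (simp_all add: power2_eq_square)
  also have "\<dots> = fps_sum (\<lambda>n::nat. Xpow ((int n + 1) * (int n + 1)) * qinv (2 * (int n + 1) - 1))"
  proof (rule arg_cong[of _ _ fps_sum], rule ext)
    fix n :: nat
    have "(int n + 1) * (int n + 1) = int ((n + 1)\<^sup>2)" "2 * (int n + 1) - 1 = int (2 * n + 1)"
      by (simp_all add: power2_eq_square algebra_simps)
    then show "fps_X ^ ((n + 1)\<^sup>2) * of_int_fps (fps_right_inverse (qpoch (- fps_X) fps_X (2 * n + 1)) 1) =
        Xpow ((int n + 1) * (int n + 1)) * qinv (2 * (int n + 1) - 1)"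
      by (simp only: of_int_fps_qpoch_inverse Xpow_int)
  qed
  \<comment> \<open>The substitution n + 1 for n; the added terms with n < 1 vanish because 2n - 1
    is negative.\<close>
  also have "\<dots> = fps_sum (\<lambda>n. Xpow (n * n) * qinv (2 * n - 1))"
  proof (rule fps_sum_reindex)
    show "fps_summable (\<lambda>n. Xpow (n * n) * qinv (2 * n - 1))"
      by (intro fps_summable_Xpow_mult finite_int_square_le)
    fix n :: int assume n: "n \<notin> range (\<lambda>n::nat. int n + 1)"
    have "n < 1"
    proof (rule ccontr)
      assume "\<not> n < 1"
      then have "n = int (nat (n - 1)) + 1" by simp
      then show False using n by blast
    qed
    then show "Xpow (n * n) * qinv (2 * n - 1) = 0" by simp
  qed (simp add: inj_def)
  finally show ?thesis unfolding chi10_sum euler_2_section_4 .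
qed

subsection \<open>Partitions with restricted parts\<close>

definition partitions_in :: "nat set \<Rightarrow> nat \<Rightarrow> nat multiset set" where
  "partitions_in S n = {M. sum_mset M = n \<and> set_mset M \<subseteq> S}"

lemma size_le_sum_mset: "0 \<notin># M \<Longrightarrow> size M \<le> sum_mset (M :: nat multiset)"
  by (induction M) auto

lemma member_le_sum_mset: "m \<in># M \<Longrightarrow> m \<le> sum_mset (M :: nat multiset)"
  by (induction M) auto

lemma finite_partitions_in:
  assumes "finite S" "0 \<notin> S"
  shows "finite (partitions_in S n)"
proof (rule finite_subset)
  show "partitions_in S n \<subseteq> mset ` {xs. set xs \<subseteq> S \<and> length xs \<le> n}"
  proof
    fix M assume M: "M \<in> partitions_in S n"
    obtain xs where xs: "M = mset xs" by (metis ex_mset)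
    have "0 \<notin># M" using M assms(2) by (auto simp: partitions_in_def)
    then have "length xs \<le> n" using size_le_sum_mset[of M] M xs by (simp add: partitions_in_def)
    moreover have "set xs \<subseteq> S" using M xs by (simp add: partitions_in_def)
    ultimately show "M \<in> mset ` {xs. set xs \<subseteq> S \<and> length xs \<le> n}" using xs by blast
  qed
qed (use finite_lists_length_le[OF assms(1)] in blast)

text \<open>A partition either avoids s or loses one copy of it. With P the series for S and Q that
  for S and s, this says Q = P + X^s Q.\<close>

lemma partitions_in_gf:
  assumes "finite S" "0 \<notin> S"
  shows "Abs_fps (\<lambda>n. of_nat (card (partitions_in S n))) * (\<Prod>s\<in>S. 1 - fps_X ^ s) = (1 :: 'a::comm_ring_1 fps)"
  using assms
proof (induction S rule: finite_induct)
  case empty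
  have "partitions_in {} n = (if n = 0 then {{#}} else {})" for n
    by (auto simp: partitions_in_def)
  then show ?case by (auto simp: fps_eq_iff)
next
  case (insert s S)
  let ?P = "\<lambda>S. Abs_fps (\<lambda>n. of_nat (card (partitions_in S n)) :: 'a)"
  have s: "s > 0" using insert.prems by auto
  have fin: "finite (partitions_in S n)" "finite (partitions_in (insert s S) n)" for n
    using insert by (auto intro!: finite_partitions_in)
  have card: "card (partitions_in (insert s S) n) = card (partitions_in S n) +
      (if n < s then 0 else card (partitions_in (insert s S) (n - s)))" for n
  proof -
    have "partitions_in (insert s S) n = partitions_in S n \<union>
        (if n < s then {} else add_mset s ` partitions_in (insert s S) (n - s))"
    proof (intro equalityI subsetI)
      fix M assume M: "M \<in> partitions_in (insert s S) n"
      show "M \<in> partitions_in S n \<union>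
        (if n < s then {} else add_mset s ` partitions_in (insert s S) (n - s))"
      proof (cases "s \<in># M")
        case True
        then obtain N where N: "M = add_mset s N" by (metis insert_DiffM)
        then have "s + sum_mset N = n" "set_mset N \<subseteq> insert s S" using M by (auto simp: partitions_in_def)
        then have "\<not> n < s" "N \<in> partitions_in (insert s S) (n - s)" by (auto simp: partitions_in_def)
        then show ?thesis using N by simp
      next
        case False
        then show ?thesis using M by (auto simp: partitions_in_def)
      qed
    next
      fix M assume "M \<in> partitions_in S n \<union>
        (if n < s then {} else add_mset s ` partitions_in (insert s S) (n - s))"
      then show "M \<in> partitions_in (insert s S) n"
        by (auto simp: partitions_in_def split: if_splits)
    qed
    moreover have "partitions_in S n \<inter>
        (if n < s then {} else add_mset s ` partitions_in (insert s S) (n - s)) = {}"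
    proof (rule ccontr)
      assume "\<not> ?thesis"
      then obtain N where "add_mset s N \<in> partitions_in S n" by (auto split: if_splits)
      then have "s \<in> S" by (simp add: partitions_in_def)
      then show False using insert.hyps(2) by simp
    qed
    moreover have "card (if n < s then {} else add_mset s ` partitions_in (insert s S) (n - s)) =
        (if n < s then 0 else card (partitions_in (insert s S) (n - s)))"
      by (simp add: card_image inj_on_def)
    ultimately show ?thesis
      using fin by (simp add: card_Un_disjoint)
  qed
  have "?P (insert s S) = ?P S + fps_X ^ s * ?P (insert s S)"
    by (auto simp: fps_eq_iff fps_X_power_mult_nth card)
  then have "?P (insert s S) * (1 - fps_X ^ s) = ?P S" by (simp add: algebra_simps)
  then have "?P (insert s S) * ((1 - fps_X ^ s) * (\<Prod>s\<in>S. 1 - fps_X ^ s)) = ?P S * (\<Prod>s\<in>S. 1 - fps_X ^ s)"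
    by (simp only: mult.assoc[symmetric])
  then show ?case using insert by simp
qed

lemma fps_X_power_dvd_diff_nth:
  "fps_X ^ n dvd f - (g :: 'a::comm_ring_1 fps) \<Longrightarrow> k < n \<Longrightarrow> f $ k = g $ k"
  unfolding fps_X_power_dvd_iff by simp

text \<open>Parts of a partition of n do not exceed n, so a finite set of parts suffices for each
  coefficient. Splitting f_1 into multiples of 10 and the rest identifies the quotient.\<close>

lemma p10_gf: "(of_nat (p10 n) :: bit) = (euler 10 * inverse (euler 1)) $ n"
proof -
  let ?S = "{s::nat. \<not> 10 dvd s}"
  let ?T = "?S \<inter> {1..n}"
  have "{M :: nat multiset. sum_mset M = n \<and> (\<forall>m\<in>#M. 0 < m \<and> \<not> 10 dvd m)} = partitions_in ?T n"
  proof (rule set_eqI)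
    fix M :: "nat multiset"
    have "0 < m \<and> \<not> 10 dvd m \<longleftrightarrow> m \<in> ?T" if "sum_mset M = n" "m \<in># M" for m
      using member_le_sum_mset[OF that(2)] that(1) by (cases m) auto
    then show "M \<in> {M. sum_mset M = n \<and> (\<forall>m\<in>#M. 0 < m \<and> \<not> 10 dvd m)} \<longleftrightarrow> M \<in> partitions_in ?T n"
      unfolding partitions_in_def by blast
  qed
  then have p: "p10 n = card (partitions_in ?T n)" by (simp add: p10_def)
  let ?P = "Abs_fps (\<lambda>m. of_nat (card (partitions_in ?T m)) :: bit)"
  have "?P * (\<Prod>s\<in>?T. 1 - fps_X ^ s) = 1" by (rule partitions_in_gf) auto
  then have P: "?P = inverse (\<Prod>s\<in>?T. 1 - fps_X ^ s)"
    by (intro fps_inverse_unique[symmetric]) (simp only: mult.commute)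
  have nz: "(\<Prod>s\<in>?T. 1 - fps_X ^ s :: bit fps) $ 0 \<noteq> 0"
    using eprod_dvd'[of n ?S, where ?'a = bit] unfolding fps_X_power_dvd_iff by auto
  have "fps_X ^ Suc n dvd ?P - inverse (eprod ?S)"
    unfolding P by (rule dvd_diff_inverse[OF eprod_dvd' nz]) simp
  then have "?P $ n = inverse (eprod ?S) $ n" by (rule fps_X_power_dvd_diff_nth) simp
  moreover have "euler 1 = (eprod ?S * euler 10 :: bit fps)"
    unfolding euler_def by (rule eprod_Un_eq) auto
  then have "inverse (euler 1) = (inverse (eprod ?S) * inverse (euler 10) :: bit fps)"
    by (simp add: fps_inverse_mult)
  then have "euler 10 * inverse (euler 1) = (inverse (eprod ?S) * (inverse (euler 10) * euler 10) :: bit fps)"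
    by (simp only: mult_ac)
  then have "euler 10 * inverse (euler 1) = (inverse (eprod ?S) :: bit fps)"
    by (simp add: inverse_mult_eq_1)
  ultimately show ?thesis using p by simp
qed

subsection \<open>Fourier coefficients of eta quotients\<close>

context
  fixes k :: nat and f :: "complex \<Rightarrow> complex" and P :: "nat \<Rightarrow> complex \<Rightarrow> complex"
  defines "f \<equiv> \<lambda>q. qpoch_inf (q ^ k) (q ^ k)" and "P \<equiv> \<lambda>N q. \<Prod>n<N. 1 - q ^ k * (q ^ k) ^ n"
  assumes k: "k > 0"
begin

text \<open>One geometric bound, uniform on a closed disc, serves convergence, uniform convergence
  and the nonvanishing of the factors.\<close>

lemma euler_norm_factor: "norm q \<le> r \<Longrightarrow> r \<le> 1 \<Longrightarrow> norm (1 - q ^ k * (q ^ k) ^ n - 1) \<le> r ^ Suc n"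
  for q :: complex
proof -
  assume r: "norm q \<le> r" "r \<le> 1"
  have "norm (q ^ k) \<le> norm q" using power_decreasing[of 1 k "norm q"] k r by (simp add: norm_power)
  then have "norm (q ^ k) ^ Suc n \<le> r ^ Suc n" using r by (intro power_mono) auto
  then show ?thesis by (simp add: norm_mult norm_power)
qed

lemma euler_convergent_prod:
  fixes q :: complex
  assumes "norm q < 1"
  shows "convergent_prod (\<lambda>n. 1 - q ^ k * (q ^ k) ^ n)"
proof -
  have "summable (\<lambda>n. norm q ^ Suc n)" using assms by (subst summable_Suc_iff) (simp add: summable_geometric)
  then have "summable (\<lambda>n. norm (1 - q ^ k * (q ^ k) ^ n - 1))"
    using euler_norm_factor[of q "norm q"] assms by (intro summable_comparison_test[OF _ \<open>summable (\<lambda>n. norm q ^ Suc n)\<close>]) auto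
  then show ?thesis
    by (intro abs_convergent_prod_imp_convergent_prod summable_imp_abs_convergent_prod)
qed

lemma euler_uniform_limit:
  assumes "r < 1"
  shows "uniform_limit (cball 0 r) P f sequentially"
proof (cases "r \<ge> 0")
  case True
  have "uniformly_convergent_on (cball 0 r) P"
    unfolding P_def
  proof (rule uniformly_convergent_on_prod')
    show "uniformly_convergent_on (cball (0::complex) r) (\<lambda>N q. \<Sum>n<N. norm (1 - q ^ k * (q ^ k) ^ n - 1))"
    proof (rule Weierstrass_m_test'_ev)
      show "\<forall>\<^sub>F n in sequentially. \<forall>q\<in>cball (0::complex) r. norm (norm (1 - q ^ k * (q ^ k) ^ n - 1)) \<le> r ^ Suc n"
        using euler_norm_factor[of _ r] assms by (intro always_eventually) simp
      show "summable (\<lambda>n. r ^ Suc n)" using assms True by (subst summable_Suc_iff) (simp add: summable_geometric)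
    qed
  qed (auto intro!: continuous_intros)
  then obtain g where g: "uniform_limit (cball 0 r) P g sequentially"
    by (auto simp: uniformly_convergent_on_def)
  also have "?this \<longleftrightarrow> uniform_limit (cball 0 r) P f sequentially"
  proof (intro uniform_limit_cong)
    fix q :: complex assume q: "q \<in> cball 0 r"
    then have "norm q < 1" using assms by simp
    from tendsto_uniform_limitI[OF g q] have "(\<lambda>n. P (Suc n) q) \<longlonglongrightarrow> g q"
      by (rule LIMSEQ_Suc)
    moreover have "(\<lambda>n. P (Suc n) q) \<longlonglongrightarrow> f q"
      using convergent_prod_LIMSEQ[OF euler_convergent_prod[OF \<open>norm q < 1\<close>]]
      unfolding P_def lessThan_Suc_atMost by (simp add: f_def qpoch_inf_def)
    ultimately show "g q = f q" by (rule LIMSEQ_unique)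
  qed auto
  finally show ?thesis .
qed simp

lemma euler_fun_holomorphic: "f holomorphic_on ball 0 1"
proof (rule holomorphic_uniform_sequence)
  show "open (ball 0 1 :: complex set)" by simp
  show "P n holomorphic_on ball 0 1" for n unfolding P_def by (intro holomorphic_intros)
  fix q :: complex assume q: "q \<in> ball 0 1"
  define d where "d = (1 - norm q) / 2"
  have d: "d > 0" "norm q + d < 1" using q by (auto simp: d_def field_simps)
  have sub: "cball q d \<subseteq> cball 0 (norm q + d)"
    by (simp add: cball_subset_cball_iff)
  have "uniform_limit (cball q d) P f sequentially"
    by (rule uniform_limit_on_subset[OF euler_uniform_limit[OF d(2)] sub])
  moreover have "cball q d \<subseteq> ball 0 1" using sub d(2) by (auto simp: subset_iff)
  ultimately show "\<exists>d>0. cball q d \<subseteq> ball 0 1 \<and> uniform_limit (cball q d) P f sequentially"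
    using d(1) by blast
qed

lemma euler_fun_nonzero:
  assumes "norm q < 1"
  shows "f q \<noteq> 0"
  unfolding f_def qpoch_inf_def
proof (rule prodinf_nonzero[OF euler_convergent_prod[OF assms]])
  fix n
  have "norm (1 - q ^ k * (q ^ k) ^ n - 1) \<le> norm q ^ Suc n"
    by (rule euler_norm_factor) (use assms in auto)
  also have "\<dots> < 1" using assms power_Suc_less_one[of "norm q" n] by (cases "q = 0") auto
  finally show "1 - q ^ k * (q ^ k) ^ n \<noteq> 0" by auto
qed

text \<open>The m-th derivative at 0 of the partial products converges by uniform convergence, and
  is eventually constant with the value given by the formal product.\<close>

lemma euler_fun_has_fps_expansion: "f has_fps_expansion euler k"
proof -
  have exp: "f has_fps_expansion fps_expansion f 0"
    by (rule has_fps_expansion_fps_expansion[OF _ _ euler_fun_holomorphic]) auto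
  have "fps_expansion f 0 = euler k"
  proof (rule fps_ext)
    fix m
    have "((\<lambda>N. (deriv ^^ m) (P N) 0) \<longlongrightarrow> (deriv ^^ m) f 0) sequentially"
    proof (rule higher_deriv_complex_uniform_limit)
      show "uniform_limit (ball 0 (1/2)) P f sequentially"
        by (rule uniform_limit_on_subset[OF euler_uniform_limit[of "1/2"]]) auto
      show "\<forall>\<^sub>F n in sequentially. P n holomorphic_on ball 0 (1/2)"
        unfolding P_def by (intro always_eventually allI holomorphic_intros)
    qed auto
    moreover have "\<forall>\<^sub>F N in sequentially. (deriv ^^ m) (P N) 0 = euler k $ m * fact m"
    proof (rule eventually_sequentiallyI[of "Suc m"])
      fix N assume N: "N \<ge> Suc m"
      let ?Q = "\<Prod>n<N. 1 - fps_X ^ k * (fps_X ^ k) ^ n :: complex fps"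
      have "P N has_fps_expansion ?Q"
        unfolding P_def by (intro fps_expansion_intros)
      then have "?Q $ m = (deriv ^^ m) (P N) 0 / fact m" by (rule fps_nth_fps_expansion)
      moreover have "fps_X ^ Suc m dvd ?Q - euler k"
      proof -
        have "fps_X ^ Suc m dvd (\<Prod>s\<in>(\<lambda>n. k * Suc n) ` {..<N}. 1 - fps_X ^ s) - (eprod {s. k dvd s} :: complex fps)"
        proof (rule eprod_dvd)
          show "{s. k dvd s} \<inter> {1..m} \<subseteq> (\<lambda>n. k * Suc n) ` {..<N}"
          proof
            fix s assume s: "s \<in> {s. k dvd s} \<inter> {1..m}"
            then obtain t where t: "s = k * t" by (auto elim: dvdE)
            then obtain u where u: "t = Suc u" using s by (cases t) auto
            have "t \<le> k * t" using k by simp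
            then have "u < N" using s t u N by simp
            then show "s \<in> (\<lambda>n. k * Suc n) ` {..<N}" using t u by blast
          qed
        qed (use k in auto)
        also have "(\<Prod>s\<in>(\<lambda>n. k * Suc n) ` {..<N}. 1 - fps_X ^ s :: complex fps) = (\<Prod>n<N. 1 - fps_X ^ (k * Suc n))"
          using k by (subst prod.reindex) (auto simp: inj_on_def)
        also have "\<dots> = ?Q" by (simp add: power_add power_mult)
        finally show ?thesis by (simp only: euler_def)
      qed
      then have "?Q $ m = euler k $ m" by (rule fps_X_power_dvd_diff_nth) simp
      ultimately show "(deriv ^^ m) (P N) 0 = euler k $ m * fact m" by (simp add: field_simps)
    qed
    then have "((\<lambda>N. (deriv ^^ m) (P N) 0) \<longlongrightarrow> euler k $ m * fact m) sequentially"
      by (rule tendsto_eventually)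
    ultimately have "(deriv ^^ m) f 0 = euler k $ m * fact m" by (rule LIMSEQ_unique)
    then show "fps_expansion f 0 $ m = euler k $ m" by (simp add: fps_expansion_def)
  qed
  with exp show ?thesis by simp
qed

end

text \<open>The factor 1/q moves coefficient n + 1 of F to position n, and the constant term 1
  becomes the simple pole. Uniqueness of the expansion then evaluates the definite
  description.\<close>

lemma fourier_coeff_eqI:
  fixes F :: "int fps"
  assumes h: "h holomorphic_on ball 0 1" "h has_fps_expansion of_int_fps F" "F $ 0 = 1"
    and f: "\<And>\<tau>. Im \<tau> > 0 \<Longrightarrow> f \<tau> = inverse (nome \<tau>) * h (nome \<tau>)"
  shows "fourier_coeff f (int n) = F $ Suc n"
proof -
  define c where "c i = (if i < -1 then 0 else F $ nat (i + 1))" for i :: int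
  have "has_q_expansion f c"
    unfolding has_q_expansion_def
  proof (intro conjI allI impI)
    fix \<tau> assume \<tau>: "Im \<tau> > 0"
    define q where "q = nome \<tau>"
    have q0: "q \<noteq> 0" by (simp add: q_def nome_def)
    have "norm q < 1" using \<tau> by (simp add: q_def nome_def)
    have "(\<lambda>n. of_int_fps F $ n * q ^ n) sums h q"
      by (rule has_fps_expansion_imp_sums_complex[OF h(2), of 1])
        (use h(1) \<open>norm q < 1\<close> in \<open>simp_all add: one_ereal_def\<close>)
    then have "(\<lambda>n. of_int (F $ Suc n) * q ^ Suc n) sums (h q - 1)"
      using sums_split_initial_segment[of "\<lambda>n. of_int_fps F $ n * q ^ n" "h q" 1] h(3) by simp
    from sums_divide[OF this, of q] have "(\<lambda>n. of_int (F $ Suc n) * q ^ n) sums ((h q - 1) / q)"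
      using q0 by simp
    moreover have "(h q - 1) / q = f \<tau> - inverse q"
      using f[OF \<tau>] q0 by (simp add: q_def field_simps)
    moreover have "c (int n) = F $ Suc n" for n by (simp add: c_def nat_add_distrib)
    ultimately show "(\<lambda>n. of_int (c (int n)) * nome \<tau> ^ n) sums (f \<tau> - inverse (nome \<tau>))"
      by (simp add: q_def)
  qed (simp_all add: c_def h(3))
  then have "fourier_coeff f = c"
    unfolding fourier_coeff_def by (intro the_equality) (auto intro: has_q_expansion_unique)
  then show ?thesis by (simp add: c_def nat_add_distrib)
qed

text \<open>A fixed 24th root of q, which makes all prefactors integral powers. Their totals 6 - 30
  and 2 + 25 - 1 - 50 are both -24, the pole q^(-1).\<close>

definition eta_base :: "complex \<Rightarrow> complex" where
  "eta_base \<tau> = exp (2 * of_real pi * \<i> * \<tau> / 24)"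

lemma eta_eq: "eta k \<tau> = eta_base \<tau> ^ k * qpoch_inf (nome \<tau> ^ k) (nome \<tau> ^ k)"
  unfolding eta_def eta_base_def by (simp add: exp_of_nat_mult[symmetric] mult_ac)

lemma nome_eq: "nome \<tau> = eta_base \<tau> ^ 24"
  unfolding nome_def eta_base_def by (simp add: exp_of_nat_mult[symmetric] mult_ac)

lemma eta_base_nonzero [simp]: "eta_base \<tau> \<noteq> 0"
  by (simp add: eta_base_def)

lemma eta_base_cancel:
  fixes a b c d :: complex
  shows "(eta_base \<tau> ^ 1 * a) ^ 6 / (eta_base \<tau> ^ 5 * b) ^ 6 =
      inverse (eta_base \<tau> ^ 24) * (a ^ 6 * inverse b ^ 6)"
    and "eta_base \<tau> ^ 2 * a * (eta_base \<tau> ^ 5 * b) ^ 5 / (eta_base \<tau> ^ 1 * c * (eta_base \<tau> ^ 10 * d) ^ 5) =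
      inverse (eta_base \<tau> ^ 24) * (a * b ^ 5 * (inverse c * inverse d ^ 5))"
proof -
  let ?w = "eta_base \<tau>"
  have "(?w ^ 1 * a) ^ 6 / (?w ^ 5 * b) ^ 6 = (?w ^ 6 * a ^ 6) / (?w ^ 6 * (?w ^ 24 * b ^ 6))"
    by (simp add: power_mult_distrib mult.assoc[symmetric] flip: power_mult power_add)
  also have "\<dots> = a ^ 6 / (?w ^ 24 * b ^ 6)"
    by (rule mult_divide_mult_cancel_left) simp
  finally show "(?w ^ 1 * a) ^ 6 / (?w ^ 5 * b) ^ 6 = inverse (?w ^ 24) * (a ^ 6 * inverse b ^ 6)"
    by (simp add: divide_inverse power_inverse mult_ac)
  have "?w ^ 2 * a * (?w ^ 5 * b) ^ 5 = (?w ^ 2 * (?w ^ 5) ^ 5) * (a * b ^ 5)"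
    by (simp only: power_mult_distrib mult_ac)
  also have "?w ^ 2 * (?w ^ 5) ^ 5 = ?w ^ 27" by (simp flip: power_mult power_add)
  finally have n: "?w ^ 2 * a * (?w ^ 5 * b) ^ 5 = ?w ^ 27 * (a * b ^ 5)" .
  have "?w ^ 1 * c * (?w ^ 10 * d) ^ 5 = (?w ^ 1 * (?w ^ 10) ^ 5) * (c * d ^ 5)"
    by (simp only: power_mult_distrib mult_ac)
  also have "?w ^ 1 * (?w ^ 10) ^ 5 = ?w ^ 27 * ?w ^ 24"
    by (simp only: power_mult[symmetric] power_add[symmetric]) simp
  finally have d: "?w ^ 1 * c * (?w ^ 10 * d) ^ 5 = ?w ^ 27 * (?w ^ 24 * (c * d ^ 5))"
    by (simp only: mult.assoc)
  have "?w ^ 2 * a * (?w ^ 5 * b) ^ 5 / (?w ^ 1 * c * (?w ^ 10 * d) ^ 5) = a * b ^ 5 / (?w ^ 24 * (c * d ^ 5))"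
    unfolding n d by (rule mult_divide_mult_cancel_left) simp
  then show "?w ^ 2 * a * (?w ^ 5 * b) ^ 5 / (?w ^ 1 * c * (?w ^ 10 * d) ^ 5) =
      inverse (?w ^ 24) * (a * b ^ 5 * (inverse c * inverse d ^ 5))"
    by (simp add: divide_inverse power_inverse mult_ac)
qed

definition euler_inv :: "nat \<Rightarrow> int fps" where
  "euler_inv k = fps_right_inverse (euler k) 1"

lemma of_int_fps_euler_inv: "of_int_fps (euler_inv k) = inverse (euler k :: 'a::field fps)"
proof -
  have "euler k * euler_inv k = 1" unfolding euler_inv_def by (rule fps_right_inverse) simp
  from of_int_fps_inverse_unique[OF this] show ?thesis by (simp add: of_int_fps_euler)
qed

lemma euler_inv_nth_0 [simp]: "euler_inv k $ 0 = 1"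
  by (simp add: euler_inv_def)

lemma c5_eq: "c5 (int n) = (euler 1 ^ 6 * euler_inv 5 ^ 6) $ Suc n"
proof (rule fourier_coeff_eqI)
  let ?f = "\<lambda>k q. qpoch_inf (q ^ k) (q ^ k)"
  let ?h = "\<lambda>q. ?f 1 q ^ 6 * inverse (?f 5 q) ^ 6"
  show "?h holomorphic_on ball 0 1"
    by (intro holomorphic_intros euler_fun_holomorphic euler_fun_nonzero) auto
  show "?h has_fps_expansion of_int_fps (euler 1 ^ 6 * euler_inv 5 ^ 6)"
    unfolding of_int_fps_mult of_int_fps_power of_int_fps_euler of_int_fps_euler_inv
    by (intro fps_expansion_intros euler_fun_has_fps_expansion) auto
  show "(euler 1 ^ 6 * euler_inv 5 ^ 6 :: int fps) $ 0 = 1" by (simp add: fps_nth_power_0)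
  fix \<tau> :: complex assume "Im \<tau> > 0"
  show "j5 \<tau> = inverse (nome \<tau>) * ?h (nome \<tau>)"
    unfolding j5_def eta_eq using eta_base_cancel(1) by (simp only: nome_eq[of \<tau>])
qed

lemma c10_eq: "c10 (int n) = (euler 2 * euler 5 ^ 5 * (euler_inv 1 * euler_inv 10 ^ 5)) $ Suc n"
proof (rule fourier_coeff_eqI)
  let ?f = "\<lambda>k q. qpoch_inf (q ^ k) (q ^ k)"
  let ?h = "\<lambda>q. ?f 2 q * ?f 5 q ^ 5 * (inverse (?f 1 q) * inverse (?f 10 q) ^ 5)"
  show "?h holomorphic_on ball 0 1"
    by (intro holomorphic_intros euler_fun_holomorphic euler_fun_nonzero) auto
  show "?h has_fps_expansion of_int_fps (euler 2 * euler 5 ^ 5 * (euler_inv 1 * euler_inv 10 ^ 5))"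
    unfolding of_int_fps_mult of_int_fps_power of_int_fps_euler of_int_fps_euler_inv
    by (intro fps_expansion_intros euler_fun_has_fps_expansion) auto
  show "(euler 2 * euler 5 ^ 5 * (euler_inv 1 * euler_inv 10 ^ 5) :: int fps) $ 0 = 1" by (simp add: fps_nth_power_0)
  fix \<tau> :: complex assume "Im \<tau> > 0"
  show "j10 \<tau> = inverse (nome \<tau>) * ?h (nome \<tau>)"
    unfolding j10_def eta_eq using eta_base_cancel(2) by (simp only: nome_eq[of \<tau>])
qed

subsection \<open>Dissections of the cube of a quotient of Euler products\<close>

lemma euler_mult_inverse [simp]: "euler k * inverse (euler k :: bit fps) = 1"
  by (rule inverse_mult_eq_1') simp

lemma inverse_euler_square: "(inverse (euler k :: bit fps))\<^sup>2 = inverse (euler (2 * k))"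
  by (simp add: fps_inverse_power euler_square flip: fps_inverse_power)

lemma fps_X_power_compose: "k > 0 \<Longrightarrow> (fps_X ^ m :: bit fps) oo fps_X ^ k = fps_X ^ (k * m)"
  by (simp add: power_mult flip: fps_compose_power)

lemma euler_2_times_10: "(euler 2 * euler 10 :: bit fps) = euler 4 ^ 3 + fps_X ^ 2 * euler 20 ^ 3"
proof -
  have X: "(fps_X ^ 2 :: bit fps) $ 0 = 0" by simp
  have pow: "euler 2 ^ 6 = (euler 4 ^ 3 :: bit fps)" "euler 10 ^ 6 = (euler 20 ^ 3 :: bit fps)"
    using euler_square[of 2] euler_square[of 10] power_mult[of "euler 2 :: bit fps" 2 3]
      power_mult[of "euler 10 :: bit fps" 2 3] by simp_all
  have "euler 2 * euler 10 = (euler 1 * euler 5 :: bit fps) oo fps_X ^ 2"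
    unfolding fps_compose_mult_distrib[OF X] by (simp add: euler_compose)
  also have "\<dots> = (euler 1 ^ 6 oo fps_X ^ 2) + (fps_X ^ 1 oo fps_X ^ 2) * (euler 5 ^ 6 oo fps_X ^ 2)"
    unfolding euler_level_5_relation by (simp only: fps_compose_add_distrib fps_compose_mult_distrib[OF X] power_one_right)
  also have "\<dots> = euler 2 ^ 6 + fps_X ^ 2 * euler 10 ^ 6"
    unfolding euler_pow_compose[OF zero_less_numeral] fps_X_power_compose[OF zero_less_numeral] by simp
  finally show ?thesis unfolding pow .
qed

text \<open>The level 5 relation is applied twice: to f_1 f_5 in f_2 (f_1 f_5), and in q^2 to the
  product f_2 f_10 that then appears. Frobenius gives f_2^4 = f_8 and f_10^2 = f_20.\<close>

lemma euler_1_cube_times_5: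
  "(euler 1 ^ 3 * euler 5 :: bit fps) = euler 8 + euler 20 * (fps_X * euler 4 ^ 3 + fps_X ^ 3 * euler 20 ^ 3)"
proof -
  have pow: "euler 1 ^ 2 = (euler 2 :: bit fps)" "euler 1 ^ 6 = (euler 2 ^ 3 :: bit fps)"
     "euler 5 ^ 6 = (euler 10 ^ 3 :: bit fps)" "euler 2 ^ 4 = (euler 8 :: bit fps)" "euler 10 ^ 2 = (euler 20 :: bit fps)"
    using euler_square[of 1] euler_square[of 5] euler_square[of 10] euler_square[of 2] euler_square[of 4]
      power_mult[of "euler 1 :: bit fps" 2 3] power_mult[of "euler 5 :: bit fps" 2 3] power_mult[of "euler 2 :: bit fps" 2 2]
    by simp_all
  have "euler 1 ^ 3 * euler 5 = euler 1 ^ 2 * (euler 1 * euler 5 :: bit fps)"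
    by (simp add: power3_eq_cube power2_eq_square mult_ac)
  also have "\<dots> = euler 2 * (euler 2 ^ 3 + fps_X * euler 10 ^ 3)"
    unfolding euler_level_5_relation pow ..
  also have "\<dots> = euler 2 ^ 4 + fps_X * (euler 10 ^ 2 * (euler 2 * euler 10))"
    by (simp add: eval_nat_numeral algebra_simps)
  also have "\<dots> = euler 8 + fps_X * (euler 20 * (euler 4 ^ 3 + fps_X ^ 2 * euler 20 ^ 3))"
    unfolding euler_2_times_10 pow ..
  also have "\<dots> = euler 8 + euler 20 * (fps_X * euler 4 ^ 3 + fps_X ^ 3 * euler 20 ^ 3)"
    by (simp add: eval_nat_numeral algebra_simps)
  finally show ?thesis .
qed

definition cube_quot :: "bit fps" where
  "cube_quot = euler 1 ^ 3 * inverse (euler 5) ^ 3"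

text \<open>Expanding the fraction by f_5 makes the denominator f_5^4 = f_20, a series in
  q^4.\<close>

lemma cube_quot_dissection:
  "cube_quot = ((euler 2 * inverse (euler 5)) oo fps_X ^ 4) + fps_X * (euler 1 ^ 3 oo fps_X ^ 4) +
     fps_X ^ 3 * (euler 5 ^ 3 oo fps_X ^ 4)"
proof -
  let ?i = "inverse (euler 5) :: bit fps" and ?j = "inverse (euler 20) :: bit fps"
  have X: "(fps_X ^ 4 :: bit fps) $ 0 = 0" by simp
  have "?i ^ 4 = ?j"
    using inverse_euler_square[of 5] inverse_euler_square[of 10] power_mult[of ?i 2 2] by simp
  have "?i ^ 3 = euler 5 * ?i * ?i ^ 3" by simp
  also have "\<dots> = euler 5 * ?i ^ 4" by (simp add: eval_nat_numeral mult_ac)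
  finally have "cube_quot = (euler 1 ^ 3 * euler 5) * ?j"
    unfolding cube_quot_def \<open>?i ^ 4 = ?j\<close> by (simp only: mult.assoc)
  also have "\<dots> = euler 8 * ?j + (euler 20 * ?j) * (fps_X * euler 4 ^ 3 + fps_X ^ 3 * euler 20 ^ 3)"
    unfolding euler_1_cube_times_5 distrib_right by (simp only: mult_ac)
  also have "\<dots> = euler 8 * ?j + fps_X * euler 4 ^ 3 + fps_X ^ 3 * euler 20 ^ 3"
    by (simp add: add.assoc)
  also have "euler 8 * ?j = (euler 2 * inverse (euler 5)) oo fps_X ^ 4"
    unfolding fps_compose_mult_distrib[OF X] using inverse_euler_compose[of 4 5] by (simp add: euler_compose)
  also have "euler 4 ^ 3 = (euler 1 ^ 3 :: bit fps) oo fps_X ^ 4" by (simp add: euler_pow_compose)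
  also have "euler 20 ^ 3 = (euler 5 ^ 3 :: bit fps) oo fps_X ^ 4" by (simp add: euler_pow_compose)
  finally show ?thesis .
qed

lemma cube_quot_nth:
  "cube_quot $ (4 * n) = (euler 2 * inverse (euler 5)) $ n"
  "cube_quot $ (4 * n + 1) = (euler 1 ^ 3) $ n"
  "cube_quot $ (4 * n + 2) = 0"
  "cube_quot $ (4 * n + 3) = (euler 5 ^ 3) $ n"
proof -
  have m: "\<not> 4 dvd 4 * n + 1" "\<not> 4 dvd 4 * n + 2" "\<not> 4 dvd 4 * n + 3" "n > 0 \<Longrightarrow> \<not> 4 dvd 4 * n - 1"
      "n > 0 \<Longrightarrow> \<not> 4 dvd 4 * n - 3" "n > 0 \<Longrightarrow> \<not> 4 dvd 4 * n - 2"
    by presburger+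
  have nth: "cube_quot $ i = (if 4 dvd i then (euler 2 * inverse (euler 5)) $ (i div 4) else 0) +
      (if i = 0 then 0 else if 4 dvd i - 1 then (euler 1 ^ 3) $ ((i - 1) div 4) else 0) +
      (if i < 3 then 0 else if 4 dvd i - 3 then (euler 5 ^ 3) $ ((i - 3) div 4) else 0)" for i
    unfolding cube_quot_dissection by (simp add: fps_compose_X_power_nth fps_X_power_mult_nth)
  have "4 * n + 3 - 3 = 4 * n" "4 * n + 1 - 1 = 4 * n" "4 * n + 3 - 1 = 4 * n + 2" "4 * n + 2 - 1 = 4 * n + 1" by simp_all
  note s = this
  have "4 * n + 1 < 3 \<or> \<not> 4 dvd 4 * n + 1 - 3" "4 * n + 2 < 3 \<or> \<not> 4 dvd 4 * n + 2 - 3"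
      "4 * n < 3 \<or> \<not> 4 dvd 4 * n - 3" "4 * n = 0 \<or> \<not> 4 dvd 4 * n - 1"
    by presburger+
  note t = this
  show "cube_quot $ (4 * n) = (euler 2 * inverse (euler 5)) $ n"
    unfolding nth using t(3,4) by auto
  show "cube_quot $ (4 * n + 1) = (euler 1 ^ 3) $ n"
    unfolding nth s using m t(1) by auto
  show "cube_quot $ (4 * n + 2) = 0"
    unfolding nth s using m t(2) by auto
  show "cube_quot $ (4 * n + 3) = (euler 5 ^ 3) $ n"
    unfolding nth s using m by auto
qed

section \<open>Reduction of the Fourier coefficients modulo 2\<close>

lemma c5_bit: "(of_int (c5 (int n)) :: bit) = (euler 1 ^ 6 * inverse (euler 5) ^ 6) $ Suc n"
proof -
  have "(of_int (c5 (int n)) :: bit) = of_int_fps (euler 1 ^ 6 * euler_inv 5 ^ 6) $ Suc n"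
    unfolding c5_eq by simp
  then show ?thesis
    by (simp only: of_int_fps_mult of_int_fps_power of_int_fps_euler of_int_fps_euler_inv)
qed

text \<open>f_1^6/f_5^6 is the square of \<open>cube_quot\<close>, and squaring substitutes q^2 for
  q. The pole accounts for the shift by one.\<close>

lemma c5_bit_cube_quot:
  "(of_int (c5 (int n)) :: bit) = (if odd n then cube_quot $ (Suc n div 2) else 0)"
proof -
  have X: "(fps_X ^ 2 :: bit fps) $ 0 = 0" by simp
  have "euler 1 ^ 6 * inverse (euler 5) ^ 6 = (euler 2 ^ 3 * inverse (euler 10) ^ 3 :: bit fps)"
    using euler_square[of 1] inverse_euler_square[of 5] power_mult[of "euler 1 :: bit fps" 2 3]
      power_mult[of "inverse (euler 5) :: bit fps" 2 3] by simp
  also have "inverse (euler 10 :: bit fps) ^ 3 = inverse (euler 5) ^ 3 oo fps_X ^ 2"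
    using inverse_euler_compose[of 2 5] by (simp flip: fps_compose_power)
  also have "euler 2 ^ 3 = (euler 1 ^ 3 :: bit fps) oo fps_X ^ 2" by (simp add: euler_pow_compose)
  finally have "euler 1 ^ 6 * inverse (euler 5) ^ 6 = cube_quot oo fps_X ^ 2"
    unfolding cube_quot_def fps_compose_mult_distrib[OF X] .
  then show ?thesis unfolding c5_bit by (simp add: fps_compose_X_power_nth)
qed

text \<open>By Frobenius f_2 = f_1^2 and f_10 = f_5^2, so the quotient is f_1/f_5^5 = f_1 f_5/f_5^6,
  to which the level 5 relation applies.\<close>

lemma c10_bit:
  assumes "n \<ge> 1"
  shows "(of_int (c10 (int n)) :: bit) = of_int (c5 (int n))"
proof -
  let ?i = "inverse (euler 5) :: bit fps"
  have one: "euler 5 ^ m * ?i ^ m = 1" for m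
    by (simp flip: power_mult_distrib)
  have "(of_int (c10 (int n)) :: bit) = of_int_fps (euler 2 * euler 5 ^ 5 * (euler_inv 1 * euler_inv 10 ^ 5)) $ Suc n"
    unfolding c10_eq by simp
  also have "of_int_fps (euler 2 * euler 5 ^ 5 * (euler_inv 1 * euler_inv 10 ^ 5)) =
      (euler 2 * euler 5 ^ 5 * (inverse (euler 1) * inverse (euler 10) ^ 5) :: bit fps)"
    by (simp only: of_int_fps_mult of_int_fps_power of_int_fps_euler of_int_fps_euler_inv)
  also have "\<dots> = euler 1 * (euler 1 * inverse (euler 1)) * (euler 5 ^ 5 * ?i ^ 5) * ?i ^ 5"
  proof -
    have "euler 2 = (euler 1 * euler 1 :: bit fps)" using euler_square[of 1] by (simp add: power2_eq_square)
    moreover have "inverse (euler 10) ^ 5 = ?i ^ 5 * ?i ^ 5"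
      using inverse_euler_square[of 5] by (simp add: power2_eq_square power_mult_distrib[symmetric])
    ultimately show ?thesis by (simp only: mult_ac)
  qed
  also have "\<dots> = euler 1 * ?i ^ 5" unfolding one by simp
  also have "\<dots> = euler 1 * (euler 5 * ?i) * ?i ^ 5" by simp
  also have "\<dots> = (euler 1 * euler 5) * ?i ^ 6" by (simp add: eval_nat_numeral mult_ac)
  also have "\<dots> = euler 1 ^ 6 * ?i ^ 6 + fps_X * (euler 5 ^ 6 * ?i ^ 6)"
    unfolding euler_level_5_relation by (simp add: algebra_simps)
  \<comment> \<open>The second summand is X, which only meets the excluded index n = 0.\<close>
  also have "\<dots> $ Suc n = (euler 1 ^ 6 * ?i ^ 6) $ Suc n"
    unfolding one using assms by simp
  finally show ?thesis by (simp add: c5_bit)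
qed

subsection \<open>The parity of the coefficients\<close>

lemma of_int_bit_eq_0_iff: "(of_int a :: bit) = 0 \<longleftrightarrow> even a"
proof (cases "even a")
  case True
  then show ?thesis by (auto elim!: evenE)
next
  case False
  then show ?thesis by (auto elim!: oddE)
qed

lemma cong_2_iff_bit: "[a = b] (mod 2) \<longleftrightarrow> (of_int a :: bit) = of_int b"
proof -
  have "(of_int a :: bit) = of_int b \<longleftrightarrow> (of_int (a - b) :: bit) = 0"
    by (simp only: of_int_diff right_minus_eq)
  then show ?thesis by (simp only: of_int_bit_eq_0_iff cong_iff_dvd_diff)
qed

lemma c5_even: "(of_int (c5 (2 * int n)) :: bit) = 0"
  using c5_bit_cube_quot[of "2 * n"] by simp

text \<open>Adding 1 for the pole and halving sends the indices to 4n + 1, 4n + 2, 4n + 3 and 4(n +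
  1), one in each quarter of the 4-dissection.\<close>

lemma c5_8n: "(of_int (c5 (8 * int n + 1)) :: bit) = (euler 1 ^ 3) $ n"
    "(of_int (c5 (8 * int n + 3)) :: bit) = 0"
    "(of_int (c5 (8 * int n + 5)) :: bit) = (euler 5 ^ 3) $ n"
    "(of_int (c5 (8 * int n + 7)) :: bit) = (euler 2 * inverse (euler 5)) $ Suc n"
proof -
  have "int (8 * n + 1) = 8 * int n + 1" "int (8 * n + 3) = 8 * int n + 3"
      "int (8 * n + 5) = 8 * int n + 5" "int (8 * n + 7) = 8 * int n + 7" by simp_all
  note s = this
  have "Suc (8 * n + 1) div 2 = 4 * n + 1" "Suc (8 * n + 3) div 2 = 4 * n + 2"
      "Suc (8 * n + 5) div 2 = 4 * n + 3" "Suc (8 * n + 7) div 2 = 4 * Suc n" by presburger+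
  note d = this
  show "(of_int (c5 (8 * int n + 1)) :: bit) = (euler 1 ^ 3) $ n"
    using c5_bit_cube_quot[of "8 * n + 1"] unfolding s d cube_quot_nth by simp
  show "(of_int (c5 (8 * int n + 3)) :: bit) = 0"
    using c5_bit_cube_quot[of "8 * n + 3"] unfolding s d cube_quot_nth by simp
  show "(of_int (c5 (8 * int n + 5)) :: bit) = (euler 5 ^ 3) $ n"
    using c5_bit_cube_quot[of "8 * n + 5"] unfolding s d cube_quot_nth by simp
  show "(of_int (c5 (8 * int n + 7)) :: bit) = (euler 2 * inverse (euler 5)) $ Suc n"
    using c5_bit_cube_quot[of "8 * n + 7"] unfolding s d cube_quot_nth by simp
qed

lemma euler_5_cube_nth: "(euler 5 ^ 3 :: bit fps) $ n = (if 5 dvd n then (euler 1 ^ 3) $ (n div 5) else 0)"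
proof -
  have "(euler 5 ^ 3 :: bit fps) = euler 1 ^ 3 oo fps_X ^ 5" by (simp add: euler_pow_compose)
  then show ?thesis by (simp add: fps_compose_X_power_nth)
qed

text \<open>As f_5 is f_1 in q^5, its inverse does not mix residue classes modulo 5, and only f_2 is
  dissected.\<close>

lemma euler_2_over_5_nth:
  assumes "c < 5"
  shows "(euler 2 * inverse (euler 5) :: bit fps) $ (5 * n + c) = (fps_section 5 c (euler 2) * inverse (euler 1)) $ n"
proof -
  have "inverse (euler 5 :: bit fps) = inverse (euler 1) oo fps_X ^ 5"
    using inverse_euler_compose[of 5 1] by simp
  then have "fps_section 5 c (euler 2 * inverse (euler 5)) = (fps_section 5 c (euler 2) * inverse (euler 1) :: bit fps)"
    using fps_section_mult_compose[OF assms] by simp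
  from arg_cong[OF this, of "\<lambda>f. f $ n"] show ?thesis by simp
qed

lemma is_sq_double_iff: "is_sq (2 * n) = 1 \<longleftrightarrow> (\<exists>k::nat. n = k * (k + 1) div 2)"
proof -
  have "(\<exists>x::int. x * x = 4 * int (2 * n) + 1) \<longleftrightarrow> (\<exists>k::nat. n = k * (k + 1) div 2)"
  proof
    assume "\<exists>x::int. x * x = 4 * int (2 * n) + 1"
    then obtain x :: int where x: "x * x = 4 * int (2 * n) + 1" by blast
    define y where "y = nat \<bar>x\<bar>"
    have "int (y * y) = int (8 * n + 1)" using x by (simp add: y_def)
    then have y: "y * y = 8 * n + 1" by (simp only: of_nat_eq_iff)
    then have "odd (y * y)" by simp
    then have "odd y" by simp
    then obtain k where "y = 2 * k + 1" by (auto elim: oddE)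
    then have "4 * (k * (k + 1)) = 8 * n" using y by (simp add: algebra_simps)
    then have "k * (k + 1) = 2 * n" by simp
    then have "n = k * (k + 1) div 2" by simp
    then show "\<exists>k::nat. n = k * (k + 1) div 2" ..
  next
    assume "\<exists>k::nat. n = k * (k + 1) div 2"
    then obtain k :: nat where "n = k * (k + 1) div 2" ..
    moreover have "even (k * (k + 1))" by simp
    ultimately have "2 * n = k * (k + 1)" by (simp only: dvd_mult_div_cancel)
    then have "int (2 * n) = int k * (int k + 1)" by (metis of_nat_1 of_nat_add of_nat_mult)
    then have "(2 * int k + 1) * (2 * int k + 1) = 4 * int (2 * n) + 1"
      by (simp add: algebra_simps)
    then show "\<exists>x::int. x * x = 4 * int (2 * n) + 1" ..
  qed
  then show ?thesis unfolding is_sq_def by simp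
qed

theorem theorem1p3:
  shows "(\<forall>n::nat. n \<ge> 1 \<longrightarrow> [c5 (int n) = c10 (int n)] (mod 2)) \<and>
    \<comment> \<open>(1)\<close>
    (\<forall>n::nat. n \<ge> 1 \<longrightarrow> [c5 (2 * int n) = 0] (mod 2)) \<and>
    (\<forall>n::nat. [c5 (8 * int n + 3) = 0] (mod 2)) \<and>
    (\<forall>n::nat. \<forall>i\<in>{1, 2, 3, 4}. [c5 (40 * int n + 5 + 8 * i) = 0] (mod 2)) \<and>
    (\<forall>n::nat. \<forall>j\<in>{0, 2}. [c5 (40 * int n + 7 + 8 * j) = 0] (mod 2)) \<and>
    \<comment> \<open>(2)\<close>
    (\<forall>n::nat. n \<ge> 1 \<longrightarrow> [c5 (40 * int n - 1) = fps_nth X10 n] (mod 2)) \<and>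
    \<comment> \<open>(3)\<close>
    (\<forall>n::nat. n \<ge> 1 \<longrightarrow> [c5 (40 * int n - 9) = fps_nth chi10 n] (mod 2)) \<and>
    \<comment> \<open>(4)\<close>
    (\<forall>n::nat. [c5 (8 * int n + 1) = c5 (40 * int n + 5)] (mod 2)) \<and>
    (\<forall>n::nat. [c5 (8 * int n + 1) = 1] (mod 2) \<longleftrightarrow> (\<exists>k::nat. n = k * (k + 1) div 2)) \<and>
    \<comment> \<open>(5)\<close>
    (\<forall>n::nat. [c5 (40 * int n + 15) = int (p10 n)] (mod 2))"
  unfolding cong_2_iff_bit of_int_0 of_int_1 of_int_of_nat_eq
proof (intro conjI allI impI ballI)
  fix n :: nat
  show "(of_int (c5 (int n)) :: bit) = of_int (c10 (int n))" if "n \<ge> 1"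
    using c10_bit[OF that] by simp
  show "(of_int (c5 (2 * int n)) :: bit) = 0" by (rule c5_even)
  show "(of_int (c5 (8 * int n + 3)) :: bit) = 0" by (rule c5_8n)
  show "(of_int (c5 (40 * int n + 5 + 8 * i)) :: bit) = 0" if i: "i \<in> {1, 2, 3, 4}" for i
  proof -
    \<comment> \<open>The index is 8m + 5 with m prime to 5, while f_5^3 is a series in q^5.\<close>
    define m where "m = 5 * n + nat i"
    have eq: "40 * int n + 5 + 8 * i = 8 * int m + 5" using i by (auto simp: m_def)
    have "m = 5 * n + 1 \<or> m = 5 * n + 2 \<or> m = 5 * n + 3 \<or> m = 5 * n + 4" using i by (auto simp: m_def)
    then have "\<not> 5 dvd m" by presburger
    then show ?thesis unfolding eq c5_8n by (simp add: euler_5_cube_nth)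
  qed
  show "(of_int (c5 (40 * int n + 7 + 8 * j)) :: bit) = 0" if j: "j \<in> {0, 2}" for j
  proof -
    \<comment> \<open>The index is 8m + 7, and m + 1 is 1 or 3 modulo 5, the classes absent from
      f_2.\<close>
    define m where "m = 5 * n + nat j"
    define c where "c = nat j + 1"
    have c: "c = 1 \<or> c = 3" using j by (auto simp: c_def)
    have "40 * int n + 7 + 8 * j = 8 * int m + 7" using j by (auto simp: m_def)
    moreover have "Suc m = 5 * n + c" by (simp add: m_def c_def)
    ultimately have "(of_int (c5 (40 * int n + 7 + 8 * j)) :: bit) = (fps_section 5 c (euler 2) * inverse (euler 1)) $ n"
      using euler_2_over_5_nth[of c n] c by (auto simp only: c5_8n)
    then show ?thesis unfolding euler_2_section_1_3[OF c] by simp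
  qed
  show "(of_int (c5 (40 * int n - 1)) :: bit) = of_int (X10 $ n)" if n: "n \<ge> 1"
  proof -
    define m where "m = 5 * n - 1"
    have m: "40 * int n - 1 = 8 * int m + 7" "Suc m = 5 * n + 0" using n by (auto simp: m_def of_nat_diff)
    have "(of_int (c5 (40 * int n - 1)) :: bit) = (fps_section 5 0 (euler 2) * inverse (euler 1)) $ n"
      unfolding m c5_8n by (rule euler_2_over_5_nth) simp
    then show ?thesis by (simp only: of_int_fps_X10[symmetric] of_int_fps_nth)
  qed
  show "(of_int (c5 (40 * int n - 9)) :: bit) = of_int (chi10 $ n)" if n: "n \<ge> 1"
  proof -
    \<comment> \<open>40n - 9 = 8m + 7 with m + 1 = 5n - 1 = 5(n - 1) + 4; the factor X in the
      section formula undoes the shift to n - 1.\<close>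
    define m where "m = 5 * n - 2"
    define l where "l = n - 1"
    have m: "40 * int n - 9 = 8 * int m + 7" "Suc m = 5 * l + 4" using n by (auto simp: m_def l_def of_nat_diff)
    have "(of_int (c5 (40 * int n - 9)) :: bit) = (fps_section 5 4 (euler 2) * inverse (euler 1)) $ l"
      unfolding m c5_8n by (rule euler_2_over_5_nth) simp
    also have "\<dots> = (fps_X * (fps_section 5 4 (euler 2) * inverse (euler 1))) $ n"
      using n by (simp add: l_def)
    also have "\<dots> = of_int_fps chi10 $ n" by (simp only: of_int_fps_chi10 mult.assoc)
    finally show ?thesis by simp
  qed
  show "(of_int (c5 (8 * int n + 1)) :: bit) = of_int (c5 (40 * int n + 5))"
  proof -
    have "40 * int n + 5 = 8 * int (5 * n) + 5" by simp
    then show ?thesis by (simp only: c5_8n euler_5_cube_nth) simp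
  qed
  show "(of_int (c5 (8 * int n + 1)) :: bit) = 1 \<longleftrightarrow> (\<exists>k::nat. n = k * (k + 1) div 2)"
    unfolding c5_8n euler_1_cube_nth by (rule is_sq_double_iff)
  show "(of_int (c5 (40 * int n + 15)) :: bit) = of_nat (p10 n)"
  proof -
    have m: "40 * int n + 15 = 8 * int (5 * n + 1) + 7" by simp
    have "Suc (5 * n + 1) = 5 * n + 2" by simp
    then have "(of_int (c5 (40 * int n + 15)) :: bit) = (fps_section 5 2 (euler 2) * inverse (euler 1)) $ n"
      unfolding m c5_8n using euler_2_over_5_nth[of 2 n] by simp
    then show ?thesis by (simp only: euler_2_section_2 p10_gf)
  qed
qed

end
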